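(* Let $\boldsymbol{W}=(\boldsymbol{W}_t)_{t\ge 0}=(X_t,Y_t)_{t\ge0}$ be standard planar Brownian motion started at the origin, let $\mathbb{D}=\{\boldsymbol{x}\in\mathbb{R}^2:\|\boldsymbol{x}\|<1\}$ and $\tau_{\mathbb{D}}=\inf\{t\ge0:\boldsymbol{W}_t\notin\mathbb{D}\}$. Define the maximum horizontal displacement $$M=\sup_{0\le t\le \tau_{\mathbb{D}}} X_t .$$ Then the cumulative distribution function of $M$ is $$\mathbb{P}(M<a)=\frac{2\arcsin a}{\pi-\arccos a},\qquad 0<a<1.$$ Furthermore, $$\mathbb{E}[M]=\int_0^{\pi/2}\left(1-\frac{2t}{\frac{\pi}{2}+t}\right)\cos t\,dt\approx 0.511655 .$$ Consequently, if $\mathsf{P}_{\tau_{\mathbb{D}}}$ denotes the perimeter of the convex hull of the path $\{\boldsymbol{W}_t:0\le t\le\tau_{\mathbb{D}}\}$, then $$\mathbb{E}[\mathsf{P}_{\tau_{\mathbb{D}}}]=2\pi\,\mathbb{E}[M]\approx 3.214826 .$$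
   Context: The convex hull of a set $\mathcal{A}\subset\mathbb{R}^2$ is the intersection of all convex subsets of $\mathbb{R}^2$ containing $\mathcal{A}$. *)

theory Defs
  imports "HOL-Analysis.Analysis" "HOL-Probability.Probability"
begin

definition coord_incr :: "(real \<Rightarrow> 'a \<Rightarrow> real) \<Rightarrow> (real \<Rightarrow> 'a \<Rightarrow> real) \<Rightarrow> real list
    \<Rightarrow> nat \<times> bool \<Rightarrow> 'a \<Rightarrow> real" where
  "coord_incr X Y ts = (\<lambda>(i, c) \<omega>. let Z = (if c then X else Y) in
      Z ((0 # ts) ! Suc i) \<omega> - Z ((0 # ts) ! i) \<omega>)"

definition std_planar_BM :: "'a measure \<Rightarrow> (real \<Rightarrow> 'a \<Rightarrow> real) \<Rightarrow> (real \<Rightarrow> 'a \<Rightarrow> real) \<Rightarrow> bool" where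
  "std_planar_BM M X Y \<longleftrightarrow>
     prob_space M \<and>
     (\<forall>t\<ge>0. X t \<in> borel_measurable M \<and> Y t \<in> borel_measurable M) \<and>
     (\<forall>\<omega>\<in>space M. X 0 \<omega> = 0 \<and> Y 0 \<omega> = 0 \<and>
        continuous_on {0..} (\<lambda>t. X t \<omega>) \<and> continuous_on {0..} (\<lambda>t. Y t \<omega>)) \<and>
     (\<forall>ts::real list. sorted_wrt (<) (0 # ts) \<longrightarrow>
        prob_space.indep_vars M (\<lambda>_. borel) (coord_incr X Y ts) ({..<length ts} \<times> UNIV) \<and>
        (\<forall>i<length ts. \<forall>c. distributed M lborel (coord_incr X Y ts (i, c))
            (\<lambda>x. ennreal (normal_density 0 (sqrt ((0 # ts) ! Suc i - (0 # ts) ! i)) x))))"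

definition curve_length :: "(real \<Rightarrow> 'b::metric_space) \<Rightarrow> ereal" where
  "curve_length g = (SUP ts \<in> {ts. sorted ts \<and> set ts \<subseteq> {0..1}}.
      ereal (\<Sum>i<length ts - 1. dist (g (ts ! i)) (g (ts ! Suc i))))"

text \<open>Perimeter of a (compact convex) planar set: length of its boundary, i.e. the least
length of a closed curve tracing exactly its frontier (for a segment this is twice its length).\<close>
definition perimeter :: "(real \<times> real) set \<Rightarrow> real" where
  "perimeter K = real_of_ereal (INF g \<in> {g. path g \<and> pathfinish g = pathstart g \<and>
      path_image g = frontier K}. curve_length g)"

definition unit_disc :: "(real \<times> real) set" where
  "unit_disc = {p. norm p < 1}"

definition exit_time :: "(real \<Rightarrow> 'a \<Rightarrow> real) \<Rightarrow> (real \<Rightarrow> 'a \<Rightarrow> real) \<Rightarrow> 'a \<Rightarrow> real" where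
  "exit_time X Y \<omega> = Inf {t. 0 \<le> t \<and> (X t \<omega>, Y t \<omega>) \<notin> unit_disc}"

definition max_horiz :: "(real \<Rightarrow> 'a \<Rightarrow> real) \<Rightarrow> (real \<Rightarrow> 'a \<Rightarrow> real) \<Rightarrow> 'a \<Rightarrow> real" where
  "max_horiz X Y \<omega> = Sup ((\<lambda>t. X t \<omega>) ` {0..exit_time X Y \<omega>})"

definition hull_perimeter :: "(real \<Rightarrow> 'a \<Rightarrow> real) \<Rightarrow> (real \<Rightarrow> 'a \<Rightarrow> real) \<Rightarrow> 'a \<Rightarrow> real" where
  "hull_perimeter X Y \<omega> = perimeter (convex hull ((\<lambda>t. (X t \<omega>, Y t \<omega>)) ` {0..exit_time X Y \<omega>}))"

end

theory Submission
  imports Defs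
begin

text \<open>
  For complex \<open>\<mu>\<close> the process \<open>exp (\<mu> (X + i Y))\<close> is a martingale, because \<open>X\<close> and \<open>Y\<close> are independent
  and \<open>E exp (\<mu> N) = exp (\<mu>\<^sup>2 v / 2)\<close>, \<open>E exp (i \<mu> N) = exp (- \<mu>\<^sup>2 v / 2)\<close> for centred Gaussians of
  variance \<open>v\<close>. Optional stopping at the exit from a bounded open set gives \<open>E exp (\<mu> Q) = 1\<close> for the
  exit point \<open>Q\<close>. For the part of the disc where \<open>x < a\<close>, a Laplace transform in real \<open>\<mu>\<close> turns this
  into \<open>E (1 / (w - Q)) = 1 / w\<close> for \<open>Re w > a\<close>, and integrating \<open>w\<close> along a chord slightly to the
  right of the segment \<open>x = a\<close> gives the mean of the angle under which that chord is seen from \<open>Q\<close>.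
  The limiting angle is \<open>\<pi>\<close> on the segment and, by the inscribed angle theorem, \<open>arccos a\<close> on the arc,
  whereas it is \<open>2 arccos a\<close> seen from the origin; this determines the probability of leaving through
  the arc, that is, the law of the maximal displacement. Since \<open>\<mu>\<close> is complex, the same law holds for the
  displacement in every direction.

  The perimeter of a planar compact convex set is the integral of its support function (Cauchy). A
  closed curve tracing the frontier has length at least this integral, by projecting its inscribed
  polygons to all lines through the origin; conversely, projecting a circumscribed polygon onto the
  convex set yields frontier curves of nearly this length. Taking means of Riemann sums gives the last
  claim.
\<close>

section \<open>Exponential moments of planar Brownian motion\<close>

text \<open>The hypothesis on the motion speaks only of finitely many increments and of continuous
  paths, not of a filtration or a strong Markov property. Optional stopping is therefore built from
  grids. The event of staying in an open set up to a fixed time is a countable combination of grid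
  events, so the martingale identity holds on it, and the exit time rounded up to a mesh turns the
  stopped exponential into a finite sum of such terms. Rounding up may carry the path out of the
  set, hence the values are unbounded, and the mesh is sent to 0 by means of second moments. The
  resolvent identity needs \<open>Re w > a\<close>, since only there does the Laplace integral
  converge for every position of \<open>Q\<close>. The segment itself is thus reached as a limit,
  which forces a separate argument that \<open>Q\<close> avoids its two endpoints. The constant
  0.511655 comes from \<open>s = t + pi / 2\<close>, under which the integrand becomes
  \<open>(pi / s - 1) * sin s\<close>, so that the mean is
  \<open>pi * (Si pi - Si (pi / 2)) - 1\<close> with \<open>Si\<close> the sine integral. Rational
  bounds for \<open>pi\<close> and a truncated series for \<open>Si\<close> then suffice.\<close>

lemma has_bochner_integral_exp_normal_density:
  fixes z :: complex and s :: real
  assumes "s > 0"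
  shows "has_bochner_integral lborel (\<lambda>x. normal_density 0 s x *\<^sub>R exp (z * of_real x))
           (exp (z\<^sup>2 * of_real (s\<^sup>2) / 2))"
proof -
  define p q where "p = Re z" and "q = Im z"
  have z: "z = of_real p + \<i> * of_real q" by (simp add: p_def q_def complex_eq)
  have "integrable std_normal_distribution (\<lambda>y. iexp ((q * s) * y))"
    by (intro finite_measure.integrable_const_bound[where B=1] prob_space.finite_measure
        prob_space_normal_density) auto
  moreover have "(CLINT y|std_normal_distribution. iexp ((q * s) * y)) = exp (- ((q * s)\<^sup>2) / 2)"
    using fun_cong[OF char_std_normal_distribution, of "q * s"] by (simp add: char_def exp_of_real)
  ultimately have std: "has_bochner_integral lborel (\<lambda>y. std_normal_density y *\<^sub>R iexp ((q * s) * y))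
      (exp (- ((q * s)\<^sup>2) / 2))"
    by (simp add: has_bochner_integral_iff integrable_density integral_density)
  \<comment> \<open>Completing the square: centring at \<open>p * s\<^sup>2\<close> removes the real
    part \<open>p\<close> of \<open>z\<close>, and what remains is the characteristic function of
    the standard normal law at \<open>q * s\<close>.\<close>
  have shift: "normal_density 0 s (p * s\<^sup>2 + s * y) *\<^sub>R exp (z * of_real (p * s\<^sup>2 + s * y)) =
     (std_normal_density y *\<^sub>R iexp ((q * s) * y)) * (exp (z * p * s\<^sup>2 - p\<^sup>2* s\<^sup>2/2) / s)" for y
  proof -
    define E where "E = p * s * y + p\<^sup>2 * s\<^sup>2/2"
    have "- (p * s\<^sup>2 + s * y)\<^sup>2 / (2 * s\<^sup>2) = - (y\<^sup>2/2) - E"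
      using assms by (simp add: E_def field_simps power2_eq_square)
    then have "exp (- (p * s\<^sup>2 + s * y)\<^sup>2 / (2 * s\<^sup>2)) = exp (- (y\<^sup>2/2)) * exp (- E)"
      by (simp only: exp_add[symmetric]) simp
    then have 1: "normal_density 0 s (p * s\<^sup>2 + s * y) = std_normal_density y * exp (- E) / s"
      using assms by (simp add: normal_density_def real_sqrt_mult)
    have 2: "exp (z * of_real (p * s\<^sup>2 + s * y)) = iexp ((q * s) * y) * exp E *
        exp (z * p * s\<^sup>2 - p\<^sup>2 * s\<^sup>2/2)"
      unfolding exp_add[symmetric] exp_of_real[symmetric] E_def
      by (rule arg_cong[of _ _ exp]) (simp add: z algebra_simps)
    have "of_real (exp (- E)) * of_real (exp E) = (1::complex)"
      by (metis exp_minus_inverse mult.commute of_real_1 of_real_mult)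
    then show ?thesis
      unfolding 1 2 scaleR_conv_of_real of_real_mult of_real_divide by (simp add: field_simps)
  qed
  have "exp (z\<^sup>2 * of_real (s\<^sup>2) / 2) = exp (- ((q * s)\<^sup>2) / 2) * exp (z * p * s\<^sup>2 - p\<^sup>2* s\<^sup>2/2)"
    unfolding exp_of_real[symmetric] exp_add[symmetric] by (rule arg_cong[of _ _ exp])
      (simp add: z field_simps power2_eq_square)
  moreover have mult: "has_bochner_integral lborel (\<lambda>y. std_normal_density y *\<^sub>R iexp ((q * s) * y) * (exp (z * p * s\<^sup>2 - p\<^sup>2 * s\<^sup>2/2) / s))
     (of_real (exp (- ((q * s)\<^sup>2) / 2)) * (exp (z * p * s\<^sup>2 - p\<^sup>2 * s\<^sup>2/2) / s))"
    by (intro has_bochner_integral_mult_left std)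
  ultimately have "has_bochner_integral lborel (\<lambda>y. normal_density 0 s (p * s\<^sup>2 + s * y) *\<^sub>R exp (z * of_real (p * s\<^sup>2 + s * y)))
     (exp (z\<^sup>2 * of_real (s\<^sup>2) / 2) /\<^sub>R \<bar>s\<bar>)"
    unfolding shift using assms
    using mult
    by (simp add: scaleR_conv_of_real field_simps)
  then show ?thesis
    by (subst lborel_has_bochner_integral_real_affine_iff[of s _ _ "p * s\<^sup>2"]) (use assms in auto)
qed

lemma (in prob_space) exp_normal_expectation:
  fixes z :: complex
  assumes "distributed M lborel N (\<lambda>x. ennreal (normal_density 0 s x))" "s > 0"
  shows "integrable M (\<lambda>\<omega>. exp (z * of_real (N \<omega>)))"
    and "expectation (\<lambda>\<omega>. exp (z * of_real (N \<omega>))) = exp (z\<^sup>2 * of_real (s\<^sup>2) / 2)"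
proof -
  have N[measurable]: "N \<in> borel_measurable M" using distributed_measurable[OF assms(1)] by simp
  have "distr M borel N = density lborel (\<lambda>x. ennreal (normal_density 0 s x))"
    using distributed_distr_eq_density[OF assms(1)] by (metis distr_cong sets_lborel)
  then have "has_bochner_integral (distr M borel N) (\<lambda>x. exp (z * of_real x)) (exp (z\<^sup>2 * of_real (s\<^sup>2) / 2))"
    using has_bochner_integral_exp_normal_density[OF assms(2), of z]
    by (simp add: has_bochner_integral_iff integrable_density integral_density)
  then show "integrable M (\<lambda>\<omega>. exp (z * of_real (N \<omega>)))"
    and "expectation (\<lambda>\<omega>. exp (z * of_real (N \<omega>))) = exp (z\<^sup>2 * of_real (s\<^sup>2) / 2)"
    by (simp_all add: has_bochner_integral_iff integrable_distr_eq integral_distr)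
qed

text \<open>The two coordinates carry separate exponents because two cases are wanted:
  \<open>\<beta> = \<i> * \<alpha>\<close> gives \<open>exp (\<alpha> * z)\<close>, whose mean is
  constant in time as \<open>\<alpha>\<^sup>2 + \<beta>\<^sup>2 = 0\<close>, and real exponents give
  its squared modulus.\<close>

definition biexp :: "complex \<Rightarrow> complex \<Rightarrow> complex \<Rightarrow> complex" where
  "biexp \<alpha> \<beta> z = exp (\<alpha> * of_real (Re z) + \<beta> * of_real (Im z))"

lemma borel_measurable_biexp[measurable]: "biexp \<alpha> \<beta> \<in> borel_measurable borel"
  unfolding biexp_def by (intro borel_measurable_continuous_onI continuous_intros)

lemma biexp_add: "biexp \<alpha> \<beta> (z + w) = biexp \<alpha> \<beta> z * biexp \<alpha> \<beta> w"
  by (simp add: biexp_def exp_add[symmetric] algebra_simps)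

locale planar_BM =
  fixes M :: "'a measure" and X Y :: "real \<Rightarrow> 'a \<Rightarrow> real"
  assumes BM: "std_planar_BM M X Y"

sublocale planar_BM \<subseteq> prob_space M
  using BM by (simp add: std_planar_BM_def)

context planar_BM
begin

definition Z :: "real \<Rightarrow> 'a \<Rightarrow> complex" where "Z t \<omega> = Complex (X t \<omega>) (Y t \<omega>)"

lemma X_measurable[measurable]: "0 \<le> t \<Longrightarrow> X t \<in> borel_measurable M"
  and Y_measurable[measurable]: "0 \<le> t \<Longrightarrow> Y t \<in> borel_measurable M"
  using BM by (auto simp: std_planar_BM_def)

lemma Z_measurable[measurable]: "0 \<le> t \<Longrightarrow> Z t \<in> borel_measurable M"
  unfolding Z_def Complex_eq by measurable

lemma Z_0: "\<omega> \<in> space M \<Longrightarrow> Z 0 \<omega> = 0"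
  using BM by (simp add: std_planar_BM_def Z_def zero_complex.code)

lemma continuous_on_Z: "\<omega> \<in> space M \<Longrightarrow> continuous_on {0..} (\<lambda>t. Z t \<omega>)"
  using BM unfolding Z_def Complex_eq
  by (intro continuous_intros continuous_on_compose2[of UNIV of_real]) (auto simp: std_planar_BM_def)

lemma biexp_increment:
  assumes "0 \<le> s" "s < t"
  shows "integrable M (\<lambda>\<omega>. biexp \<alpha> \<beta> (Z t \<omega> - Z s \<omega>))"
    and "expectation (\<lambda>\<omega>. biexp \<alpha> \<beta> (Z t \<omega> - Z s \<omega>)) = exp ((\<alpha>\<^sup>2 + \<beta>\<^sup>2) * of_real (t - s) / 2)"
proof -
  \<comment> \<open>The times are prefixed with 0 and must increase strictly, so
    \<open>s = 0\<close> may not be listed a second time.\<close>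
  define ts where "ts = (if s = 0 then [t] else [s, t])"
  define i where "i = length ts - 1"
  have ts: "sorted_wrt (<) (0 # ts)" "i < length ts" "(0 # ts) ! Suc i = t" "(0 # ts) ! i = s"
    using assms by (auto simp: ts_def i_def)
  have incr: "coord_incr X Y ts (i, True) \<omega> = Re (Z t \<omega> - Z s \<omega>)"
       "coord_incr X Y ts (i, False) \<omega> = Im (Z t \<omega> - Z s \<omega>)" for \<omega>
    using ts(3,4) by (auto simp: coord_incr_def Z_def)
  have iv: "indep_vars (\<lambda>_. borel) (coord_incr X Y ts) ({..<length ts} \<times> UNIV)"
    and d: "\<And>c. distributed M lborel (coord_incr X Y ts (i, c))
            (\<lambda>x. ennreal (normal_density 0 (sqrt (t - s)) x))"
    using BM ts unfolding std_planar_BM_def by metis+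
  have "indep_var borel ((\<lambda>w. exp (\<alpha> * of_real (w (i, True)))) \<circ> (\<lambda>\<omega>. restrict (\<lambda>k. coord_incr X Y ts k \<omega>) {(i, True)}))
                  borel ((\<lambda>w. exp (\<beta> * of_real (w (i, False)))) \<circ> (\<lambda>\<omega>. restrict (\<lambda>k. coord_incr X Y ts k \<omega>) {(i, False)}))"
    by (rule indep_var_compose[OF indep_var_restrict[OF iv]])
       (use ts in \<open>auto intro!: measurable_compose[OF measurable_component_singleton]\<close>)
  then have iv2: "indep_var borel (\<lambda>\<omega>. exp (\<alpha> * of_real (coord_incr X Y ts (i, True) \<omega>)))
                       borel (\<lambda>\<omega>. exp (\<beta> * of_real (coord_incr X Y ts (i, False) \<omega>)))"
    by (simp add: comp_def)
  have pos: "sqrt (t - s) > 0" using assms by simp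
  note I = indep_var_integrable[OF iv2 exp_normal_expectation(1)[OF d pos] exp_normal_expectation(1)[OF d pos]]
  note E = indep_var_lebesgue_integral[OF iv2 exp_normal_expectation(1)[OF d pos] exp_normal_expectation(1)[OF d pos]]
  show "integrable M (\<lambda>\<omega>. biexp \<alpha> \<beta> (Z t \<omega> - Z s \<omega>))"
    using I unfolding biexp_def incr exp_add .
  show "expectation (\<lambda>\<omega>. biexp \<alpha> \<beta> (Z t \<omega> - Z s \<omega>)) = exp ((\<alpha>\<^sup>2 + \<beta>\<^sup>2) * of_real (t - s) / 2)"
    using E[unfolded exp_normal_expectation(2)[OF d pos]] assms
    unfolding incr biexp_def exp_add[symmetric] by (simp add: add_divide_distrib distrib_right)
qed

lemma integrable_biexp: "0 \<le> t \<Longrightarrow> integrable M (\<lambda>\<omega>. biexp \<alpha> \<beta> (Z t \<omega>))"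
proof (cases "t = 0")
  case True
  then show ?thesis
    by (intro Bochner_Integration.integrable_cong[THEN iffD1, OF refl _ integrable_const[of 1]]) (auto simp: Z_0 biexp_def)
next
  case False
  moreover assume "0 \<le> t"
  ultimately have "integrable M (\<lambda>\<omega>. biexp \<alpha> \<beta> (Z t \<omega> - Z 0 \<omega>))"
    by (intro biexp_increment) auto
  then show ?thesis
    by (rule Bochner_Integration.integrable_cong[THEN iffD1, OF refl, rotated]) (simp add: Z_0)
qed

text \<open>Positions at grid times are partial sums of the increments, so the event and
  \<open>Z t\<close> depend only on increments up to \<open>t\<close>, which are independent of the
  last one. This is the martingale step restricted to a past event.\<close>

lemma grid_past_indep:
  assumes ts: "sorted_wrt (<) (0 # ts @ [T])" and C[measurable]: "C \<in> sets borel"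
  defines "t \<equiv> last (0 # ts)"
  shows "integrable M (\<lambda>\<omega>. indicator {\<omega>. \<forall>s\<in>set ts. Z s \<omega> \<in> C} \<omega> * biexp \<alpha> \<beta> (Z T \<omega>))" (is ?I)
    and "expectation (\<lambda>\<omega>. indicator {\<omega>. \<forall>s\<in>set ts. Z s \<omega> \<in> C} \<omega> * biexp \<alpha> \<beta> (Z T \<omega>)) =
       expectation (\<lambda>\<omega>. indicator {\<omega>. \<forall>s\<in>set ts. Z s \<omega> \<in> C} \<omega> * biexp \<alpha> \<beta> (Z t \<omega>)) *
       exp ((\<alpha>\<^sup>2 + \<beta>\<^sup>2) * of_real (T - t) / 2)" (is ?E)
proof -
  define n where "n = length ts"
  define D where "D = coord_incr X Y (ts @ [T])"
  define S where "S = (\<lambda>(w :: nat \<times> bool \<Rightarrow> real) i. Complex (\<Sum>l<i. w (l, True)) (\<Sum>l<i. w (l, False)))"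
  define f where "f w = (if \<forall>i<n. S w (Suc i) \<in> C then biexp \<alpha> \<beta> (S w n) else 0)" for w
  define g where "g w = biexp \<alpha> \<beta> (Complex (w (n, True)) (w (n, False)))" for w :: "nat \<times> bool \<Rightarrow> real"
  have t_nth: "t = (0 # ts) ! n" unfolding t_def n_def by (subst last_conv_nth) auto
  have iv: "indep_vars (\<lambda>_. borel) D ({..<Suc n} \<times> UNIV)"
    using BM ts unfolding std_planar_BM_def D_def n_def by (metis append_Cons length_append_singleton)
  have S_D: "S (\<lambda>i. D i \<omega>) i = Z ((0 # ts) ! i) \<omega>" if "\<omega> \<in> space M" "i \<le> n" for \<omega> i
    using that(2)
  proof (induction i)
    case 0 then show ?case using that by (simp add: S_def Z_0 zero_complex.code)
  next
    case (Suc i)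
    then show ?case
      by (auto simp: S_def D_def coord_incr_def Z_def nth_append nth_Cons' n_def)
  qed
  have S_meas[measurable]: "(\<lambda>w. S w i) \<in> borel_measurable (PiM ({..<n} \<times> UNIV) (\<lambda>_. borel))" if "i \<le> n" for i
    unfolding S_def Complex_eq using that
    by (intro borel_measurable_add borel_measurable_times borel_measurable_of_real borel_measurable_sum
        measurable_component_singleton) auto
  have f_meas: "f \<in> borel_measurable (PiM ({..<n} \<times> UNIV) (\<lambda>_. borel))"
    unfolding f_def
  proof (intro measurable_If)
    have "{w \<in> space (PiM ({..<n} \<times> UNIV) (\<lambda>_. borel)). \<forall>i\<in>{..<n}. S w (Suc i) \<in> C} \<in> sets (PiM ({..<n} \<times> UNIV) (\<lambda>_. borel))"
      using measurable_sets[OF S_meas C] by (intro sets.sets_Collect_finite_All) (auto simp: vimage_def Int_def conj_commute)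
    then show "{w \<in> space (PiM ({..<n} \<times> UNIV) (\<lambda>_. borel)). \<forall>i<n. S w (Suc i) \<in> C} \<in> sets (PiM ({..<n} \<times> UNIV) (\<lambda>_. borel))"
      by simp
  qed (auto intro: measurable_compose[OF S_meas])
  have g_meas: "g \<in> borel_measurable (PiM ({n} \<times> UNIV) (\<lambda>_. borel))"
    unfolding g_def Complex_eq by measurable
  have "indep_var borel (f \<circ> (\<lambda>\<omega>. restrict (\<lambda>i. D i \<omega>) ({..<n} \<times> UNIV)))
                  borel (g \<circ> (\<lambda>\<omega>. restrict (\<lambda>i. D i \<omega>) ({n} \<times> UNIV)))"
    by (rule indep_var_compose[OF indep_var_restrict[OF iv]] f_meas g_meas)+ (auto simp: f_meas g_meas)
  moreover have "f (restrict (\<lambda>i. D i \<omega>) ({..<n} \<times> UNIV)) = f (\<lambda>i. D i \<omega>)"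
     "g (restrict (\<lambda>i. D i \<omega>) ({n} \<times> UNIV)) = g (\<lambda>i. D i \<omega>)" for \<omega>
    by (auto simp: f_def g_def S_def)
  ultimately have iv2: "indep_var borel (\<lambda>\<omega>. f (\<lambda>i. D i \<omega>)) borel (\<lambda>\<omega>. g (\<lambda>i. D i \<omega>))"
    by (simp add: comp_def)
  have fD: "f (\<lambda>i. D i \<omega>) = indicator {\<omega>. \<forall>s\<in>set ts. Z s \<omega> \<in> C} \<omega> * biexp \<alpha> \<beta> (Z t \<omega>)"
    if "\<omega> \<in> space M" for \<omega>
    using that by (auto simp: f_def S_D t_nth all_set_conv_all_nth n_def indicator_def)
  have gD: "g (\<lambda>i. D i \<omega>) = biexp \<alpha> \<beta> (Z T \<omega> - Z t \<omega>)" for \<omega>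
    by (auto simp: g_def D_def coord_incr_def Z_def t_nth n_def nth_append nth_Cons' intro!: arg_cong[of _ _ "biexp _ _"] complex_eqI)
  have tT: "0 \<le> t" "t < T"
    using ts last_in_set[of ts] by (auto simp: t_def sorted_wrt_append intro: less_imp_le)
  have If: "integrable M (\<lambda>\<omega>. f (\<lambda>i. D i \<omega>))"
  proof (rule Bochner_Integration.integrable_bound[OF integrable_biexp[OF tT(1), of \<alpha> \<beta>]])
    show "(\<lambda>\<omega>. f (\<lambda>i. D i \<omega>)) \<in> borel_measurable M"
      using iv2 by (rule indep_var_rv1)
    show "AE \<omega> in M. norm (f (\<lambda>i. D i \<omega>)) \<le> norm (biexp \<alpha> \<beta> (Z t \<omega>))"
      by (auto simp: fD indicator_def)
  qed
  have Ig: "integrable M (\<lambda>\<omega>. g (\<lambda>i. D i \<omega>))"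
    unfolding gD by (intro biexp_increment tT)
  have prod: "f (\<lambda>i. D i \<omega>) * g (\<lambda>i. D i \<omega>) = indicator {\<omega>. \<forall>s\<in>set ts. Z s \<omega> \<in> C} \<omega> * biexp \<alpha> \<beta> (Z T \<omega>)"
    if "\<omega> \<in> space M" for \<omega>
    using biexp_add[of \<alpha> \<beta> "Z t \<omega>" "Z T \<omega> - Z t \<omega>"] that by (simp add: fD gD)
  show ?I
    using indep_var_integrable[OF iv2 If Ig] by (rule Bochner_Integration.integrable_cong[THEN iffD1, OF refl, rotated]) (rule prod)
  have "expectation (\<lambda>\<omega>. indicator {\<omega>. \<forall>s\<in>set ts. Z s \<omega> \<in> C} \<omega> * biexp \<alpha> \<beta> (Z T \<omega>)) =
      expectation (\<lambda>\<omega>. f (\<lambda>i. D i \<omega>) * g (\<lambda>i. D i \<omega>))"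
    by (intro Bochner_Integration.integral_cong refl prod[symmetric])
  also have "\<dots> = expectation (\<lambda>\<omega>. f (\<lambda>i. D i \<omega>)) * expectation (\<lambda>\<omega>. g (\<lambda>i. D i \<omega>))"
    by (rule indep_var_lebesgue_integral[OF iv2 If Ig])
  finally show ?E
    using tT by (simp add: fD gD biexp_increment cong: Bochner_Integration.integral_cong)
qed

end

section \<open>Stopped sums and convergence under bounded second moments\<close>

lemma card_initial_segment:
  fixes P :: "nat \<Rightarrow> bool"
  assumes "\<And>i j. i \<le> j \<Longrightarrow> P j \<Longrightarrow> P i"
  shows "{i. i < n \<and> P i} = {..<card {i. i < n \<and> P i}}"
proof (induction n)
  case (Suc n)
  show ?case
  proof (cases "P n")
    case True
    then have "{i. i < Suc n \<and> P i} = {..<Suc n}" using assms by (auto simp: less_Suc_eq_le)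
    then show ?thesis by simp
  next
    case False
    then have "{i. i < Suc n \<and> P i} = {i. i < n \<and> P i}" by (auto simp: less_Suc_eq)
    then show ?thesis using Suc by simp
  qed
qed simp

text \<open>Optional stopping in discrete form: read \<open>P i\<close> as not yet stopped at index
  \<open>i\<close>. The stopping index is the size of an initial segment, and each increment is
  multiplied by an event of the past alone.\<close>

lemma sum_stopped_telescope:
  fixes P :: "nat \<Rightarrow> bool" and f :: "nat \<Rightarrow> 'b :: real_normed_field"
  assumes "\<And>i j. i \<le> j \<Longrightarrow> P j \<Longrightarrow> P i"
  shows "f (card {i. i < n \<and> P i}) = f 0 + (\<Sum>i<n. of_bool (P i) * (f (Suc i) - f i))"
proof -
  have "(\<Sum>i<n. of_bool (P i) * (f (Suc i) - f i)) = (\<Sum>i\<in>{i. i < n \<and> P i}. f (Suc i) - f i)"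
    by (rule sum.mono_neutral_cong_right) auto
  also have "\<dots> = (\<Sum>i<card {i. i < n \<and> P i}. f (Suc i) - f i)"
    by (subst card_initial_segment[OF assms]) auto
  also have "\<dots> = f (card {i. i < n \<and> P i}) - f 0" by (rule sum_lessThan_telescope)
  finally show ?thesis by simp
qed

text \<open>Dominated convergence does not apply to the stopped exponentials, as the path may have
  left the set by the rounded-up exit time. Bounded second moments yield uniform integrability
  instead.\<close>

lemma (in prob_space) expectation_eq_of_bounded_second_moments:
  fixes V :: "nat \<Rightarrow> 'a \<Rightarrow> complex"
  assumes meas: "\<And>n. V n \<in> borel_measurable M" "W \<in> borel_measurable M"
    and int: "\<And>n. integrable M (V n)" "\<And>n. integrable M (\<lambda>\<omega>. (norm (V n \<omega>))\<^sup>2)"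
    and lim: "AE \<omega> in M. (\<lambda>n. V n \<omega>) \<longlonglongrightarrow> W \<omega>"
    and E: "\<And>n. expectation (V n) = e" "\<And>n. expectation (\<lambda>\<omega>. (norm (V n \<omega>))\<^sup>2) \<le> C"
    and W: "AE \<omega> in M. norm (W \<omega>) \<le> B"
  shows "expectation W = e"
proof -
  note [measurable] = meas
  \<comment> \<open>Truncating at level \<open>c\<close> costs at most \<open>C / c\<close> in mean, uniformly in \<open>n\<close>.\<close>
  define clip where "clip c z = (c / max c (norm z)) *\<^sub>R z" for c :: real and z :: complex
  have clip_le: "norm (clip c z) \<le> c" if "c > 0" for c z
    using that by (auto simp: clip_def max_def field_simps)
  have clip_err: "norm (z - clip c z) \<le> (norm z)\<^sup>2 / c" if "c > 0" for c z
  proof (cases "norm z \<le> c")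
    case True then show ?thesis using that by (simp add: clip_def max_def)
  next
    case False
    then have "z \<noteq> 0" using that by auto
    have "norm (z - clip c z) = norm ((1 - c / norm z) *\<^sub>R z)"
      using False by (simp add: clip_def max_def algebra_simps)
    also have "\<dots> = (1 - c / norm z) * norm z"
      unfolding norm_scaleR using False that \<open>z \<noteq> 0\<close> by (simp add: field_simps)
    also have "\<dots> = norm z - c" using \<open>z \<noteq> 0\<close> by (simp add: field_simps)
    also have "\<dots> \<le> norm z * norm z / c"
      using False that mult_right_mono[of c "norm z" "norm z"] by (simp add: field_simps)
         (smt (verit) mult_pos_pos mult_strict_right_mono)
    finally show ?thesis by (simp add: power2_eq_square)
  qed
  have clip_cont: "isCont (clip c) z" if "c > 0" for c z
    unfolding clip_def using that by (intro continuous_intros) auto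
  have clip_meas[measurable]: "clip c \<in> borel_measurable borel" if "c > 0" for c
    using that clip_cont by (intro borel_measurable_continuous_onI) (auto simp: continuous_at_imp_continuous_on)
  have main: "norm (expectation W - e) \<le> C / c" if c: "c > 0" "c \<ge> B" for c
  proof -
    note clip_meas[OF c(1), measurable]
    have int_clip: "integrable M (\<lambda>\<omega>. clip c (V n \<omega>))" for n
      by (rule integrable_const_bound[where B=c]) (auto simp: clip_le c)
    have "(\<lambda>n. expectation (\<lambda>\<omega>. clip c (V n \<omega>))) \<longlonglongrightarrow> expectation (\<lambda>\<omega>. clip c (W \<omega>))"
    proof (rule integral_dominated_convergence[where w="\<lambda>_. c"])
      show "AE x in M. (\<lambda>i. clip c (V i x)) \<longlonglongrightarrow> clip c (W x)"
        using lim by eventually_elim (rule isCont_tendsto_compose[OF clip_cont[OF c(1)]])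
    qed (auto simp: clip_le c)
    moreover have "expectation (\<lambda>\<omega>. clip c (W \<omega>)) = expectation W"
    proof (rule integral_cong_AE)
      show "AE \<omega> in M. clip c (W \<omega>) = W \<omega>"
        using W
      proof eventually_elim
        case (elim \<omega>)
        then have "max c (norm (W \<omega>)) = c" using c by simp
        then show ?case using c by (simp add: clip_def)
      qed
    qed measurable
    ultimately have "(\<lambda>n. norm (expectation (\<lambda>\<omega>. clip c (V n \<omega>)) - e)) \<longlonglongrightarrow> norm (expectation W - e)"
      by (intro tendsto_intros) auto
    then show ?thesis
    proof (rule LIMSEQ_le_const2, intro exI allI impI)
      fix n :: nat
      have "norm (expectation (\<lambda>\<omega>. clip c (V n \<omega>)) - e) = norm (expectation (\<lambda>\<omega>. V n \<omega> - clip c (V n \<omega>)))"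
        using int(1) int_clip by (simp add: E norm_minus_commute)
      also have "\<dots> \<le> expectation (\<lambda>\<omega>. norm (V n \<omega> - clip c (V n \<omega>)))" by (rule integral_norm_bound)
      also have "\<dots> \<le> expectation (\<lambda>\<omega>. (norm (V n \<omega>))\<^sup>2 / c)"
        using int int_clip clip_err[OF c(1)] by (intro integral_mono) auto
      also have "\<dots> \<le> C / c" using E(2)[of n] c by (simp add: divide_right_mono)
      finally show "norm (expectation (\<lambda>\<omega>. clip c (V n \<omega>)) - e) \<le> C / c" .
    qed
  qed
  have lim0: "(\<lambda>n. C / real (Suc n)) \<longlonglongrightarrow> 0"
    by (rule LIMSEQ_Suc[OF lim_const_over_n])
  have "norm (expectation W - e) \<le> C / real (Suc n)" if "n \<ge> nat \<lceil>B\<rceil>" for n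
    using that by (intro main) (auto simp: nat_le_iff ceiling_le_iff)
  then have "norm (expectation W - e) \<le> 0"
    by (intro LIMSEQ_le_const[OF lim0]) blast
  then show ?thesis by simp
qed

section \<open>Dyadic grids and the event of staying in an open set\<close>

definition dyadic_grid :: "real \<Rightarrow> nat \<Rightarrow> real list" where
  "dyadic_grid t j = (if t = 0 then [] else map (\<lambda>i. t * real (Suc i) / 2 ^ j) [0..<2 ^ j])"

lemma set_dyadic_grid: "0 < t \<Longrightarrow> set (dyadic_grid t j) = (\<lambda>i. t * real i / 2 ^ j) ` {1..2 ^ j}"
proof -
  have "{1..2 ^ j} = Suc ` {0..<2 ^ j}" by (simp add: image_Suc_atLeastLessThan atLeastLessThanSuc_atLeastAtMost)
  then show "0 < t \<Longrightarrow> ?thesis" by (auto simp: dyadic_grid_def image_image simp del: image_Suc_atLeastLessThan of_nat_Suc)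
qed

text \<open>Nested grids make the grid events decreasing in \<open>j\<close>, so that their
  indicators converge.\<close>

lemma dyadic_grid_mono: "0 \<le> t \<Longrightarrow> set (dyadic_grid t j) \<subseteq> set (dyadic_grid t (Suc j))"
proof (cases "t = 0")
  case False
  assume "0 \<le> t"
  then have "t > 0" using False by simp
  then show ?thesis
    unfolding set_dyadic_grid[OF \<open>t > 0\<close>]
  proof (intro subsetI, elim imageE)
    fix x i assume "x = t * real i / 2 ^ j" "i \<in> {1..(2::nat) ^ j}"
    then show "x \<in> (\<lambda>i. t * real i / 2 ^ Suc j) ` {1..2 ^ Suc j}"
      by (intro image_eqI[of _ _ "2 * i"]) auto
  qed
qed (simp add: dyadic_grid_def)

text \<open>The grid leaves out 0, which \<open>grid_past_indep\<close> puts in front, and is empty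
  for \<open>t = 0\<close>; hence the last time is \<open>t\<close> in every case.\<close>

lemma last_dyadic_grid: "last (0 # dyadic_grid t j) = t"
  by (auto simp: dyadic_grid_def last_map)

lemma sorted_dyadic_grid: "0 \<le> t \<Longrightarrow> t < T \<Longrightarrow> sorted_wrt (<) (0 # dyadic_grid t j @ [T])"
proof -
  assume "0 \<le> t" "t < T"
  have "t * real (Suc i) / 2 ^ j < T" if "i < 2 ^ j" "t \<noteq> 0" for i
  proof -
    have "real (Suc i) \<le> 2 ^ j"
      using that(1) by (metis Suc_leI of_nat_le_iff of_nat_numeral of_nat_power)
    then have "t * real (Suc i) / 2 ^ j \<le> t * 2 ^ j / 2 ^ j"
      using \<open>0 \<le> t\<close> by (intro divide_right_mono mult_left_mono) auto
    then show ?thesis using \<open>t < T\<close> by simp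
  qed
  then show ?thesis
    using \<open>0 \<le> t\<close> \<open>t < T\<close>
    by (auto simp: dyadic_grid_def sorted_wrt_append sorted_wrt_map
        intro!: divide_strict_right_mono mult_strict_left_mono sorted_wrt_mono_rel[OF _ sorted_wrt_upt])
qed

context planar_BM
begin

definition stays :: "complex set \<Rightarrow> real \<Rightarrow> 'a set" where
  "stays S t = {\<omega> \<in> space M. \<forall>s\<in>{0..t}. Z s \<omega> \<in> S}"

text \<open>Membership in the open set \<open>S\<close> at grid times does not exclude touching its
  boundary in between. A positive lower bound for the distance to the complement is a closed
  condition, which passes from the dense grid times to all times, and compactness of the path up to
  \<open>t\<close> supplies such a bound. The union over \<open>m\<close> ranges over its possible
  values.\<close>

lemma stays_eq_grid:
  assumes S: "open S" "S \<noteq> UNIV" "0 \<in> S" and "0 \<le> t"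
  shows "stays S t = (\<Union>m. \<Inter>j. {\<omega> \<in> space M. \<forall>s\<in>set (dyadic_grid t j). Z s \<omega> \<in> {z. infdist z (- S) \<ge> 1 / real (Suc m)}})"
    (is "_ = ?R")
proof (intro equalityI subsetI)
  fix \<omega> assume \<omega>: "\<omega> \<in> stays S t"
  then have "\<omega> \<in> space M" by (simp add: stays_def)
  have "compact ((\<lambda>s. Z s \<omega>) ` {0..t})"
    using continuous_on_subset[OF continuous_on_Z[OF \<open>\<omega> \<in> space M\<close>]]
    by (intro compact_continuous_image) auto
  then have "\<exists>d>0. \<forall>x\<in>(\<lambda>s. Z s \<omega>) ` {0..t}. \<forall>y\<in>- S. d \<le> dist x y"
    using S \<omega> by (intro separate_compact_closed) (auto simp: stays_def)
  then obtain d where d: "d > 0" "\<And>x y. x \<in> (\<lambda>s. Z s \<omega>) ` {0..t} \<Longrightarrow> y \<in> - S \<Longrightarrow> d \<le> dist x y"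
    by blast
  obtain m :: nat where m: "1 / real (Suc m) < d"
    using d(1) nat_approx_posE by blast
  have "infdist (Z s \<omega>) (- S) \<ge> 1 / real (Suc m)" if "s \<in> {0..t}" for s
  proof -
    have "- S \<noteq> {}" using S by auto
    then show ?thesis
      unfolding infdist_def using d(2)[of "Z s \<omega>"] m that
      by (auto intro!: cINF_greatest intro: order_trans[OF less_imp_le])
  qed
  moreover have "set (dyadic_grid t j) \<subseteq> {0..t}" for j
  proof
    fix x assume x: "x \<in> set (dyadic_grid t j)"
    have "x \<le> t"
      \<comment> \<open>\<open>sorted_dyadic_grid\<close> gives \<open>x < T\<close> for every
        \<open>T > t\<close>, hence \<open>x \<le> t\<close>.\<close>
      by (rule dense_ge) (use sorted_dyadic_grid[OF \<open>0 \<le> t\<close>, of _ j] x in \<open>auto simp: sorted_wrt_append less_imp_le\<close>)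
    then show "x \<in> {0..t}"
      using sorted_dyadic_grid[OF \<open>0 \<le> t\<close>, of "t + 1" j] x by (auto simp: less_imp_le)
  qed
  ultimately show "\<omega> \<in> ?R" using \<open>\<omega> \<in> space M\<close> by blast
next
  fix \<omega> assume "\<omega> \<in> ?R"
  then obtain m where m: "\<And>j s. s \<in> set (dyadic_grid t j) \<Longrightarrow> infdist (Z s \<omega>) (- S) \<ge> 1 / real (Suc m)"
    and \<omega>: "\<omega> \<in> space M" by auto
  have "Z s \<omega> \<in> S" if s: "s \<in> {0..t}" for s
  proof (cases "s = 0")
    case True then show ?thesis using S \<omega> by (simp add: Z_0)
  next
    case False
    then have "0 < s" "0 < t" using s by auto
    \<comment> \<open>This is \<open>s\<close> rounded up to the grid: rounding down could give 0,
      which the grid omits.\<close>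
    define r where "r j = t * real (nat \<lceil>s / t * 2 ^ j\<rceil>) / 2 ^ j" for j :: nat
    have c: "nat \<lceil>s / t * 2 ^ j\<rceil> \<in> {1..2 ^ j}" for j
    proof -
      have "0 < s / t * 2 ^ j" using \<open>0 < s\<close> \<open>0 < t\<close> by simp
      moreover have "s / t * 2 ^ j \<le> of_int (2 ^ j)"
        using s \<open>0 < t\<close> by (simp add: field_simps)
      ultimately show ?thesis by (simp add: nat_le_iff ceiling_le_iff Suc_le_eq)
    qed
    have r: "s \<le> r j" "r j \<le> s + t / 2 ^ j" for j
    proof -
      have eq: "real (nat \<lceil>s / t * 2 ^ j\<rceil>) = of_int \<lceil>s / t * 2 ^ j\<rceil>"
        using \<open>0 < s\<close> \<open>0 < t\<close> by simp
      have "s / t * 2 ^ j \<le> real (nat \<lceil>s / t * 2 ^ j\<rceil>)" "real (nat \<lceil>s / t * 2 ^ j\<rceil>) \<le> s / t * 2 ^ j + 1"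
        unfolding eq by linarith+
      then show "s \<le> r j" "r j \<le> s + t / 2 ^ j"
        using \<open>0 < t\<close> by (simp_all add: r_def field_simps)
    qed
    have "(\<lambda>j. s + t / 2 ^ j) \<longlonglongrightarrow> s + 0"
      by (intro tendsto_intros LIMSEQ_divide_realpow_zero) auto
    then have "r \<longlonglongrightarrow> s"
      using r by (intro tendsto_sandwich[of "\<lambda>_. s" r sequentially "\<lambda>j. s + t / 2 ^ j"]) auto
    then have "(\<lambda>j. Z (r j) \<omega>) \<longlonglongrightarrow> Z s \<omega>"
      using continuous_on_Z[OF \<omega>] r(1) \<open>0 < s\<close>
      by (intro continuous_on_tendsto_compose[of "{0..}" "\<lambda>t. Z t \<omega>"]) (auto intro!: always_eventually intro: order_trans[of 0 s])
    then have "(\<lambda>j. infdist (Z (r j) \<omega>) (- S)) \<longlonglongrightarrow> infdist (Z s \<omega>) (- S)"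
      by (rule tendsto_infdist)
    moreover have "infdist (Z (r j) \<omega>) (- S) \<ge> 1 / real (Suc m)" for j
      using c \<open>0 < t\<close> by (intro m[of _ j]) (auto simp: set_dyadic_grid r_def)
    ultimately have "infdist (Z s \<omega>) (- S) \<ge> 1 / real (Suc m)"
      by (intro LIMSEQ_le_const) auto
    then show ?thesis
      by (metis ComplI infdist_zero not_le of_nat_0_less_iff zero_less_Suc zero_less_divide_1_iff)
  qed
  then show "\<omega> \<in> stays S t" using \<omega> by (simp add: stays_def)
qed

text \<open>Both claims pass together through pointwise limits of indicators by dominated
  convergence, with the modulus of the exponential as the bound. From grid events one reaches the
  path event by a decreasing limit in \<open>j\<close> followed by an increasing one in
  \<open>m\<close>.\<close>

lemma
  assumes S: "open S" "S \<noteq> UNIV" "0 \<in> S" and "0 \<le> t"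
  shows stays_sets[measurable]: "stays S t \<in> sets M"
    and stays_indep: "t < T \<Longrightarrow> expectation (\<lambda>\<omega>. indicator (stays S t) \<omega> * biexp \<alpha> \<beta> (Z T \<omega>)) =
       expectation (\<lambda>\<omega>. indicator (stays S t) \<omega> * biexp \<alpha> \<beta> (Z t \<omega>)) * exp ((\<alpha>\<^sup>2 + \<beta>\<^sup>2) * of_real (T - t) / 2)"
proof -
  define c where "c T = exp ((\<alpha>\<^sup>2 + \<beta>\<^sup>2) * of_real (T - t) / 2)" for T
  define P where "P E \<longleftrightarrow> E \<in> sets M \<and> (\<forall>T>t. expectation (\<lambda>\<omega>. indicator E \<omega> * biexp \<alpha> \<beta> (Z T \<omega>)) =
       expectation (\<lambda>\<omega>. indicator E \<omega> * biexp \<alpha> \<beta> (Z t \<omega>)) * c T)" for E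
  have conv: "(\<lambda>n. expectation (\<lambda>\<omega>. indicator (A n) \<omega> * biexp \<alpha> \<beta> (Z T \<omega>)))
       \<longlonglongrightarrow> expectation (\<lambda>\<omega>. indicator B \<omega> * biexp \<alpha> \<beta> (Z T \<omega>))"
    if [measurable]: "\<And>n. A n \<in> sets M" "B \<in> sets M"
     and lim: "\<And>\<omega>. (\<lambda>n. indicator (A n) \<omega> :: complex) \<longlonglongrightarrow> indicator B \<omega>" and "T \<ge> t" for A B T
  proof (rule integral_dominated_convergence[where w="\<lambda>\<omega>. norm (biexp \<alpha> \<beta> (Z T \<omega>))"])
    have [measurable]: "Z T \<in> borel_measurable M" using \<open>0 \<le> t\<close> \<open>T \<ge> t\<close> by simp
    show "(\<lambda>\<omega>. indicator B \<omega> * biexp \<alpha> \<beta> (Z T \<omega>)) \<in> borel_measurable M" by measurable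
    show "(\<lambda>\<omega>. indicator (A n) \<omega> * biexp \<alpha> \<beta> (Z T \<omega>)) \<in> borel_measurable M" for n by measurable
    show "integrable M (\<lambda>\<omega>. norm (biexp \<alpha> \<beta> (Z T \<omega>)))"
      using \<open>0 \<le> t\<close> \<open>T \<ge> t\<close> by (intro integrable_norm integrable_biexp) auto
    show "AE \<omega> in M. (\<lambda>i. indicator (A i) \<omega> * biexp \<alpha> \<beta> (Z T \<omega>)) \<longlonglongrightarrow> indicator B \<omega> * biexp \<alpha> \<beta> (Z T \<omega>)"
      by (intro AE_I2 tendsto_intros lim)
  qed (auto simp: indicator_def)
  have P_lim: "P B" if PA: "\<And>n. P (A n)" and B: "B \<in> sets M"
     and lim: "\<And>\<omega>. (\<lambda>n. indicator (A n) \<omega> :: complex) \<longlonglongrightarrow> indicator B \<omega>" for A B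
    unfolding P_def
  proof (intro conjI allI impI B)
    fix T assume "t < T"
    have A: "A n \<in> sets M" for n using PA by (simp add: P_def)
    have "(\<lambda>n. expectation (\<lambda>\<omega>. indicator (A n) \<omega> * biexp \<alpha> \<beta> (Z T \<omega>)))
       \<longlonglongrightarrow> expectation (\<lambda>\<omega>. indicator B \<omega> * biexp \<alpha> \<beta> (Z t \<omega>)) * c T"
      using tendsto_mult[OF conv[OF A B lim order_refl] tendsto_const[of "c T"]] PA \<open>t < T\<close> by (simp add: P_def)
    then show "expectation (\<lambda>\<omega>. indicator B \<omega> * biexp \<alpha> \<beta> (Z T \<omega>)) =
       expectation (\<lambda>\<omega>. indicator B \<omega> * biexp \<alpha> \<beta> (Z t \<omega>)) * c T"
      using conv[OF A B lim less_imp_le[OF \<open>t < T\<close>]] by (rule LIMSEQ_unique[rotated])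
  qed
  define A where "A m j = {\<omega> \<in> space M. \<forall>s\<in>set (dyadic_grid t j). Z s \<omega> \<in> {z. infdist z (- S) \<ge> 1 / real (Suc m)}}" for m j
  have closed: "closed {z. infdist z (- S) \<ge> c}" for c
    by (intro closed_Collect_le continuous_intros)
  have pos: "0 \<le> s" if "s \<in> set (dyadic_grid t j)" for s j
    using sorted_dyadic_grid[OF \<open>0 \<le> t\<close>, of "t + 1" j] that by (auto simp: less_imp_le)
  have PA: "P (A m j)" for m j
    unfolding P_def
  proof (intro conjI allI impI)
    have "{\<omega> \<in> space M. Z s \<omega> \<in> {z. infdist z (- S) \<ge> 1 / real (Suc m)}} \<in> sets M" if "s \<in> set (dyadic_grid t j)" for s
      using measurable_sets[OF Z_measurable[OF pos[OF that]] borel_closed[OF closed, of "1 / real (Suc m)"]]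
      by (simp add: vimage_def Int_def conj_commute)
    then show "A m j \<in> sets M" unfolding A_def by (intro sets.sets_Collect_finite_All) auto
    fix T assume "t < T"
    have "indicator (A m j) \<omega> * f = indicator {\<omega>. \<forall>s\<in>set (dyadic_grid t j). Z s \<omega> \<in> {z. infdist z (- S) \<ge> 1 / real (Suc m)}} \<omega> * f"
      if "\<omega> \<in> space M" for \<omega> and f :: complex
      using that by (auto simp: A_def indicator_def)
    then have eq: "expectation (\<lambda>\<omega>. indicator (A m j) \<omega> * biexp \<alpha> \<beta> (Z u \<omega>)) =
        expectation (\<lambda>\<omega>. indicator {\<omega>. \<forall>s\<in>set (dyadic_grid t j). Z s \<omega> \<in> {z. infdist z (- S) \<ge> 1 / real (Suc m)}} \<omega> * biexp \<alpha> \<beta> (Z u \<omega>))" for u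
      by (intro Bochner_Integration.integral_cong refl)
    show "expectation (\<lambda>\<omega>. indicator (A m j) \<omega> * biexp \<alpha> \<beta> (Z T \<omega>)) =
       expectation (\<lambda>\<omega>. indicator (A m j) \<omega> * biexp \<alpha> \<beta> (Z t \<omega>)) * c T"
      unfolding eq c_def
      using grid_past_indep(2)[where ts="dyadic_grid t j" and T=T and \<alpha>=\<alpha> and \<beta>=\<beta> and C="{z. infdist z (- S) \<ge> 1 / real (Suc m)}",
          OF sorted_dyadic_grid[OF \<open>0 \<le> t\<close> \<open>t < T\<close>] borel_closed[OF closed]]
      unfolding last_dyadic_grid .
  qed
  have PB: "P (\<Inter>j. A m j)" for m
  proof (rule P_lim[OF PA])
    have "decseq (A m)"
      using dyadic_grid_mono[OF \<open>0 \<le> t\<close>] by (intro decseq_SucI) (auto simp: A_def)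
    then show "(\<lambda>n. indicator (A m n) \<omega> :: complex) \<longlonglongrightarrow> indicator (\<Inter>j. A m j) \<omega>" for \<omega>
      by (rule LIMSEQ_indicator_decseq)
  qed (use PA in \<open>auto simp: P_def\<close>)
  have "P (\<Union>m. \<Inter>j. A m j)"
  proof (rule P_lim[OF PB])
    have le: "1 / real (Suc (Suc m)) \<le> 1 / real (Suc m)" for m
      by (simp add: field_simps)
    have "incseq (\<lambda>m. \<Inter>j. A m j)"
      unfolding A_def by (intro incseq_SucI INF_mono bexI[OF _ UNIV_I]) (auto intro: order_trans[OF le] simp del: of_nat_Suc)
    then show "(\<lambda>m. indicator (\<Inter>j. A m j) \<omega> :: complex) \<longlonglongrightarrow> indicator (\<Union>m. \<Inter>j. A m j) \<omega>" for \<omega>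
      by (rule LIMSEQ_indicator_incseq)
  qed (use PB in \<open>auto simp: P_def\<close>)
  then have "P (stays S t)" unfolding A_def stays_eq_grid[OF assms] .
  then show "stays S t \<in> sets M" "t < T \<Longrightarrow> expectation (\<lambda>\<omega>. indicator (stays S t) \<omega> * biexp \<alpha> \<beta> (Z T \<omega>)) =
       expectation (\<lambda>\<omega>. indicator (stays S t) \<omega> * biexp \<alpha> \<beta> (Z t \<omega>)) * exp ((\<alpha>\<^sup>2 + \<beta>\<^sup>2) * of_real (T - t) / 2)"
    unfolding P_def c_def by auto
qed

end

section \<open>Optional stopping\<close>

context planar_BM
begin

definition exit_from :: "complex set \<Rightarrow> 'a \<Rightarrow> real" where
  "exit_from S \<omega> = Inf {t. 0 \<le> t \<and> Z t \<omega> \<notin> S}"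

definition leaves :: "complex set \<Rightarrow> 'a \<Rightarrow> bool" where
  "leaves S \<omega> \<longleftrightarrow> (\<exists>t\<ge>0. Z t \<omega> \<notin> S)"

text \<open>By continuity of the path the times spent outside the open set form a closed set, so the
  infimum is attained. Hence the strict inequality in the last claim, which also covers
  \<open>t < 0\<close>, where \<open>stays S t\<close> is the whole space.\<close>

lemma exit_from_props:
  assumes "open S" "\<omega> \<in> space M" "leaves S \<omega>"
  shows "0 \<le> exit_from S \<omega>" "Z (exit_from S \<omega>) \<omega> \<notin> S"
    "\<And>t. 0 \<le> t \<Longrightarrow> t < exit_from S \<omega> \<Longrightarrow> Z t \<omega> \<in> S"
    "\<And>t. \<omega> \<in> stays S t \<longleftrightarrow> t < exit_from S \<omega>"
proof -
  let ?E = "{t. 0 \<le> t \<and> Z t \<omega> \<notin> S}"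
  have ne: "?E \<noteq> {}" and bdd: "bdd_below ?E" using assms by (auto simp: leaves_def)
  have "?E = {0..} \<inter> (\<lambda>t. Z t \<omega>) -` (- S)" by auto
  also have "closed \<dots>"
    using assms by (intro continuous_closed_preimage continuous_on_Z) auto
  finally have "Inf ?E \<in> ?E" by (intro closed_contains_Inf ne bdd)
  then show 1: "0 \<le> exit_from S \<omega>" "Z (exit_from S \<omega>) \<omega> \<notin> S" by (auto simp: exit_from_def)
  show 2: "Z t \<omega> \<in> S" if "0 \<le> t" "t < exit_from S \<omega>" for t
    using that cInf_lower[OF _ bdd, of t] by (force simp: exit_from_def)
  show "\<omega> \<in> stays S t \<longleftrightarrow> t < exit_from S \<omega>" for t
    using 1 2 assms(2) by (auto simp: stays_def intro: le_less_trans)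
qed

text \<open>The density of \<open>X t\<close> is at most \<open>1 / sqrt (2 * pi * t)\<close>, and
  staying in \<open>S\<close> confines \<open>X t\<close> to an interval of length
  \<open>2 * R\<close>. The spreading of the Gaussian law alone thus makes the exit time almost
  surely finite.\<close>

lemma prob_stays_le:
  assumes "open S" "0 \<in> S" "S \<subseteq> cball 0 R" "t > 0"
  shows "prob (stays S t) \<le> 2 * R / sqrt (2 * pi * t)"
proof -
  have [measurable]: "X t \<in> borel_measurable M" using assms by simp
  have "R \<ge> 0" using assms by auto
  define N where "N = coord_incr X Y [t] (0, True)"
  have N: "N \<omega> = X t \<omega>" if "\<omega> \<in> space M" for \<omega>
    using BM that by (auto simp: std_planar_BM_def coord_incr_def N_def)
  have d: "distributed M lborel N (\<lambda>x. ennreal (normal_density 0 (sqrt t) x))"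
    using BM assms(4) unfolding std_planar_BM_def N_def
    by (elim conjE allE[of _ "[t]"]) auto
  have "X t -` {-R..R} \<inter> space M = N -` {-R..R} \<inter> space M" using N by auto
  also have "emeasure M (N -` {-R..R} \<inter> space M) = (\<integral>\<^sup>+x. ennreal (normal_density 0 (sqrt t) x) * indicator {-R..R} x \<partial>lborel)"
    by (rule distributed_emeasure[OF d]) auto
  also have "\<dots> \<le> (\<integral>\<^sup>+x. ennreal (1 / sqrt (2 * pi * t)) * indicator {-R..R} x \<partial>lborel)"
    using assms(4) by (intro nn_integral_mono mult_right_mono ennreal_leI) (auto simp: normal_density_def divide_right_mono)
  also have "\<dots> = ennreal (2 * R / sqrt (2 * pi * t))"
    using \<open>R \<ge> 0\<close> assms(4) by (simp add: nn_integral_cmult) (simp flip: ennreal_mult)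
  finally have "prob (X t -` {-R..R} \<inter> space M) \<le> 2 * R / sqrt (2 * pi * t)"
    using \<open>R \<ge> 0\<close> assms(4) by (simp add: emeasure_eq_measure)
  moreover have "stays S t \<subseteq> X t -` {-R..R} \<inter> space M"
  proof (intro subsetI IntI vimageI2)
    fix \<omega> assume "\<omega> \<in> stays S t"
    then have "Z t \<omega> \<in> S" "\<omega> \<in> space M" using assms(4) by (auto simp: stays_def)
    then have "norm (Z t \<omega>) \<le> R" using assms(3) by auto
    then have "\<bar>X t \<omega>\<bar> \<le> R" using abs_Re_le_cmod[of "Z t \<omega>"] by (simp add: Z_def)
    then show "X t \<omega> \<in> {-R..R}" "\<omega> \<in> space M" using \<open>\<omega> \<in> space M\<close> by auto
  qed
  ultimately show ?thesis
    using finite_measure_mono[of "stays S t" "X t -` {-R..R} \<inter> space M"] by fastforce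
qed

lemma AE_leaves:
  assumes "open S" "0 \<in> S" "bounded S"
  shows "AE \<omega> in M. leaves S \<omega>"
proof -
  obtain R where R: "S \<subseteq> cball 0 R" using assms(3) by (meson ball_subset_cball bounded_subset_ballD order_trans)
  have S: "S \<noteq> UNIV" using assms(3) not_bounded_UNIV by metis
  have meas: "stays S t \<in> sets M" if "0 \<le> t" for t using stays_sets[OF assms(1) S assms(2) that] .
  let ?N = "\<Inter>n. stays S (real (Suc n))"
  have N: "?N \<in> sets M" using meas by auto
  have "prob ?N \<le> 2 * R / sqrt (2 * pi * real (Suc n))" for n
    using prob_stays_le[OF assms(1,2) R, of "real (Suc n)"] meas
    by (intro order_trans[OF finite_measure_mono[of ?N "stays S (real (Suc n))"]]) auto
  moreover have "(\<lambda>n. 2 * R / sqrt (2 * pi * real (Suc n))) \<longlonglongrightarrow> 0"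
    by real_asymp
  ultimately have "prob ?N \<le> 0" by (intro LIMSEQ_le_const) auto
  then have "prob ?N = 0" using measure_nonneg[of M ?N] by linarith
  then have "?N \<in> null_sets M" using N by (simp add: null_sets_def emeasure_eq_measure)
  moreover have "{\<omega> \<in> space M. \<not> leaves S \<omega>} \<subseteq> ?N" by (auto simp: leaves_def stays_def)
  ultimately show ?thesis by (intro AE_I'[of ?N])
qed

lemma before_exit_in_closure:
  assumes "open S" "0 \<in> S" "\<omega> \<in> space M" "leaves S \<omega>" "0 \<le> t" "t \<le> exit_from S \<omega>"
  shows "Z t \<omega> \<in> closure S"
proof -
  note ex = exit_from_props[OF assms(1,3,4)]
  have "exit_from S \<omega> \<noteq> 0" using ex(2) assms(2) Z_0[OF assms(3)] by metis
  then have cl: "closure {0..<exit_from S \<omega>} = {0..exit_from S \<omega>}" using ex(1) by simp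
  have "(\<lambda>t. Z t \<omega>) ` closure {0..<exit_from S \<omega>} \<subseteq> closure S"
    using ex(3) by (intro image_closure_subset continuous_on_subset[OF continuous_on_Z[OF assms(3)]])
      (auto simp: cl intro: closure_subset[THEN subsetD])
  then show ?thesis using assms(5,6) unfolding cl by auto
qed

text \<open>Evaluation of \<open>biexp \<alpha> \<beta> (Z t)\<close> at the exit time rounded up to the grid of mesh \<open>h\<close> and capped
  at \<open>n h\<close>, written as a discrete stochastic integral so that its mean can be taken termwise.\<close>

definition stop_sum :: "complex \<Rightarrow> complex \<Rightarrow> complex set \<Rightarrow> real \<Rightarrow> nat \<Rightarrow> 'a \<Rightarrow> complex" where
  "stop_sum \<alpha> \<beta> S h n \<omega> = 1 + (\<Sum>i<n. indicator (stays S (real i * h)) \<omega> *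
      (biexp \<alpha> \<beta> (Z (real (Suc i) * h) \<omega>) - biexp \<alpha> \<beta> (Z (real i * h) \<omega>)))"

lemma stop_sum_eq:
  assumes "\<omega> \<in> space M" "0 < h"
  shows "stop_sum \<alpha> \<beta> S h n \<omega> = biexp \<alpha> \<beta> (Z (real (card {i. i < n \<and> \<omega> \<in> stays S (real i * h)}) * h) \<omega>)"
proof -
  have "\<omega> \<in> stays S (real i * h)" if "i \<le> j" "\<omega> \<in> stays S (real j * h)" for i j
  proof -
    have "real i * h \<le> real j * h" using that assms by simp
    then show ?thesis using that(2) by (auto simp: stays_def)
  qed
  from sum_stopped_telescope[of "\<lambda>i. \<omega> \<in> stays S (real i * h)" "\<lambda>i. biexp \<alpha> \<beta> (Z (real i * h) \<omega>)" n, OF this]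
  show ?thesis using assms by (simp add: stop_sum_def Z_0 biexp_def[of _ _ 0] indicator_def of_bool_def if_distrib cong: if_cong)
qed

text \<open>The increment after \<open>real i * h\<close> is independent of having stayed in
  \<open>S\<close> until then, so each term acquires the factor \<open>exp ((\<alpha>\<^sup>2 +
  \<beta>\<^sup>2) * of_real h / 2) - 1\<close>. It vanishes when
  \<open>\<beta> = \<i> * \<alpha>\<close>.\<close>

lemma
  assumes S: "open S" "S \<noteq> UNIV" "0 \<in> S" and h: "0 < h"
  shows integrable_stop_sum: "integrable M (stop_sum \<alpha> \<beta> S h n)"
    and expectation_stop_sum: "expectation (stop_sum \<alpha> \<beta> S h n) =
      1 + (\<Sum>i<n. expectation (\<lambda>\<omega>. indicator (stays S (real i * h)) \<omega> * biexp \<alpha> \<beta> (Z (real i * h) \<omega>)) *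
                    (exp ((\<alpha>\<^sup>2 + \<beta>\<^sup>2) * of_real h / 2) - 1))"
proof -
  have st[measurable]: "stays S (real i * h) \<in> sets M" for i using h by (intro stays_sets S) auto
  have int: "integrable M (\<lambda>\<omega>. indicator (stays S (real i * h)) \<omega> * biexp \<alpha> \<beta> (Z (real j * h) \<omega>))" for i j
  proof (rule Bochner_Integration.integrable_bound[OF integrable_biexp[of "real j * h" \<alpha> \<beta>]])
    have [measurable]: "Z (real j * h) \<in> borel_measurable M" using h by simp
    show "(\<lambda>\<omega>. indicator (stays S (real i * h)) \<omega> * biexp \<alpha> \<beta> (Z (real j * h) \<omega>)) \<in> borel_measurable M"
      by measurable
  qed (use h in \<open>auto simp: indicator_def\<close>)
  have ss: "stop_sum \<alpha> \<beta> S h n = (\<lambda>\<omega>. 1 + (\<Sum>i<n. indicator (stays S (real i * h)) \<omega> * biexp \<alpha> \<beta> (Z (real (Suc i) * h) \<omega>) -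
       indicator (stays S (real i * h)) \<omega> * biexp \<alpha> \<beta> (Z (real i * h) \<omega>)))"
    by (simp add: stop_sum_def fun_eq_iff right_diff_distrib)
  show "integrable M (stop_sum \<alpha> \<beta> S h n)"
    unfolding ss by (intro Bochner_Integration.integrable_add integrable_const
      Bochner_Integration.integrable_sum Bochner_Integration.integrable_diff int)
  have "expectation (stop_sum \<alpha> \<beta> S h n) = 1 + (\<Sum>i<n. expectation (\<lambda>\<omega>. indicator (stays S (real i * h)) \<omega> * biexp \<alpha> \<beta> (Z (real (Suc i) * h) \<omega>)) -
       expectation (\<lambda>\<omega>. indicator (stays S (real i * h)) \<omega> * biexp \<alpha> \<beta> (Z (real i * h) \<omega>)))"
    unfolding ss using int
    by (subst Bochner_Integration.integral_add; (subst Bochner_Integration.integral_sum)?)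
       (auto intro!: Bochner_Integration.integrable_sum Bochner_Integration.integrable_diff simp: prob_space simp del: of_nat_Suc)
  also have "\<dots> = 1 + (\<Sum>i<n. expectation (\<lambda>\<omega>. indicator (stays S (real i * h)) \<omega> * biexp \<alpha> \<beta> (Z (real i * h) \<omega>)) *
                    (exp ((\<alpha>\<^sup>2 + \<beta>\<^sup>2) * of_real h / 2) - 1))"
    using h by (subst stays_indep[OF S]) (auto simp: algebra_simps)
  finally show "expectation (stop_sum \<alpha> \<beta> S h n) =
      1 + (\<Sum>i<n. expectation (\<lambda>\<omega>. indicator (stays S (real i * h)) \<omega> * biexp \<alpha> \<beta> (Z (real i * h) \<omega>)) *
                    (exp ((\<alpha>\<^sup>2 + \<beta>\<^sup>2) * of_real h / 2) - 1))" .
qed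

text \<open>With real exponents all terms are nonnegative, so dropping the indicators leaves a
  telescoping geometric sum. The bound depends only on the total time \<open>real n * h\<close>,
  hence is uniform in the mesh; it serves as the second-moment bound.\<close>

lemma expectation_stop_sum_le:
  fixes \<alpha> \<beta> :: real
  assumes S: "open S" "S \<noteq> UNIV" "0 \<in> S" and h: "0 < h"
  shows "Re (expectation (stop_sum \<alpha> \<beta> S h n)) \<le> exp ((\<alpha>\<^sup>2 + \<beta>\<^sup>2) * (real n * h) / 2)"
proof -
  define q where "q = exp ((\<alpha>\<^sup>2 + \<beta>\<^sup>2) * h / 2)"
  have q: "exp (((complex_of_real \<alpha>)\<^sup>2 + (complex_of_real \<beta>)\<^sup>2) * of_real h / 2) = of_real q"
    by (simp add: q_def flip: exp_of_real)
  have q1: "q \<ge> 1" using h by (simp add: q_def)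
  have qpow: "q ^ i = exp ((\<alpha>\<^sup>2 + \<beta>\<^sup>2) * (real i * h) / 2)" for i
    by (simp add: q_def flip: exp_of_nat_mult)
  have real: "biexp \<alpha> \<beta> z = of_real (norm (biexp \<alpha> \<beta> z))" for z
    by (simp add: biexp_def norm_exp_eq_Re flip: exp_of_real)
  have E: "expectation (\<lambda>\<omega>. norm (biexp \<alpha> \<beta> (Z (real i * h) \<omega>))) = q ^ i" for i
  proof (cases "i = 0")
    case True
    have "expectation (\<lambda>\<omega>. norm (biexp \<alpha> \<beta> (Z 0 \<omega>))) = expectation (\<lambda>\<omega>. 1)"
      by (intro Bochner_Integration.integral_cong) (auto simp: Z_0 biexp_def)
    then show ?thesis using True by (simp add: prob_space)
  next
    case False
    have "of_real (expectation (\<lambda>\<omega>. norm (biexp \<alpha> \<beta> (Z (real i * h) \<omega>)))) = expectation (\<lambda>\<omega>. biexp \<alpha> \<beta> (Z (real i * h) \<omega>))"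
      by (subst integral_complex_of_real[symmetric]) (simp flip: real)
    also have "\<dots> = expectation (\<lambda>\<omega>. biexp \<alpha> \<beta> (Z (real i * h) \<omega> - Z 0 \<omega>))"
      by (intro Bochner_Integration.integral_cong) (auto simp: Z_0)
    also have "\<dots> = of_real (q ^ i)"
      using False h unfolding qpow exp_of_real[symmetric] by (subst biexp_increment) auto
    finally show ?thesis using of_real_eq_iff by blast
  qed
  have le: "Re (expectation (\<lambda>\<omega>. indicator (stays S (real i * h)) \<omega> * biexp \<alpha> \<beta> (Z (real i * h) \<omega>))) \<le> q ^ i" for i
  proof -
    have "norm (expectation (\<lambda>\<omega>. indicator (stays S (real i * h)) \<omega> * biexp \<alpha> \<beta> (Z (real i * h) \<omega>)))
       \<le> expectation (\<lambda>\<omega>. norm (indicator (stays S (real i * h)) \<omega> * biexp \<alpha> \<beta> (Z (real i * h) \<omega>)))"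
      by (rule integral_norm_bound)
    also have "\<dots> \<le> expectation (\<lambda>\<omega>. norm (biexp \<alpha> \<beta> (Z (real i * h) \<omega>)))"
      using h by (intro integral_mono' integrable_norm integrable_biexp) (auto simp: indicator_def)
    finally show ?thesis unfolding E using complex_Re_le_cmod order_trans by blast
  qed
  have "Re (expectation (stop_sum \<alpha> \<beta> S h n)) = 1 + (\<Sum>i<n. Re (expectation (\<lambda>\<omega>. indicator (stays S (real i * h)) \<omega> * biexp \<alpha> \<beta> (Z (real i * h) \<omega>))) * (q - 1))"
    unfolding expectation_stop_sum[OF S h] q by (simp add: of_real_diff flip: of_real_diff)
  also have "\<dots> \<le> 1 + (\<Sum>i<n. q ^ i * (q - 1))"
    using q1 by (intro add_left_mono sum_mono mult_right_mono le) auto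
  also have "(\<Sum>i<n. q ^ i * (q - 1)) = (\<Sum>i<n. q ^ Suc i - q ^ i)"
    by (intro sum.cong) (auto simp: algebra_simps)
  also have "\<dots> = q ^ n - 1" by (subst sum_lessThan_telescope) auto
  finally show ?thesis by (simp add: qpow)
qed

text \<open>\<open>P\<close> is any measurable map that agrees with the exit point where the path
  leaves \<open>S\<close>; the exit time is unspecified elsewhere. The mesh tends to 0 at a fixed
  horizon \<open>T\<close>, and afterwards \<open>T\<close> tends to infinity, where boundedness of
  \<open>S\<close> gives domination.\<close>

lemma expectation_exp_exit:
  fixes \<mu> :: complex
  assumes S: "open S" "0 \<in> S" "bounded S"
    and P[measurable]: "P \<in> borel_measurable M" and P_eq: "\<And>\<omega>. \<omega> \<in> space M \<Longrightarrow> leaves S \<omega> \<Longrightarrow> P \<omega> = Z (exit_from S \<omega>) \<omega>"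
  shows "expectation (\<lambda>\<omega>. exp (\<mu> * P \<omega>)) = 1"
proof -
  have U: "S \<noteq> UNIV" using assms(3) not_bounded_UNIV by metis
  obtain R where R: "closure S \<subseteq> cball 0 R" using bounded_closure[OF S(3)] by (meson ball_subset_cball bounded_subset_ballD order_trans)
  have bi: "biexp \<mu> (\<i> * \<mu>) z = exp (\<mu> * z)" for z
    by (simp add: biexp_def) (metis complex_eq distrib_left mult.assoc mult.left_commute)
  have norm_exp: "norm (exp (\<mu> * z)) \<le> exp (norm \<mu> * R)" if "z \<in> closure S" for z
  proof -
    have "Re (\<mu> * z) \<le> norm \<mu> * norm z" using complex_Re_le_cmod[of "\<mu> * z"] by (simp add: norm_mult)
    also have "\<dots> \<le> norm \<mu> * R" using that R by (intro mult_left_mono) auto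
    finally show ?thesis by (simp add: norm_exp_eq_Re)
  qed
  have AE_L: "AE \<omega> in M. \<omega> \<in> space M \<and> leaves S \<omega>" using AE_leaves[OF S] by auto
  \<comment> \<open>As a pointwise limit of measurable functions \<open>W T\<close> is measurable
    without regard to the exit time; only its almost sure value involves the latter.\<close>
  define W where "W T \<omega> = lim (\<lambda>n. stop_sum \<mu> (\<i> * \<mu>) S (T / real (Suc n)) (Suc n) \<omega>)" for T \<omega>
  have meas: "stop_sum \<mu> (\<i> * \<mu>) S h n \<in> borel_measurable M" if "h > 0" for h n
    using integrable_stop_sum[OF S(1) U S(2) that] by (rule borel_measurable_integrable)
  have W_lim: "(\<lambda>n. stop_sum \<mu> (\<i> * \<mu>) S (T / real (Suc n)) (Suc n) \<omega>) \<longlonglongrightarrow> exp (\<mu> * Z (min (exit_from S \<omega>) T) \<omega>)"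
    if "T > 0" and \<omega>: "\<omega> \<in> space M" "leaves S \<omega>" for T \<omega>
  proof -
    define k where "k n = card {i. i < Suc n \<and> \<omega> \<in> stays S (real i * (T / real (Suc n)))}" for n
    define u where "u n = real (k n) * (T / real (Suc n))" for n
    note ex = exit_from_props[OF S(1) \<omega>]
    \<comment> \<open>The time \<open>u n\<close> is the exit time rounded up to the mesh and capped
      at \<open>T\<close>, so it errs by at most one mesh width.\<close>
    have u: "\<bar>u n - min (exit_from S \<omega>) T\<bar> \<le> T / real (Suc n)" "u n \<ge> 0" for n
    proof -
      define h where "h = T / real (Suc n)"
      have h: "h > 0" "real (Suc n) * h = T" using \<open>T > 0\<close> by (auto simp: h_def)
      have "{i. i < Suc n \<and> real i * h < exit_from S \<omega>} = {..<card {i. i < Suc n \<and> real i * h < exit_from S \<omega>}}"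
        using h by (intro card_initial_segment) (smt (verit) mult_right_mono of_nat_le_iff)
      then have seg: "i < Suc n \<and> real i * h < exit_from S \<omega> \<longleftrightarrow> i < k n" for i
        unfolding k_def ex(4) h_def[symmetric] by blast
      have kn: "k n \<le> Suc n" using seg[of "Suc n"] by auto
      have "real (k n) * h \<le> T" using kn h(1) unfolding h(2)[symmetric] by (intro mult_right_mono) auto
      moreover have "real (k n) * h \<le> exit_from S \<omega> + h"
      proof (cases "k n")
        case (Suc j)
        then show ?thesis using seg[of j] h by (simp add: algebra_simps)
      qed (use ex h in simp)
      moreover have "T \<le> real (k n) * h \<or> exit_from S \<omega> \<le> real (k n) * h"
      proof (cases "k n = Suc n")
        case False
        then show ?thesis using kn seg[of "k n"] by auto
      qed (use h in simp)
      ultimately show "\<bar>u n - min (exit_from S \<omega>) T\<bar> \<le> T / real (Suc n)" "u n \<ge> 0"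
        using h(1) unfolding u_def h_def[symmetric] by (auto simp: min_def abs_le_iff)
    qed
    have "(\<lambda>n. T / real (Suc n)) \<longlonglongrightarrow> 0" by (rule LIMSEQ_Suc[OF lim_const_over_n])
    then have "(\<lambda>n. u n - min (exit_from S \<omega>) T) \<longlonglongrightarrow> 0"
      by (rule Lim_null_comparison[rotated]) (use u in auto)
    then have "u \<longlonglongrightarrow> min (exit_from S \<omega>) T" by (simp add: LIM_zero_iff)
    then have "(\<lambda>n. Z (u n) \<omega>) \<longlonglongrightarrow> Z (min (exit_from S \<omega>) T) \<omega>"
      using continuous_on_Z[OF \<omega>(1)] u ex(1) \<open>T > 0\<close>
      by (intro continuous_on_tendsto_compose[of "{0..}" "\<lambda>t. Z t \<omega>"]) auto
    then have "(\<lambda>n. exp (\<mu> * Z (u n) \<omega>)) \<longlonglongrightarrow> exp (\<mu> * Z (min (exit_from S \<omega>) T) \<omega>)"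
      by (intro tendsto_intros)
    moreover have "stop_sum \<mu> (\<i> * \<mu>) S (T / real (Suc n)) (Suc n) \<omega> = exp (\<mu> * Z (u n) \<omega>)" for n
      using \<open>T > 0\<close> by (subst stop_sum_eq[OF \<omega>(1)]) (auto simp: bi u_def k_def simp del: of_nat_Suc)
    ultimately show ?thesis by simp
  qed
  have W_eq: "W T \<omega> = exp (\<mu> * Z (min (exit_from S \<omega>) T) \<omega>)" if "T > 0" "\<omega> \<in> space M" "leaves S \<omega>" for T \<omega>
    unfolding W_def using W_lim[OF that] by (rule limI)
  have W_meas: "W T \<in> borel_measurable M" if "T > 0" for T
    unfolding W_def by (intro borel_measurable_lim_metric meas) (use that in auto)
  have W_le: "norm (W T \<omega>) \<le> exp (norm \<mu> * R)" if "T > 0" "\<omega> \<in> space M" "leaves S \<omega>" for T \<omega>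
    using exit_from_props(1)[OF S(1) that(2,3)] that
    unfolding W_eq[OF that] by (intro norm_exp before_exit_in_closure S) auto
  have EW: "expectation (W T) = 1" if "T > 0" for T
  proof (rule expectation_eq_of_bounded_second_moments)
    fix n
    have h: "T / real (Suc n) > 0" using that by simp
    show "integrable M (stop_sum \<mu> (\<i> * \<mu>) S (T / real (Suc n)) (Suc n))"
      by (rule integrable_stop_sum[OF S(1) U S(2) h])
    show "stop_sum \<mu> (\<i> * \<mu>) S (T / real (Suc n)) (Suc n) \<in> borel_measurable M" using meas h by blast
    show "expectation (stop_sum \<mu> (\<i> * \<mu>) S (T / real (Suc n)) (Suc n)) = 1"
      by (subst expectation_stop_sum[OF S(1) U S(2) h]) (simp add: power_mult_distrib)
    \<comment> \<open>Since
      \<open>(norm (exp (\<mu> * z)))\<^sup>2 = exp (2 * Re (\<mu> * z))\<close>, the squared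
      modulus is itself a stopped sum with real exponents.\<close>
    let ?s = "stop_sum (of_real (2 * Re \<mu>)) (of_real (- 2 * Im \<mu>)) S (T / real (Suc n)) (Suc n)"
    have sq: "(norm (stop_sum \<mu> (\<i> * \<mu>) S (T / real (Suc n)) (Suc n) \<omega>))\<^sup>2 = Re (?s \<omega>)" if "\<omega> \<in> space M" for \<omega>
      unfolding stop_sum_eq[OF that h] bi
      by (simp add: biexp_def norm_exp_eq_Re Re_exp power2_eq_square algebra_simps flip: exp_add)
    have int: "integrable M (\<lambda>\<omega>. Re (?s \<omega>))"
      by (intro integrable_Re integrable_stop_sum[OF S(1) U S(2) h])
    show "integrable M (\<lambda>\<omega>. (norm (stop_sum \<mu> (\<i> * \<mu>) S (T / real (Suc n)) (Suc n) \<omega>))\<^sup>2)"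
      using int by (subst Bochner_Integration.integrable_cong[OF refl sq])
    have "expectation (\<lambda>\<omega>. (norm (stop_sum \<mu> (\<i> * \<mu>) S (T / real (Suc n)) (Suc n) \<omega>))\<^sup>2) = expectation (\<lambda>\<omega>. Re (?s \<omega>))"
      by (rule Bochner_Integration.integral_cong[OF refl sq])
    also have "\<dots> = Re (expectation ?s)"
      by (rule integral_Re[OF integrable_stop_sum[OF S(1) U S(2) h]])
    also have "\<dots> \<le> exp (((2 * Re \<mu>)\<^sup>2 + (- 2 * Im \<mu>)\<^sup>2) * T / 2)"
      using expectation_stop_sum_le[OF S(1) U S(2) h, of "2 * Re \<mu>" "- 2 * Im \<mu>" "Suc n"] by simp
    finally show "expectation (\<lambda>\<omega>. (norm (stop_sum \<mu> (\<i> * \<mu>) S (T / real (Suc n)) (Suc n) \<omega>))\<^sup>2)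
       \<le> exp (((2 * Re \<mu>)\<^sup>2 + (- 2 * Im \<mu>)\<^sup>2) * T / 2)" .
  next
    show "AE \<omega> in M. (\<lambda>n. stop_sum \<mu> (\<i> * \<mu>) S (T / real (Suc n)) (Suc n) \<omega>) \<longlonglongrightarrow> W T \<omega>"
      using AE_L by eventually_elim (use W_lim W_eq that in auto)
    show "AE \<omega> in M. norm (W T \<omega>) \<le> exp (norm \<mu> * R)"
      using AE_L by eventually_elim (use W_le that in auto)
  qed (use W_meas that in auto)
  have "(\<lambda>n. expectation (W (real (Suc n)))) \<longlonglongrightarrow> expectation (\<lambda>\<omega>. exp (\<mu> * P \<omega>))"
  proof (rule integral_dominated_convergence[where w="\<lambda>_. exp (norm \<mu> * R)"])
    show "AE \<omega> in M. (\<lambda>n. W (real (Suc n)) \<omega>) \<longlonglongrightarrow> exp (\<mu> * P \<omega>)"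
      using AE_L
    proof eventually_elim
      case (elim \<omega>)
      have "\<forall>\<^sub>F n in sequentially. W (real (Suc n)) \<omega> = exp (\<mu> * P \<omega>)"
        using eventually_ge_at_top[of "nat \<lceil>exit_from S \<omega>\<rceil>"]
      proof eventually_elim
        case le: (elim n)
        then have "exit_from S \<omega> \<le> real (Suc n)" by (simp add: nat_le_iff ceiling_le_iff)
        then show ?case using elim by (subst W_eq) (auto simp: min_absorb1 P_eq)
      qed
      then show ?case by (rule tendsto_eventually)
    qed
    show "AE \<omega> in M. norm (W (real (Suc n)) \<omega>) \<le> exp (norm \<mu> * R)" for n
      using AE_L by eventually_elim (use W_le in auto)
  qed (use W_meas in auto)
  then show ?thesis
    using EW by (simp add: LIMSEQ_const_iff)
qed

end

section \<open>The law of the exit point\<close>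

lemma has_bochner_integral_exp_halfline:
  fixes z :: complex
  assumes "Re z > 0"
  shows "has_bochner_integral lborel (\<lambda>x. indicator {0<..} x *\<^sub>R exp (- (of_real x * z))) (1 / z)"
proof -
  have z: "z \<noteq> 0" using assms by auto
  have "((\<lambda>x. exp (- Re z * x)) has_integral exp (- Re z * 0) / Re z) {0..}"
    using assms by (intro has_integral_exp_minus_to_infinity)
  then have "set_integrable lebesgue {0..} (\<lambda>x. exp (- Re z * x))"
    by (intro absolutely_integrable_onI) (auto simp: has_integral_iff)
  then have "set_integrable lebesgue {0<..} (\<lambda>x. exp (- Re z * x))"
    by (rule set_integrable_subset) auto
  then have intR: "set_integrable lborel {0<..} (\<lambda>x. exp (- Re z * x))"
    unfolding set_integrable_def by (subst (asm) integrable_completion) auto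
  have int: "set_integrable lborel (einterval 0 \<infinity>) (\<lambda>x. exp (- (of_real x * z)))"
    unfolding set_integrable_def
    by (rule Bochner_Integration.integrable_bound[OF intR[unfolded set_integrable_def]])
       (auto simp: indicator_def einterval_def norm_exp_eq_Re zero_ereal_def mult.commute)
  have lim: "((\<lambda>x. - exp (- (of_real x * z)) / z) \<longlongrightarrow> 0) at_top"
  proof (rule Lim_null_comparison[where g="\<lambda>x. exp (- (Re z * x)) / norm z"])
    show "((\<lambda>x. exp (- (Re z * x)) / norm z) \<longlongrightarrow> 0) at_top"
      using assms z by real_asymp
  qed (auto simp: norm_divide norm_exp_eq_Re mult.commute)
  have "(LBINT x=0..\<infinity>. exp (- (of_real x * z))) = 0 - (- exp (- (of_real 0 * z)) / z)"
  proof (rule interval_integral_FTC_integrable[OF _ _ _ int])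
    fix x :: real
    show "((\<lambda>x. - exp (- (of_real x * z)) / z) has_vector_derivative exp (- (of_real x * z))) (at x)"
      using z by (auto intro!: derivative_eq_intros has_vector_derivative_real_field)
    show "isCont (\<lambda>x. exp (- (complex_of_real x * z))) x" by (intro continuous_intros)
  next
    show "(((\<lambda>x. - exp (- (complex_of_real x * z)) / z) \<circ> real_of_ereal) \<longlongrightarrow> - exp (- (complex_of_real 0 * z)) / z) (at_right 0)"
      unfolding zero_ereal_def ereal_tendsto_simps using z by (intro tendsto_intros)
    show "(((\<lambda>x. - exp (- (complex_of_real x * z)) / z) \<circ> real_of_ereal) \<longlongrightarrow> 0) (at_left \<infinity>)"
      unfolding ereal_tendsto_simps by (rule lim)
  qed simp
  then show ?thesis
    using int z unfolding has_bochner_integral_iff interval_lebesgue_integral_def set_integrable_def set_lebesgue_integral_def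
    by (simp add: einterval_def zero_ereal_def greaterThan_def)
qed

lemma (in prob_space) expectation_resolvent:
  fixes Q :: "'a \<Rightarrow> complex" and a :: real
  assumes Q[measurable]: "Q \<in> borel_measurable M" and Re: "AE \<omega> in M. Re (Q \<omega>) \<le> a"
    and exp1: "\<And>x. 0 \<le> x \<Longrightarrow> expectation (\<lambda>\<omega>. exp (of_real x * Q \<omega>)) = 1"
    and w: "Re w > a" "Re w > 0"
  shows "expectation (\<lambda>\<omega>. 1 / (w - Q \<omega>)) = 1 / w"
proof -
  interpret pair_sigma_finite M lborel ..
  define f where "f \<omega> x = indicator {0<..} x *\<^sub>R exp (- (of_real x * (w - Q \<omega>)))" for \<omega> and x :: real
  have f_meas: "(\<lambda>(\<omega>, x). f \<omega> x) \<in> borel_measurable (M \<Otimes>\<^sub>M lborel)" unfolding f_def by measurable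
  have L: "has_bochner_integral lborel (f \<omega>) (1 / (w - Q \<omega>))" if "Re (Q \<omega>) \<le> a" for \<omega>
    unfolding f_def using that w by (intro has_bochner_integral_exp_halfline) auto
  \<comment> \<open>Fubini needs the absolute values: they integrate to
    \<open>1 / (Re w - Re (Q \<omega>))\<close>, which is at most \<open>1 / (Re w - a)\<close>
    whatever the position of \<open>Q \<omega>\<close>.\<close>
  have LN: "has_bochner_integral lborel (\<lambda>x. norm (f \<omega> x)) (1 / (Re w - Re (Q \<omega>)))" if "Re (Q \<omega>) \<le> a" for \<omega>
  proof -
    have "Re (w - Q \<omega>) > 0" using that w by simp
    then have "has_bochner_integral lborel (\<lambda>x. Re (indicator {0<..} x *\<^sub>R exp (- (of_real x * of_real (Re (w - Q \<omega>)))))) (Re (1 / of_real (Re (w - Q \<omega>))))"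
      by (intro has_bochner_integral_Re has_bochner_integral_exp_halfline) auto
    moreover have "Re (indicator {0<..} x *\<^sub>R exp (- (of_real x * of_real (Re (w - Q \<omega>))))) = norm (f \<omega> x)" for x
      by (simp add: f_def norm_exp_eq_Re Re_exp)
    moreover have "Re (1 / of_real (Re (w - Q \<omega>))) = 1 / (Re w - Re (Q \<omega>))"
      by (simp flip: of_real_diff add: Re_divide_of_real)
    ultimately show ?thesis by simp
  qed
  have int: "integrable (M \<Otimes>\<^sub>M lborel) (\<lambda>(\<omega>, x). f \<omega> x)"
  proof (rule Fubini_integrable[OF f_meas])
    show "AE \<omega> in M. integrable lborel (\<lambda>x. case (\<omega>, x) of (\<omega>, x) \<Rightarrow> f \<omega> x)"
      using Re by eventually_elim (use L in \<open>auto simp: has_bochner_integral_iff\<close>)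
    show "integrable M (\<lambda>\<omega>. \<integral>x. norm (case (\<omega>, x) of (\<omega>, x) \<Rightarrow> f \<omega> x) \<partial>lborel)"
    proof (rule integrable_const_bound[where B="1 / (Re w - a)"])
      show "AE \<omega> in M. norm (\<integral>x. norm (case (\<omega>, x) of (\<omega>, x) \<Rightarrow> f \<omega> x) \<partial>lborel) \<le> 1 / (Re w - a)"
        using Re by eventually_elim (use LN w in \<open>auto simp: has_bochner_integral_iff frac_le\<close>)
      show "(\<lambda>\<omega>. \<integral>x. norm (case (\<omega>, x) of (\<omega>, x) \<Rightarrow> f \<omega> x) \<partial>lborel) \<in> borel_measurable M"
        using f_meas by measurable
    qed
  qed
  have "expectation (\<lambda>\<omega>. 1 / (w - Q \<omega>)) = expectation (\<lambda>\<omega>. \<integral>x. f \<omega> x \<partial>lborel)"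
  proof (rule integral_cong_AE)
    show "AE \<omega> in M. 1 / (w - Q \<omega>) = (\<integral>x. f \<omega> x \<partial>lborel)"
      using Re by eventually_elim (use L in \<open>auto simp: has_bochner_integral_iff\<close>)
    show "(\<lambda>\<omega>. \<integral>x. f \<omega> x \<partial>lborel) \<in> borel_measurable M" using f_meas by measurable
  qed measurable
  also have "\<dots> = (\<integral>x. expectation (\<lambda>\<omega>. f \<omega> x) \<partial>lborel)"
    by (rule Fubini_integral[OF int, symmetric])
  also have "\<dots> = (\<integral>x. indicator {0<..} x *\<^sub>R exp (- (of_real x * w)) \<partial>lborel)"
  proof (intro Bochner_Integration.integral_cong refl)
    fix x :: real
    have "f \<omega> x = indicator {0<..} x *\<^sub>R exp (- (of_real x * w)) * exp (of_real x * Q \<omega>)" for \<omega>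
      by (simp add: f_def algebra_simps flip: exp_add)
    then show "expectation (\<lambda>\<omega>. f \<omega> x) = indicator {0<..} x *\<^sub>R exp (- (of_real x * w))"
      using exp1[of x] by (cases "x > 0") auto
  qed
  also have "\<dots> = 1 / w"
    using has_bochner_integral_exp_halfline[of w] w by (simp add: has_bochner_integral_iff)
  finally show ?thesis .
qed

text \<open>Inscribed angle theorem: the chord on the line of abscissa \<open>a\<close> is seen under the constant angle
  \<open>arccos a\<close> from the points of the unit circle to its left.\<close>

lemma arctan_sum_on_circle:
  fixes a x y :: real
  assumes "0 < a" "a < 1" "x < a" "x\<^sup>2 + y\<^sup>2 = 1"
  defines "b \<equiv> sqrt (1 - a\<^sup>2)"
  shows "arctan ((b - y) / (a - x)) + arctan ((b + y) / (a - x)) = arctan (b / a)"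
proof -
  define p q where "p = (b - y) / (a - x)" and "q = (b + y) / (a - x)"
  have b2: "b\<^sup>2 = 1 - a\<^sup>2" using assms by (simp add: b_def power_le_one)
  have d: "a - x > 0" using assms by simp
  have y2: "y\<^sup>2 = 1 - x\<^sup>2" using assms(4) by simp
  have "p * q = (b\<^sup>2 - y\<^sup>2) / (a - x)\<^sup>2"
    by (simp add: p_def q_def power2_eq_square algebra_simps)
  then have "1 - p * q = ((a - x)\<^sup>2 - (b\<^sup>2 - y\<^sup>2)) / (a - x)\<^sup>2"
    using d by (simp add: diff_divide_distrib)
  also have "(a - x)\<^sup>2 - (b\<^sup>2 - y\<^sup>2) = 2 * a * (a - x)"
    unfolding b2 y2 by (simp add: power2_eq_square algebra_simps)
  finally have pq: "1 - p * q = 2 * a / (a - x)" using d by (simp add: power2_eq_square)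
  then have pos: "1 - p * q > 0" using d assms by simp
  have sum: "p + q = 2 * b / (a - x)" by (simp add: p_def q_def add_divide_distrib[symmetric])
  have bounds: "-(pi/2) < arctan p" "arctan p < pi/2" "-(pi/2) < arctan q" "arctan q < pi/2"
    using arctan_bounded by auto
  have cpos: "cos (arctan p) > 0" "cos (arctan q) > 0" by (simp_all add: cos_arctan add_pos_nonneg)
  have "cos (arctan p + arctan q) = cos (arctan p) * cos (arctan q) * (1 - tan (arctan p) * tan (arctan q))"
    using cpos by (simp add: cos_add tan_def field_simps)
  then have c: "cos (arctan p + arctan q) > 0" using cpos pos by (simp add: tan_arctan)
  \<comment> \<open>The addition formula for the tangent determines the sum only up to multiples of
    \<open>pi\<close>. Positivity of \<open>1 - p * q\<close>, which comes from
    \<open>a > 0\<close>, makes the cosine of the sum positive and keeps the sum on the principal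
    branch.\<close>
  have range: "-(pi/2) < arctan p + arctan q" "arctan p + arctan q < pi/2"
  proof -
    have "\<not> arctan p + arctan q \<ge> pi/2"
    proof
      assume "arctan p + arctan q \<ge> pi/2"
      then have "cos (arctan p + arctan q) \<le> cos (pi/2)"
        using bounds by (intro cos_monotone_0_pi_le) auto
      then show False using c by simp
    qed
    moreover have "\<not> - (arctan p + arctan q) \<ge> pi/2"
    proof
      assume "- (arctan p + arctan q) \<ge> pi/2"
      then have "cos (- (arctan p + arctan q)) \<le> cos (pi/2)"
        using bounds by (intro cos_monotone_0_pi_le) auto
      then show False using c by (simp only: cos_minus) simp
    qed
    ultimately show "-(pi/2) < arctan p + arctan q" "arctan p + arctan q < pi/2" by auto
  qed
  have "tan (arctan p + arctan q) = (p + q) / (1 - p * q)"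
    using tan_add[of "arctan p" "arctan q"] c cpos by (simp add: tan_arctan)
  also have "\<dots> = b / a" unfolding sum pq using d assms by (simp add: field_simps)
  finally have "arctan (b / a) = arctan p + arctan q"
    by (rule arctan_unique[OF range])
  then show ?thesis unfolding p_def q_def by (rule sym)
qed

lemma arccos_eq_arctan:
  assumes "0 < a" "a < 1"
  shows "arctan (sqrt (1 - a\<^sup>2) / a) = arccos a"
proof -
  have "tan (arccos a) = sqrt (1 - a\<^sup>2) / a"
    using assms by (simp add: tan_def sin_arccos)
  then show ?thesis
    using arctan_tan[of "arccos a"] assms arccos_lt_bounded[of a] arccos_less_arccos[of 0 a] by simp
qed

text \<open>Up to the factor \<open>1 / pi\<close> this is the Poisson kernel of the half plane to
  the left of abscissa \<open>c\<close>, whose integral along a chord is an angle.\<close>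

lemma Re_inverse_line:
  "Re (1 / (Complex c s - z)) = (c - Re z) / ((c - Re z)\<^sup>2 + (s - Im z)\<^sup>2)"
  by (simp add: Re_divide)

lemma arctan_kernel_integral:
  fixes w y b :: real
  assumes "w > 0" "0 \<le> b"
  shows "has_bochner_integral lborel (\<lambda>s. indicator {-b..b} s *\<^sub>R (w / (w\<^sup>2 + (s - y)\<^sup>2)))
     (arctan ((b - y) / w) + arctan ((b + y) / w))"
proof -
  have ne: "w\<^sup>2 + x\<^sup>2 \<noteq> 0" for x :: real using assms by (smt (verit) zero_le_power2 zero_less_power)
  have "has_bochner_integral lborel (\<lambda>s. (w / (w\<^sup>2 + (s - y)\<^sup>2)) * indicator {-b..b} s)
     (arctan ((b - y) / w) - arctan ((-b - y) / w))"
  proof (rule has_bochner_integral_FTC_Icc_nonneg)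
    show "((\<lambda>s. arctan ((s - y) / w)) has_real_derivative w / (w\<^sup>2 + (s - y)\<^sup>2)) (at s)" for s
      using assms ne[of "s - y"]
      by (auto intro!: derivative_eq_intros simp: field_simps power2_eq_square)
  qed (use assms ne in auto)
  moreover have "arctan ((-b - y) / w) = - arctan ((b + y) / w)"
    by (simp flip: arctan_minus add: minus_divide_left)
  ultimately show ?thesis by (simp add: mult.commute)
qed

lemma (in prob_space) exit_point_law:
  fixes Q :: "'a \<Rightarrow> complex" and a :: real
  assumes a: "0 < a" "a < 1" and Q[measurable]: "Q \<in> borel_measurable M"
    and bd: "AE \<omega> in M. Re (Q \<omega>) \<le> a \<and> norm (Q \<omega>) \<le> 1 \<and> (Re (Q \<omega>) = a \<or> norm (Q \<omega>) = 1)"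
    and exp1: "\<And>x. 0 \<le> x \<Longrightarrow> expectation (\<lambda>\<omega>. exp (of_real x * Q \<omega>)) = 1"
  shows "prob {\<omega> \<in> space M. Re (Q \<omega>) < a} = 2 * arcsin a / (pi - arccos a)"
proof -
  define b where "b = sqrt (1 - a\<^sup>2)"
  have a2: "a\<^sup>2 < 1" using a by (simp add: power_less_one_iff)
  have b: "b > 0" "b\<^sup>2 = 1 - a\<^sup>2" using a2 by (simp_all add: b_def)
  have Re: "AE \<omega> in M. Re (Q \<omega>) \<le> a" using bd by auto
  define k where "k c s \<omega> = Re (1 / (Complex c s - Q \<omega>))" for c s \<omega>
  have k_eq: "k c s \<omega> = (c - Re (Q \<omega>)) / ((c - Re (Q \<omega>))\<^sup>2 + (s - Im (Q \<omega>))\<^sup>2)" for c s \<omega>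
    unfolding k_def by (rule Re_inverse_line)
  have k_meas[measurable]: "(\<lambda>(\<omega>, s). k c s \<omega>) \<in> borel_measurable (M \<Otimes>\<^sub>M lborel)" for c
    unfolding k_eq by measurable
  have k_le: "norm (1 / (Complex c s - Q \<omega>)) \<le> 1 / (c - a)" if "c > a" "Re (Q \<omega>) \<le> a" for c s \<omega>
  proof -
    have "c - a \<le> Re (Complex c s - Q \<omega>)" using that by simp
    also have "\<dots> \<le> norm (Complex c s - Q \<omega>)" by (rule complex_Re_le_cmod)
    finally show ?thesis using that by (simp add: norm_divide frac_le)
  qed
  have k_le': "\<bar>k c s \<omega>\<bar> \<le> 1 / (c - a)" if "c > a" "Re (Q \<omega>) \<le> a" for c s \<omega>
    using k_le[OF that] abs_Re_le_cmod order_trans unfolding k_def by blast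
  have Ek: "expectation (k c s) = c / (c\<^sup>2 + s\<^sup>2)" and Ik: "integrable M (k c s)" if "c > a" for c s
  proof -
    have int: "integrable M (\<lambda>\<omega>. 1 / (Complex c s - Q \<omega>))"
      using Re by (intro integrable_const_bound[where B="1 / (c - a)"]) (auto elim!: eventually_mono intro: k_le that)
    then show "integrable M (k c s)" unfolding k_def by (rule integrable_Re)
    have "expectation (k c s) = Re (expectation (\<lambda>\<omega>. 1 / (Complex c s - Q \<omega>)))"
      unfolding k_def by (rule integral_Re[OF int])
    also have "\<dots> = Re (1 / Complex c s)"
      using that a by (subst expectation_resolvent[OF Q Re exp1]) auto
    also have "\<dots> = c / (c\<^sup>2 + s\<^sup>2)" using Re_inverse_line[of c s 0] by simp
    finally show "expectation (k c s) = c / (c\<^sup>2 + s\<^sup>2)" .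
  qed
  \<comment> \<open>At the point \<open>Complex a s\<close> the kernel \<open>k (a + \<epsilon>) s\<close> equals \<open>1 / \<epsilon>\<close>, while its mean stays bounded as \<open>\<epsilon>\<close> tends to 0.\<close>
  have corner: "AE \<omega> in M. Q \<omega> \<noteq> Complex a s" for s
  proof -
    let ?C = "{\<omega> \<in> space M. Q \<omega> = Complex a s}"
    have le: "prob ?C \<le> 1 / a * (1 / real (Suc n))" for n
    proof -
      define \<epsilon> where "\<epsilon> = 1 / real (Suc n)"
      have \<epsilon>: "\<epsilon> > 0" by (simp add: \<epsilon>_def)
      have "prob ?C * (1 / \<epsilon>) = expectation (\<lambda>\<omega>. indicator ?C \<omega> * (1 / \<epsilon>))"
        by simp
      also have "\<dots> \<le> expectation (k (a + \<epsilon>) s)"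
      proof (rule integral_mono_AE)
        show "AE \<omega> in M. indicator ?C \<omega> * (1 / \<epsilon>) \<le> k (a + \<epsilon>) s \<omega>"
          using Re
        proof eventually_elim
          case (elim \<omega>)
          then show ?case using \<epsilon>
            by (cases "\<omega> \<in> ?C") (auto simp: k_eq power2_eq_square)
        qed
        show "integrable M (\<lambda>\<omega>. indicator ?C \<omega> * (1 / \<epsilon>))"
          by (rule integrable_const_bound[where B="1 / \<epsilon>"]) (use \<epsilon> in \<open>auto simp: indicator_def\<close>)
      qed (use Ik \<epsilon> in auto)
      also have "\<dots> = (a + \<epsilon>) / ((a + \<epsilon>)\<^sup>2 + s\<^sup>2)" using Ek \<epsilon> by simp
      also have "\<dots> \<le> (a + \<epsilon>) / ((a + \<epsilon>)\<^sup>2)" using a \<epsilon> by (intro divide_left_mono) (auto intro!: mult_pos_pos add_pos_nonneg)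
      also have "\<dots> \<le> 1 / a" using a \<epsilon> by (simp add: power2_eq_square frac_le)
      finally show ?thesis unfolding \<epsilon>_def[symmetric] using \<epsilon> a by (simp add: field_simps)
    qed
    have "(\<lambda>n. 1 / a * (1 / real (Suc n))) \<longlonglongrightarrow> 1 / a * 0"
      by (intro tendsto_mult tendsto_const LIMSEQ_Suc[OF lim_const_over_n])
    then have "prob ?C \<le> 1 / a * 0" by (rule LIMSEQ_le_const) (use le in auto)
    then have "prob ?C = 0" using measure_nonneg[of M ?C] by simp
    then show ?thesis by (subst (asm) prob_Collect_eq_0) auto
  qed
  \<comment> \<open>\<open>g c \<omega>\<close> is the angle under which the chord, shifted to abscissa \<open>c\<close>, is seen from \<open>Q \<omega>\<close>.\<close>
  define g where "g c \<omega> = arctan ((b - Im (Q \<omega>)) / (c - Re (Q \<omega>))) + arctan ((b + Im (Q \<omega>)) / (c - Re (Q \<omega>)))" for c \<omega>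
  have g_meas[measurable]: "g c \<in> borel_measurable M" for c unfolding g_def by measurable
  have Eg: "expectation (g c) = 2 * arctan (b / c)" if c: "c > a" for c
  proof -
    interpret pair_sigma_finite M lborel ..
    define f where "f \<omega> s = indicator {-b..b} s *\<^sub>R k c s \<omega>" for \<omega> s
    have f_meas: "(\<lambda>(\<omega>, s). f \<omega> s) \<in> borel_measurable (M \<Otimes>\<^sub>M lborel)" unfolding f_def by measurable
    have B: "has_bochner_integral lborel (f \<omega>) (g c \<omega>)" if "Re (Q \<omega>) \<le> a" for \<omega>
      unfolding f_def g_def k_eq using that c b by (intro arctan_kernel_integral) auto
    have int: "integrable (M \<Otimes>\<^sub>M lborel) (\<lambda>(\<omega>, s). f \<omega> s)"
    proof (rule Fubini_integrable[OF f_meas])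
      show "AE \<omega> in M. integrable lborel (\<lambda>x. case (\<omega>, x) of (\<omega>, x) \<Rightarrow> f \<omega> x)"
        using Re by eventually_elim (use B in \<open>auto simp: has_bochner_integral_iff\<close>)
      show "integrable M (\<lambda>\<omega>. \<integral>x. norm (case (\<omega>, x) of (\<omega>, x) \<Rightarrow> f \<omega> x) \<partial>lborel)"
      proof (rule integrable_const_bound[where B="2 * pi"])
        show "AE \<omega> in M. norm (\<integral>x. norm (case (\<omega>, x) of (\<omega>, x) \<Rightarrow> f \<omega> x) \<partial>lborel) \<le> 2 * pi"
          using Re
        proof eventually_elim
          case (elim \<omega>)
          have "norm (f \<omega> x) = f \<omega> x" for x
            using elim c by (auto simp: f_def k_eq indicator_def)
          then show ?case
            using B[OF elim] arctan_bounded[of "(b - Im (Q \<omega>)) / (c - Re (Q \<omega>))"]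
              arctan_bounded[of "(b + Im (Q \<omega>)) / (c - Re (Q \<omega>))"]
            by (auto simp: has_bochner_integral_iff g_def abs_le_iff)
        qed
        show "(\<lambda>\<omega>. \<integral>x. norm (case (\<omega>, x) of (\<omega>, x) \<Rightarrow> f \<omega> x) \<partial>lborel) \<in> borel_measurable M"
          using f_meas by measurable
      qed
    qed
    have "expectation (g c) = expectation (\<lambda>\<omega>. \<integral>x. f \<omega> x \<partial>lborel)"
    proof (rule integral_cong_AE)
      show "AE \<omega> in M. g c \<omega> = (\<integral>x. f \<omega> x \<partial>lborel)"
        using Re by eventually_elim (use B in \<open>auto simp: has_bochner_integral_iff\<close>)
      show "(\<lambda>\<omega>. \<integral>x. f \<omega> x \<partial>lborel) \<in> borel_measurable M" using f_meas by measurable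
    qed measurable
    also have "\<dots> = (\<integral>s. expectation (\<lambda>\<omega>. f \<omega> s) \<partial>lborel)"
      by (rule Fubini_integral[OF int, symmetric])
    also have "\<dots> = (\<integral>s. indicator {-b..b} s *\<^sub>R (c / (c\<^sup>2 + (s - 0)\<^sup>2)) \<partial>lborel)"
      unfolding f_def using Ek[OF c] by (intro Bochner_Integration.integral_cong) auto
    also have "\<dots> = 2 * arctan (b / c)"
      using arctan_kernel_integral[of c b 0] c a b by (simp add: has_bochner_integral_iff)
    finally show ?thesis .
  qed
  \<comment> \<open>The limit of the viewing angle as the chord moves back to abscissa
    \<open>a\<close>.\<close>
  define G where "G \<omega> = (if Re (Q \<omega>) < a then arccos a else pi)" for \<omega>
  define c where "c n = a + 1 / real (Suc n)" for n
  have c_gt: "c n > a" for n by (simp add: c_def)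
  have c_lim: "c \<longlonglongrightarrow> a"
    unfolding c_def using tendsto_add[OF tendsto_const[of a] LIMSEQ_Suc[OF lim_const_over_n[of 1]]] by simp
  have c_right: "filterlim (\<lambda>n. c n - a) (at_right 0) sequentially"
    using c_gt[THEN less_imp_neq] c_gt tendsto_diff[OF c_lim tendsto_const[of a]]
    by (auto simp: filterlim_at intro!: always_eventually)
  have "(\<lambda>n. expectation (g (c n))) \<longlonglongrightarrow> expectation G"
  proof (rule integral_dominated_convergence[where w="\<lambda>_. 2 * pi"])
    show "AE \<omega> in M. (\<lambda>n. g (c n) \<omega>) \<longlonglongrightarrow> G \<omega>"
      \<comment> \<open>At an endpoint of the segment one of the two arctangents is 0 throughout and
        the limit is \<open>pi / 2\<close> instead of \<open>pi\<close>; so both endpoints are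
        excluded.\<close>
      using bd corner[of b] corner[of "- b"]
    proof eventually_elim
      case (elim \<omega>)
      show ?case
      proof (cases "Re (Q \<omega>) < a")
        case True
        then have "norm (Q \<omega>) = 1" using elim by auto
        then have "(Re (Q \<omega>))\<^sup>2 + (Im (Q \<omega>))\<^sup>2 = 1" using cmod_power2[of "Q \<omega>"] by simp
        then have "arctan ((b - Im (Q \<omega>)) / (a - Re (Q \<omega>))) + arctan ((b + Im (Q \<omega>)) / (a - Re (Q \<omega>))) = G \<omega>"
          using arctan_sum_on_circle[OF a True] arccos_eq_arctan[OF a] True by (simp add: b_def G_def)
        moreover have "(\<lambda>n. g (c n) \<omega>) \<longlonglongrightarrow> arctan ((b - Im (Q \<omega>)) / (a - Re (Q \<omega>))) + arctan ((b + Im (Q \<omega>)) / (a - Re (Q \<omega>)))"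
          unfolding g_def using True by (intro tendsto_intros c_lim) auto
        ultimately show ?thesis by simp
      next
        case False
        then have ra: "Re (Q \<omega>) = a" using elim by auto
        have "(norm (Q \<omega>))\<^sup>2 \<le> 1" using elim by (simp add: power_le_one)
        then have "(Im (Q \<omega>))\<^sup>2 \<le> b\<^sup>2" unfolding cmod_power2 ra b(2) by simp
        then have "\<bar>Im (Q \<omega>)\<bar> \<le> b" using b(1) by (simp add: abs_le_square_iff[symmetric])
        moreover have "Im (Q \<omega>) \<noteq> b" "Im (Q \<omega>) \<noteq> - b" using elim ra by (auto simp: complex_eq_iff)
        ultimately have pos: "b - Im (Q \<omega>) > 0" "b + Im (Q \<omega>) > 0" by auto
        have lim: "(\<lambda>n. arctan (d / (c n - a))) \<longlonglongrightarrow> pi / 2" if "d > 0" for d :: real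
        proof -
          have "filterlim (\<lambda>n. d / (c n - a)) at_top sequentially"
            by (rule filterlim_compose[OF _ c_right]) (use that in real_asymp)
          then show ?thesis by (rule filterlim_compose[OF tendsto_arctan_at_top])
        qed
        show ?thesis
          using tendsto_add[OF lim[OF pos(1)] lim[OF pos(2)]] ra by (simp add: g_def G_def)
      qed
    qed
    show "AE \<omega> in M. norm (g (c n) \<omega>) \<le> 2 * pi" for n
    proof (rule AE_I2)
      fix \<omega>
      show "norm (g (c n) \<omega>) \<le> 2 * pi"
        using arctan_bounded[of "(b - Im (Q \<omega>)) / (c n - Re (Q \<omega>))"]
              arctan_bounded[of "(b + Im (Q \<omega>)) / (c n - Re (Q \<omega>))"] by (auto simp: g_def abs_le_iff)
    qed
    show "G \<in> borel_measurable M" unfolding G_def by measurable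
  qed auto
  moreover have "(\<lambda>n. expectation (g (c n))) \<longlonglongrightarrow> 2 * arctan (b / a)"
    unfolding Eg[OF c_gt] using a by (intro tendsto_intros c_lim) auto
  ultimately have "expectation G = 2 * arccos a"
    using LIMSEQ_unique arccos_eq_arctan[OF a] unfolding b_def by fastforce
  \<comment> \<open>\<open>G\<close> is affine in the indicator of the arc, so its mean gives a
    linear equation for the probability; \<open>arcsin a = pi / 2 - arccos a\<close> brings the
    solution into the stated form.\<close>
  moreover have "expectation G = expectation (\<lambda>\<omega>. pi - (pi - arccos a) * indicator {\<omega> \<in> space M. Re (Q \<omega>) < a} \<omega>)"
    by (intro Bochner_Integration.integral_cong) (auto simp: G_def)
  moreover have "integrable M (\<lambda>\<omega>. indicator {\<omega> \<in> space M. Re (Q \<omega>) < a} \<omega> :: real)"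
    by (rule integrable_const_bound[where B=1]) auto
  then have "expectation (\<lambda>\<omega>. pi - (pi - arccos a) * indicator {\<omega> \<in> space M. Re (Q \<omega>) < a} \<omega>) =
      pi - (pi - arccos a) * prob {\<omega> \<in> space M. Re (Q \<omega>) < a}"
    by (subst Bochner_Integration.integral_diff) (auto simp: prob_space)
  ultimately have eq: "(pi - arccos a) * prob {\<omega> \<in> space M. Re (Q \<omega>) < a} = pi - 2 * arccos a" by linarith
  have "arcsin a = pi / 2 - arccos a" using arcsin_arccos_eq[of a] a by simp
  then have "2 * arcsin a = (pi - arccos a) * prob {\<omega> \<in> space M. Re (Q \<omega>) < a}" using eq by simp
  moreover have "pi - arccos a \<noteq> 0" using arccos_lt_bounded[of a] a by simp
  ultimately show ?thesis by simp
qed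

section \<open>Extrema in a fixed direction\<close>

lemma floor_grid:
  fixes x :: real
  assumes "0 \<le> x"
  shows "real (nat \<lfloor>real (Suc n) * x\<rfloor>) / real (Suc n) \<le> x"
    and "(\<lambda>n. real (nat \<lfloor>real (Suc n) * x\<rfloor>) / real (Suc n)) \<longlonglongrightarrow> x"
proof -
  let ?k = "\<lambda>n. real (nat \<lfloor>real (Suc n) * x\<rfloor>)"
  have k: "?k n \<le> real (Suc n) * x" "real (Suc n) * x - 1 \<le> ?k n" for n
  proof -
    have "?k n = of_int \<lfloor>real (Suc n) * x\<rfloor>" using assms by simp
    then show "?k n \<le> real (Suc n) * x" "real (Suc n) * x - 1 \<le> ?k n" by linarith+
  qed
  have up: "?k n / real (Suc n) \<le> x" for n
    using divide_right_mono[OF k(1)[of n], of "real (Suc n)"] by simp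
  have lo: "x - 1 / real (Suc n) \<le> ?k n / real (Suc n)" for n
    using divide_right_mono[OF k(2)[of n], of "real (Suc n)"] by (simp add: diff_divide_distrib)
  show "?k n / real (Suc n) \<le> x" by (rule up)
  have "(\<lambda>n. x - 1 / real (Suc n)) \<longlonglongrightarrow> x - 0"
    by (intro tendsto_diff tendsto_const LIMSEQ_Suc[OF lim_const_over_n])
  then have lim: "(\<lambda>n. x - 1 / real (Suc n)) \<longlonglongrightarrow> x" unfolding diff_zero .
  show "(\<lambda>n. ?k n / real (Suc n)) \<longlonglongrightarrow> x"
    by (rule tendsto_sandwich[OF always_eventually[OF allI[OF lo]] always_eventually[OF allI[OF up]] lim tendsto_const])
qed

context planar_BM
begin

text \<open>Rounding the random time down to multiples of \<open>1 / real (Suc n)\<close> leaves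
  countably many deterministic times; continuity of the paths gives the limit.\<close>

lemma Z_random_time_measurable:
  assumes [measurable]: "\<tau> \<in> borel_measurable M" and pos: "\<And>\<omega>. \<omega> \<in> space M \<Longrightarrow> 0 \<le> \<tau> \<omega>"
  shows "(\<lambda>\<omega>. Z (\<tau> \<omega>) \<omega>) \<in> borel_measurable M"
proof -
  define k where "k n \<omega> = nat \<lfloor>real (Suc n) * \<tau> \<omega>\<rfloor>" for n \<omega>
  show ?thesis
  proof (rule borel_measurable_LIMSEQ_metric)
    fix n
    have k: "k n \<in> measurable M (count_space UNIV)" unfolding k_def by measurable
    show "(\<lambda>\<omega>. Z (real (k n \<omega>) / real (Suc n)) \<omega>) \<in> borel_measurable M"
      by (rule measurable_compose_countable[where f="\<lambda>i \<omega>. Z (real i / real (Suc n)) \<omega>", OF _ k]) simp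
  next
    fix \<omega> assume \<omega>: "\<omega> \<in> space M"
    have "(\<lambda>n. real (k n \<omega>) / real (Suc n)) \<longlonglongrightarrow> \<tau> \<omega>"
      unfolding k_def by (rule floor_grid(2)[OF pos[OF \<omega>]])
    then show "(\<lambda>n. Z (real (k n \<omega>) / real (Suc n)) \<omega>) \<longlonglongrightarrow> Z (\<tau> \<omega>) \<omega>"
      using pos[OF \<omega>] by (intro continuous_on_tendsto_compose[OF continuous_on_Z[OF \<omega>]]) auto
  qed
qed

text \<open>For \<open>norm u = 1\<close> the displacement is measured along the conjugate of
  \<open>u\<close>, so multiplication by \<open>u\<close> does the work of a rotation of the
  motion.\<close>

definition dir_sup :: "complex \<Rightarrow> real \<Rightarrow> 'a \<Rightarrow> real" where
  "dir_sup u t \<omega> = Sup ((\<lambda>s. Re (u * Z s \<omega>)) ` {0..t})"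

lemma continuous_on_dir: "\<omega> \<in> space M \<Longrightarrow> continuous_on {0..t} (\<lambda>s. Re (u * Z s \<omega>))"
  by (intro continuous_intros continuous_on_subset[OF continuous_on_Z]) auto

lemma dir_sup_attained:
  assumes "\<omega> \<in> space M" "0 \<le> t"
  shows "\<exists>s\<in>{0..t}. dir_sup u t \<omega> = Re (u * Z s \<omega>)"
    and "\<And>s. s \<in> {0..t} \<Longrightarrow> Re (u * Z s \<omega>) \<le> dir_sup u t \<omega>"
proof -
  let ?A = "(\<lambda>s. Re (u * Z s \<omega>)) ` {0..t}"
  have c: "compact ?A" using continuous_on_dir[OF assms(1)] by (intro compact_continuous_image) auto
  have "?A \<noteq> {}" using assms by auto
  then show "\<exists>s\<in>{0..t}. dir_sup u t \<omega> = Re (u * Z s \<omega>)"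
    using closed_contains_Sup[of ?A] c by (auto simp: dir_sup_def compact_imp_closed compact_imp_bounded bounded_imp_bdd_above)
  show "Re (u * Z s \<omega>) \<le> dir_sup u t \<omega>" if "s \<in> {0..t}" for s
    unfolding dir_sup_def using that c by (intro cSup_upper) (auto simp: compact_imp_bounded bounded_imp_bdd_above)
qed

text \<open>Rescaling \<open>{0..\<tau> \<omega>}\<close> to the unit interval makes the rationals
  there an index set that is countable and the same for all \<open>\<omega>\<close>.\<close>

lemma dir_sup_random_time_measurable:
  assumes [measurable]: "\<tau> \<in> borel_measurable M" and pos: "\<And>\<omega>. \<omega> \<in> space M \<Longrightarrow> 0 \<le> \<tau> \<omega>"
  shows "(\<lambda>\<omega>. dir_sup u (\<tau> \<omega>) \<omega>) \<in> borel_measurable M"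
proof -
  define I where "I = {(i, n). i \<le> Suc n}"
  define r where "r = (\<lambda>(i, n). real i / real (Suc n))"
  have r: "r p \<in> {0..1}" if "p \<in> I" for p using that by (auto simp: I_def r_def field_simps)
  have le: "Re (u * Z (r p * \<tau> \<omega>) \<omega>) \<le> dir_sup u (\<tau> \<omega>) \<omega>" if "\<omega> \<in> space M" "p \<in> I" for \<omega> p
    using r[OF that(2)] pos[OF that(1)] mult_left_le_one_le[of "\<tau> \<omega>" "r p"]
    by (intro dir_sup_attained(2)[OF that(1) pos[OF that(1)]]) auto
  have bdd: "bdd_above ((\<lambda>p. Re (u * Z (r p * \<tau> \<omega>) \<omega>)) ` I)" if \<omega>: "\<omega> \<in> space M" for \<omega>
    using le[OF \<omega>] by (intro bdd_aboveI2[where M="dir_sup u (\<tau> \<omega>) \<omega>"])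
  have eq: "dir_sup u (\<tau> \<omega>) \<omega> = (SUP p\<in>I. Re (u * Z (r p * \<tau> \<omega>) \<omega>))" if \<omega>: "\<omega> \<in> space M" for \<omega>
  proof (rule antisym)
    show "dir_sup u (\<tau> \<omega>) \<omega> \<le> (SUP p\<in>I. Re (u * Z (r p * \<tau> \<omega>) \<omega>))"
    proof -
      obtain s where s: "s \<in> {0..\<tau> \<omega>}" "dir_sup u (\<tau> \<omega>) \<omega> = Re (u * Z s \<omega>)"
        using dir_sup_attained(1)[OF \<omega> pos[OF \<omega>]] by blast
      define x where "x = (if \<tau> \<omega> = 0 then 0 else s / \<tau> \<omega>)"
      have x: "0 \<le> x" "x \<le> 1" "s = x * \<tau> \<omega>" using s pos[OF \<omega>] by (auto simp: x_def divide_le_eq)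
      define k where "k n = nat \<lfloor>real (Suc n) * x\<rfloor>" for n
      have kI: "(k n, n) \<in> I" for n
        using order_trans[OF floor_grid(1)[OF x(1), of n] x(2)] by (simp add: I_def k_def divide_le_eq)
      have "(\<lambda>n. r (k n, n)) \<longlonglongrightarrow> x"
        unfolding r_def k_def case_prod_conv by (rule floor_grid(2)[OF x(1)])
      then have "(\<lambda>n. r (k n, n) * \<tau> \<omega>) \<longlonglongrightarrow> s" unfolding x(3) by (intro tendsto_intros)
      then have "(\<lambda>n. Z (r (k n, n) * \<tau> \<omega>) \<omega>) \<longlonglongrightarrow> Z s \<omega>"
        using s pos[OF \<omega>] by (intro continuous_on_tendsto_compose[OF continuous_on_Z[OF \<omega>]]) (auto simp: r_def)
      then have "(\<lambda>n. Re (u * Z (r (k n, n) * \<tau> \<omega>) \<omega>)) \<longlonglongrightarrow> Re (u * Z s \<omega>)"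
        by (intro tendsto_intros)
      then show ?thesis unfolding s(2)
        using cSUP_upper[OF kI bdd[OF \<omega>]] by (intro LIMSEQ_le_const2) auto
    qed
    have "I \<noteq> {}" by (auto simp: I_def)
    then show "(SUP p\<in>I. Re (u * Z (r p * \<tau> \<omega>) \<omega>)) \<le> dir_sup u (\<tau> \<omega>) \<omega>"
      using le[OF \<omega>] by (intro cSUP_least)
  qed
  have "(\<lambda>\<omega>. SUP p\<in>I. Re (u * Z (r p * \<tau> \<omega>) \<omega>)) \<in> borel_measurable M"
  proof (rule borel_measurable_cSUP)
    fix p assume "p \<in> I"
    then have [measurable]: "(\<lambda>\<omega>. Z (r p * \<tau> \<omega>) \<omega>) \<in> borel_measurable M"
      using r pos by (intro Z_random_time_measurable) auto
    show "(\<lambda>\<omega>. Re (u * Z (r p * \<tau> \<omega>) \<omega>)) \<in> borel_measurable M" by measurable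
  qed (use bdd in auto)
  then show ?thesis by (subst measurable_cong[OF eq]) auto
qed

section \<open>Measurability of exit times and the law of directional maxima\<close>

lemma leaves_measurable:
  assumes "open S" "S \<noteq> UNIV" "0 \<in> S"
  shows "{\<omega> \<in> space M. leaves S \<omega>} \<in> sets M"
proof -
  have "{\<omega> \<in> space M. leaves S \<omega>} = space M - (\<Inter>n. stays S (real n))"
  proof (intro equalityI subsetI)
    fix \<omega> assume "\<omega> \<in> {\<omega> \<in> space M. leaves S \<omega>}"
    then obtain t where "\<omega> \<in> space M" "0 \<le> t" "Z t \<omega> \<notin> S" by (auto simp: leaves_def)
    moreover obtain n where "t \<le> real n" using real_arch_simple by blast
    ultimately show "\<omega> \<in> space M - (\<Inter>n. stays S (real n))" by (auto simp: stays_def intro!: exI[of _ n])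
  qed (auto simp: stays_def leaves_def)
  then show ?thesis using stays_sets[OF assms] by auto
qed

lemma exit_from_measurable:
  assumes S: "open S" "S \<noteq> UNIV" "0 \<in> S"
  shows "exit_from S \<in> borel_measurable M"
  unfolding borel_measurable_iff_le
proof
  fix t
  have L: "{\<omega> \<in> space M. leaves S \<omega>} \<in> sets M" by (rule leaves_measurable[OF S])
  have "{\<omega> \<in> space M. \<not> leaves S \<omega>} = space M - {\<omega> \<in> space M. leaves S \<omega>}" by auto
  then have nL: "{\<omega> \<in> space M. \<not> leaves S \<omega>} \<in> sets M" using L by auto
  have st: "stays S t \<in> sets M"
  proof (cases "t \<ge> 0")
    case False
    then have "stays S t = space M" by (auto simp: stays_def)
    then show ?thesis by simp
  qed (use stays_sets[OF S] in simp)
  \<comment> \<open>Whatever the number \<open>Inf {}\<close> is, the paths that never leave fall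
    wholly on one side of \<open>t\<close>.\<close>
  have "exit_from S \<omega> = Inf {}" if "\<not> leaves S \<omega>" for \<omega>
    using that by (auto simp: exit_from_def leaves_def intro!: arg_cong[of _ _ Inf])
  then have "\<omega> \<in> {\<omega> \<in> space M. exit_from S \<omega> \<le> t} \<longleftrightarrow> \<omega> \<in> ({\<omega> \<in> space M. leaves S \<omega>} - stays S t) \<union>
      (if Inf {} \<le> t then {\<omega> \<in> space M. \<not> leaves S \<omega>} else {})" for \<omega>
    using exit_from_props(4)[OF S(1), of \<omega> t] by (cases "leaves S \<omega>") (auto simp: not_less)
  then have "{\<omega> \<in> space M. exit_from S \<omega> \<le> t} = ({\<omega> \<in> space M. leaves S \<omega>} - stays S t) \<union>
      (if Inf {} \<le> t then {\<omega> \<in> space M. \<not> leaves S \<omega>} else {})"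
    by blast
  then show "{\<omega> \<in> space M. exit_from S \<omega> \<le> t} \<in> sets M" using L nL st by auto
qed

lemma exit_time_eq: "exit_time X Y = exit_from (ball 0 1)"
proof
  fix \<omega>
  have "norm (X t \<omega>, Y t \<omega>) = norm (Z t \<omega>)" for t
    unfolding Z_def complex_norm norm_Pair by simp
  then have "(X t \<omega>, Y t \<omega>) \<notin> unit_disc \<longleftrightarrow> Z t \<omega> \<notin> ball 0 1" for t
    unfolding unit_disc_def by simp
  then show "exit_time X Y \<omega> = exit_from (ball 0 1) \<omega>" by (simp add: exit_time_def exit_from_def)
qed

lemma exit_disc_measurable[measurable]: "exit_from (ball 0 1) \<in> borel_measurable M"
proof (rule exit_from_measurable)
  show "ball 0 1 \<noteq> (UNIV :: complex set)" using bounded_ball not_bounded_UNIV by metis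
qed auto

text \<open>On the null event that the path never leaves the disc, \<open>exit_from\<close> is \<open>Inf {}\<close>, a real number about
  which nothing is known; it may be negative.\<close>

lemma dir_sup_exit_measurable: "(\<lambda>\<omega>. dir_sup u (exit_from (ball 0 1) \<omega>) \<omega>) \<in> borel_measurable M"
proof -
  have [measurable]: "(\<lambda>\<omega>. dir_sup u (max 0 (exit_from (ball 0 1) \<omega>)) \<omega>) \<in> borel_measurable M"
    by (rule dir_sup_random_time_measurable) auto
  have eq: "(\<lambda>\<omega>. dir_sup u (exit_from (ball 0 1) \<omega>) \<omega>) = (\<lambda>\<omega>. if exit_from (ball 0 1) \<omega> < 0 then Sup {}
      else dir_sup u (max 0 (exit_from (ball 0 1) \<omega>)) \<omega>)"
    by (auto simp: dir_sup_def max_def fun_eq_iff)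
  show ?thesis unfolding eq by measurable
qed

text \<open>\<open>S\<close> is the part of the disc below level \<open>a\<close> in the direction
  considered. The level is not reached up to the exit from the disc exactly when \<open>S\<close> is
  left at a point of the arc off the chord; in that case both exit times coincide.\<close>

lemma prob_dir_sup:
  assumes u: "norm u = 1" and a: "0 < a" "a < 1"
  shows "prob {\<omega> \<in> space M. dir_sup u (exit_from (ball 0 1) \<omega>) \<omega> < a} = 2 * arcsin a / (pi - arccos a)"
    (is "prob ?A = _")
proof -
  define S where "S = ball 0 1 \<inter> {z. Re (u * z) < a}"
  have S: "open S" "0 \<in> S" "bounded S"
    using a by (auto simp: S_def intro!: open_Int open_Collect_less continuous_intros bounded_Int)
  have U: "S \<noteq> UNIV" using S(3) not_bounded_UNIV by metis
  \<comment> \<open>The value 0 on the null set of paths that never leave keeps the time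
    nonnegative, as the measurability of \<open>P\<close> requires.\<close>
  define \<tau> where "\<tau> \<omega> = (if leaves S \<omega> then exit_from S \<omega> else 0)" for \<omega>
  have \<tau>0: "0 \<le> \<tau> \<omega>" if "\<omega> \<in> space M" for \<omega> using exit_from_props(1)[OF S(1) that] by (simp add: \<tau>_def)
  have \<tau>m: "\<tau> \<in> borel_measurable M" unfolding \<tau>_def
    using exit_from_measurable[OF S(1) U S(2)] leaves_measurable[OF S(1) U S(2)] by (intro measurable_If) auto
  define P where "P \<omega> = Z (\<tau> \<omega>) \<omega>" for \<omega>
  have [measurable]: "P \<in> borel_measurable M"
    unfolding P_def by (rule Z_random_time_measurable[OF \<tau>m \<tau>0])
  have cl: "closure S \<subseteq> cball 0 1 \<inter> {z. Re (u * z) \<le> a}"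
    by (rule closure_minimal) (auto simp: S_def intro!: closed_Int closed_Collect_le continuous_intros)
  have AE_L: "AE \<omega> in M. \<omega> \<in> space M \<and> leaves S \<omega> \<and> leaves (ball 0 1) \<omega>"
    using AE_leaves[OF S] AE_leaves[of "ball 0 1"] by auto
  have PL: "P \<omega> \<in> closure S" "P \<omega> \<notin> S" if "\<omega> \<in> space M" "leaves S \<omega>" for \<omega>
    using before_exit_in_closure[OF S(1,2) that, of "exit_from S \<omega>"] exit_from_props[OF S(1) that] that
    by (auto simp: P_def \<tau>_def)
  have law: "prob {\<omega> \<in> space M. Re (u * P \<omega>) < a} = 2 * arcsin a / (pi - arccos a)"
  proof (rule exit_point_law[OF a])
    show "AE \<omega> in M. Re (u * P \<omega>) \<le> a \<and> norm (u * P \<omega>) \<le> 1 \<and> (Re (u * P \<omega>) = a \<or> norm (u * P \<omega>) = 1)"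
      using AE_L
    proof eventually_elim
      case (elim \<omega>)
      then show ?case using PL[of \<omega>] cl u by (force simp: S_def norm_mult)
    qed
    show "expectation (\<lambda>\<omega>. exp (of_real x * (u * P \<omega>))) = 1" for x
      using expectation_exp_exit[OF S, of P "of_real x * u"] by (simp add: P_def \<tau>_def mult.assoc)
  qed measurable
  have A: "?A \<in> sets M" using dir_sup_exit_measurable[of u] by measurable
  have "prob ?A = prob {\<omega> \<in> space M. Re (u * P \<omega>) < a}"
  proof (rule measure_eq_AE)
    show "AE \<omega> in M. \<omega> \<in> ?A \<longleftrightarrow> \<omega> \<in> {\<omega> \<in> space M. Re (u * P \<omega>) < a}"
      using AE_L
    proof eventually_elim
      case (elim \<omega>)
      then have \<omega>: "\<omega> \<in> space M" "leaves S \<omega>" "leaves (ball 0 1) \<omega>" by auto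
      note exS = exit_from_props[OF S(1) \<omega>(1,2)] and exB = exit_from_props[OF open_ball \<omega>(1,3)]
      have le: "exit_from S \<omega> \<le> exit_from (ball 0 1) \<omega>"
      proof (rule ccontr)
        assume "\<not> ?thesis"
        then have "Z (exit_from (ball 0 1) \<omega>) \<omega> \<in> S" using exB(1) exS(3) by auto
        then show False using exB(2) by (auto simp: S_def)
      qed
      have "dir_sup u (exit_from (ball 0 1) \<omega>) \<omega> < a \<longleftrightarrow> Re (u * P \<omega>) < a"
      proof
        assume "dir_sup u (exit_from (ball 0 1) \<omega>) \<omega> < a"
        moreover have "Re (u * P \<omega>) \<le> dir_sup u (exit_from (ball 0 1) \<omega>) \<omega>"
          unfolding P_def using \<omega> le exS(1) exB(1) by (intro dir_sup_attained) (auto simp: \<tau>_def)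
        ultimately show "Re (u * P \<omega>) < a" by simp
      next
        assume lt: "Re (u * P \<omega>) < a"
        then have "norm (Z (exit_from S \<omega>) \<omega>) \<ge> 1" using PL(2)[OF \<omega>(1,2)] \<omega> by (auto simp: S_def P_def \<tau>_def)
        then have "\<not> exit_from S \<omega> < exit_from (ball 0 1) \<omega>" using exB(3)[OF exS(1)] by auto
        then have eq: "exit_from (ball 0 1) \<omega> = exit_from S \<omega>" using le by simp
        obtain s where s: "s \<in> {0..exit_from S \<omega>}" "dir_sup u (exit_from S \<omega>) \<omega> = Re (u * Z s \<omega>)"
          using dir_sup_attained(1)[OF \<omega>(1) exS(1)] by blast
        show "dir_sup u (exit_from (ball 0 1) \<omega>) \<omega> < a"
        proof (cases "s = exit_from S \<omega>")
          case True then show ?thesis using s lt \<omega> by (simp add: eq P_def \<tau>_def)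
        next
          case False
          then have "Z s \<omega> \<in> S" using s exS(3) by auto
          then show ?thesis using s by (simp add: eq S_def)
        qed
      qed
      then show ?case using \<omega> by auto
    qed
    show "{\<omega> \<in> space M. Re (u * P \<omega>) < a} \<in> sets M" by measurable
  qed (rule A)
  then show ?thesis using law by simp
qed

end

section \<open>The mean displacement\<close>

text \<open>The mean is the integral over \<open>a\<close> of the probability of
  \<open>H \<omega> \<ge> a\<close>, taken on the open unit interval because the distribution is
  given only there. The stated integrand arises from \<open>a = sin t\<close>, where
  \<open>arcsin a = t\<close> and \<open>pi - arccos a = pi / 2 + t\<close>.\<close>

lemma (in prob_space) expectation_of_exit_cdf:
  fixes H :: "'a \<Rightarrow> real"
  assumes H[measurable]: "H \<in> borel_measurable M" and H01: "AE \<omega> in M. 0 \<le> H \<omega> \<and> H \<omega> \<le> 1"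
    and cdf: "\<And>a. 0 < a \<Longrightarrow> a < 1 \<Longrightarrow> prob {\<omega> \<in> space M. H \<omega> < a} = 2 * arcsin a / (pi - arccos a)"
  shows "expectation H = integral {0..pi/2} (\<lambda>t. (1 - 2 * t / (pi/2 + t)) * cos t)"
proof -
  interpret pair_sigma_finite M lborel ..
  define \<phi> where "\<phi> a = 1 - 2 * arcsin a / (pi - arccos a)" for a :: real
  have "arccos x < pi" if "0 \<le> x" "x \<le> 1" for x
    using arccos_le_pi2[of x] that pi_gt_zero by linarith
  then have cont: "continuous_on {0..1} \<phi>"
    unfolding \<phi>_def by (intro continuous_intros) force+
  define f where "f \<omega> a = (indicator {a. 0 < a \<and> a < 1 \<and> a \<le> H \<omega>} a :: real)" for \<omega> a
  have "{p \<in> space (M \<Otimes>\<^sub>M lborel). 0 < snd p \<and> snd p < 1 \<and> snd p \<le> H (fst p)} \<in> sets (M \<Otimes>\<^sub>M lborel)"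
    by measurable
  then have "(\<lambda>p. indicator {p \<in> space (M \<Otimes>\<^sub>M lborel). 0 < snd p \<and> snd p < 1 \<and> snd p \<le> H (fst p)} p :: real) \<in> borel_measurable (M \<Otimes>\<^sub>M lborel)"
    by (rule borel_measurable_indicator)
  then have f_meas: "(\<lambda>(\<omega>, a). f \<omega> a) \<in> borel_measurable (M \<Otimes>\<^sub>M lborel)"
    by (rule measurable_cong[THEN iffD1, rotated]) (auto simp: f_def indicator_def space_pair_measure)
  have fH: "has_bochner_integral lborel (f \<omega>) (H \<omega>)" if "0 \<le> H \<omega>" "H \<omega> \<le> 1" for \<omega>
  proof -
    \<comment> \<open>The endpoint 1 is cut off, so \<open>H \<omega> = 1\<close> is a separate
      case.\<close>
    have "{a. 0 < a \<and> a < 1 \<and> a \<le> H \<omega>} = (if H \<omega> = 1 then {0<..<1} else {0<..H \<omega>})"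
      using that by auto
    then have "emeasure lborel {a. 0 < a \<and> a < 1 \<and> a \<le> H \<omega>} = ennreal (H \<omega>)"
      "{a. 0 < a \<and> a < 1 \<and> a \<le> H \<omega>} \<in> sets lborel" using that by auto
    then show ?thesis unfolding f_def
      using has_bochner_integral_real_indicator[of "{a. 0 < a \<and> a < 1 \<and> a \<le> H \<omega>}" lborel] that
      by (simp add: measure_def)
  qed
  have int: "integrable (M \<Otimes>\<^sub>M lborel) (\<lambda>(\<omega>, a). f \<omega> a)"
  proof (rule Fubini_integrable[OF f_meas])
    show "AE \<omega> in M. integrable lborel (\<lambda>x. case (\<omega>, x) of (\<omega>, x) \<Rightarrow> f \<omega> x)"
      using H01 by eventually_elim (use fH in \<open>auto simp: has_bochner_integral_iff\<close>)
    have nn: "norm (f \<omega> x) = f \<omega> x" for \<omega> x by (simp add: f_def)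
    show "integrable M (\<lambda>\<omega>. \<integral>x. norm (case (\<omega>, x) of (\<omega>, x) \<Rightarrow> f \<omega> x) \<partial>lborel)"
    proof (rule integrable_const_bound[where B=1])
      show "AE \<omega> in M. norm (\<integral>x. norm (case (\<omega>, x) of (\<omega>, x) \<Rightarrow> f \<omega> x) \<partial>lborel) \<le> 1"
        using H01 by eventually_elim (use fH nn in \<open>auto simp: has_bochner_integral_iff\<close>)
      show "(\<lambda>\<omega>. \<integral>x. norm (case (\<omega>, x) of (\<omega>, x) \<Rightarrow> f \<omega> x) \<partial>lborel) \<in> borel_measurable M"
        using f_meas by measurable
    qed
  qed
  have "expectation H = expectation (\<lambda>\<omega>. \<integral>x. f \<omega> x \<partial>lborel)"
  proof (rule integral_cong_AE)
    show "AE \<omega> in M. H \<omega> = (\<integral>x. f \<omega> x \<partial>lborel)"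
      using H01 by eventually_elim (use fH in \<open>auto simp: has_bochner_integral_iff\<close>)
    show "(\<lambda>\<omega>. \<integral>x. f \<omega> x \<partial>lborel) \<in> borel_measurable M" using f_meas by measurable
  qed measurable
  also have "\<dots> = (\<integral>x. expectation (\<lambda>\<omega>. f \<omega> x) \<partial>lborel)"
    by (rule Fubini_integral[OF int, symmetric])
  also have "\<dots> = (\<integral>x. indicator {0<..<1} x *\<^sub>R \<phi> x \<partial>lborel)"
  proof (intro Bochner_Integration.integral_cong refl)
    fix x :: real
    show "expectation (\<lambda>\<omega>. f \<omega> x) = indicator {0<..<1} x *\<^sub>R \<phi> x"
    proof (cases "0 < x \<and> x < 1")
      case True
      have "expectation (\<lambda>\<omega>. f \<omega> x) = expectation (indicator {\<omega> \<in> space M. \<not> H \<omega> < x})"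
        using True by (intro Bochner_Integration.integral_cong) (auto simp: f_def indicator_def)
      also have "\<dots> = prob {\<omega> \<in> space M. \<not> H \<omega> < x}" by simp
      also have "\<dots> = 1 - prob {\<omega> \<in> space M. H \<omega> < x}" by (rule prob_neg) measurable
      finally show ?thesis using True cdf[of x] by (simp add: \<phi>_def)
    qed (auto simp: f_def)
  qed
  also have "\<dots> = integral {0..1} \<phi>"
  proof -
    have "set_integrable lborel {0..1} \<phi>" by (rule borel_integrable_atLeastAtMost'[OF cont])
    then have "set_integrable lborel {0<..<1} \<phi>" by (rule set_integrable_subset) auto
    then show ?thesis
      using set_borel_integral_eq_integral(2)[of "{0<..<1}" \<phi>] by (simp add: set_lebesgue_integral_def integral_open_interval_real)
  qed
  also have "\<dots> = integral {0..pi/2} (\<lambda>t. (1 - 2 * t / (pi/2 + t)) * cos t)"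
  proof -
    have "((\<lambda>t. cos t *\<^sub>R \<phi> (sin t)) has_integral (integral {sin 0..sin (pi/2)} \<phi>)) {0..pi/2}"
    proof (rule has_integral_substitution[OF _ _ _ cont])
      show "(sin has_real_derivative cos x) (at x within {0..pi/2})" for x by (rule DERIV_subset[OF DERIV_sin]) auto
      show "sin ` {0..pi/2} \<subseteq> {0..1}" using sin_ge_zero by force
    qed auto
    then have "integral {0..1} \<phi> = integral {0..pi/2} (\<lambda>t. cos t *\<^sub>R \<phi> (sin t))"
      by (simp add: integral_unique)
    also have "\<dots> = integral {0..pi/2} (\<lambda>t. (1 - 2 * t / (pi/2 + t)) * cos t)"
    proof (rule integral_cong)
      fix t assume t: "t \<in> {0..pi/2}"
      then have "arcsin (sin t) = t" by (intro arcsin_sin) auto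
      moreover have "arccos (sin t) = pi/2 - t"
        using t arccos_cos[of "pi/2 - t"] by (simp add: cos_diff)
      ultimately show "cos t *\<^sub>R \<phi> (sin t) = (1 - 2 * t / (pi/2 + t)) * cos t"
        by (simp add: \<phi>_def)
    qed
    finally show ?thesis .
  qed
  finally show ?thesis .
qed

section \<open>Numerical value of the mean displacement\<close>

definition sinc_poly :: "real \<Rightarrow> real" where
  "sinc_poly x = (\<Sum>k<12. (-1) ^ k * x ^ (2 * k) / fact (2 * k + 1))"

text \<open>Truncated sine integral, the antiderivative of \<open>sinc_poly\<close>. Twelve terms
  put the Taylor remainder at order 24, which on the range up to 4 keeps the error of the mean below
  \<open>1 / 100000000\<close>.\<close>

definition Si_poly :: "real \<Rightarrow> real" where
  "Si_poly x = (\<Sum>k<12. (-1) ^ k * x ^ (2 * k + 1) / (real (2 * k + 1) * fact (2 * k + 1)))"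

lemma sin_coeff_sum_even:
  fixes x :: real
  shows "(\<Sum>m<2 * n. sin_coeff m * x ^ m) = x * (\<Sum>k<n. (-1) ^ k * x ^ (2 * k) / fact (2 * k + 1))"
proof (induction n)
  case (Suc n)
  have "(\<Sum>m<2 * Suc n. sin_coeff m * x ^ m) = (\<Sum>m<2 * n. sin_coeff m * x ^ m) + sin_coeff (2 * n) * x ^ (2 * n)
      + sin_coeff (Suc (2 * n)) * x ^ Suc (2 * n)" by simp
  also have "sin_coeff (2 * n) = 0" by (simp add: sin_coeff_def)
  also have "sin_coeff (Suc (2 * n)) = (-1) ^ n / fact (2 * n + 1)" by (simp add: sin_coeff_def)
  finally show ?case unfolding Suc by (simp add: distrib_left del: fact_Suc)
qed simp

lemma sin_taylor24: "\<bar>sin x - x * sinc_poly x\<bar> \<le> \<bar>x\<bar> ^ 24 / fact 24"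
proof -
  have "(\<Sum>m<24. sin_coeff m * x ^ m) = x * sinc_poly x"
    using sin_coeff_sum_even[of x 12] by (simp add: sinc_poly_def)
  then show ?thesis
    using Maclaurin_sin_bound[of x 24] by (simp only: divide_inverse mult.commute)
qed

lemma DERIV_Si_poly: "(Si_poly has_real_derivative sinc_poly x) (at x)"
  unfolding Si_poly_def sinc_poly_def
proof (rule DERIV_sum)
  fix k :: nat
  have "((\<lambda>x. (-1) ^ k * x ^ (2 * k + 1) / (real (2 * k + 1) * fact (2 * k + 1))) has_real_derivative
      (-1) ^ k * (real (2 * k + 1) * x ^ (2 * k)) / (real (2 * k + 1) * fact (2 * k + 1))) (at x)"
    by (intro DERIV_cdivide DERIV_cmult DERIV_cong[OF DERIV_pow]) simp
  moreover have "(-1) ^ k * (real (2 * k + 1) * x ^ (2 * k)) / (real (2 * k + 1) * fact (2 * k + 1)) = (-1) ^ k * x ^ (2 * k) / fact (2 * k + 1)"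
    by (simp del: of_nat_add of_nat_mult fact_Suc add: mult.left_commute[of _ "real (2 * k + 1)"])
  ultimately show "((\<lambda>x. (-1) ^ k * x ^ (2 * k + 1) / (real (2 * k + 1) * fact (2 * k + 1))) has_real_derivative
      (-1) ^ k * x ^ (2 * k) / fact (2 * k + 1)) (at x)" by simp
qed

lemma arctan_partial_sums:
  fixes x :: real
  assumes "0 \<le> x" "x \<le> 1"
  shows "(\<Sum>k<2 * n. (-1) ^ k * (1 / real (k * 2 + 1) * x ^ (k * 2 + 1))) \<le> arctan x"
    and "arctan x \<le> (\<Sum>k<2 * n + 1. (-1) ^ k * (1 / real (k * 2 + 1) * x ^ (k * 2 + 1)))"
proof -
  have lim: "(\<lambda>k. 1 / real (k * 2 + 1) * x ^ (k * 2 + 1)) \<longlonglongrightarrow> 0"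
    using zeroseq_arctan_series[of x] assms by simp
  have mono: "1 / real (Suc k * 2 + 1) * x ^ (Suc k * 2 + 1) \<le> 1 / real (k * 2 + 1) * x ^ (k * 2 + 1)" for k
    using assms by (intro mult_mono power_decreasing divide_left_mono) auto
  show "(\<Sum>k<2 * n. (-1) ^ k * (1 / real (k * 2 + 1) * x ^ (k * 2 + 1))) \<le> arctan x"
    "arctan x \<le> (\<Sum>k<2 * n + 1. (-1) ^ k * (1 / real (k * 2 + 1) * x ^ (k * 2 + 1)))"
    using summable_Leibniz'(2,4)[OF lim _ mono, of n] assms arctan_series[of x] by simp_all
qed

text \<open>Machin's formula, with \<open>arctan (1 / 5)\<close> and \<open>arctan (1 / 239)\<close>
  enclosed to within 10^-13 by partial sums of the alternating series.\<close>

lemma pi_bounds: "3.1415926535 < pi" "pi < 3.1415926536"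
proof -
  have a5: "0.1973955598498 < arctan (1 / 5)" "arctan (1 / 5) < 0.1973955598499"
    using arctan_partial_sums[of "1 / 5" 4] arctan_partial_sums[of "1 / 5" 5]
    by (simp_all add: lessThan_nat_numeral power_divide)
  have a239: "0.004184076002 < arctan (1 / 239)" "arctan (1 / 239) < 0.0041840760021"
    using arctan_partial_sums[of "1 / 239" 1] arctan_partial_sums[of "1 / 239" 2]
    by (simp_all add: lessThan_nat_numeral power_divide)
  show "3.1415926535 < pi" "pi < 3.1415926536"
    using a5 a239 machin by simp_all
qed

lemma interval_mult:
  fixes a b :: real
  assumes "l \<le> a" "a \<le> u" "m \<le> b" "b \<le> v"
  shows "0 \<le> l \<Longrightarrow> 0 \<le> m \<Longrightarrow> l * m \<le> a * b"
    and "0 \<le> l \<Longrightarrow> 0 \<le> m \<Longrightarrow> a * b \<le> u * v"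
  using assms mult_mono[of l a m b] mult_mono[of a u b v] by simp_all

text \<open>The extra factor \<open>pi\<close> leaves only even powers, each obtained from the one
  before through a multiplication by \<open>pi ^ 2\<close>.\<close>

lemma pi_Si_poly_eq:
  "pi * (Si_poly pi - Si_poly (pi / 2)) =
    (\<Sum>k<12. (-1) ^ k * (1 - 1 / 2 ^ (2 * k + 1)) / (real (2 * k + 1) * fact (2 * k + 1)) * pi ^ (2 * k + 2))"
  unfolding Si_poly_def sum_subtractf[symmetric] sum_distrib_left
  by (intro sum.cong refl) (simp add: power_divide divide_simps del: fact_Suc; simp add: algebra_simps)

lemma pi_Si_poly_bounds: "\<bar>pi * (Si_poly pi - Si_poly (pi / 2)) - 151165548 / 100000000\<bar> \<le> 1 / 100000000"
proof -
  have eq: "pi * (Si_poly pi - Si_poly (pi / 2)) = 1 / 2 * pi ^ 2 - 7 / 144 * pi ^ 4 + 31 / 19200 * pi ^ 6 - 127 / 4515840 * pi ^ 8 + 73 / 238878720 * pi ^ 10 - 2047 / 899245670400 * pi ^ 12 + 8191 / 663152807116800 * pi ^ 14 - 4681 / 91821157908480000 * pi ^ 16 + 131071 / 792551263781781504000 * pi ^ 18 - 524287 / 1211764261659768520704000 * pi ^ 20 + 42799 / 45919487810264912363520000 * pi ^ 22 - 8388607 / 4987835991934721800808693760000 * pi ^ 24"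
    unfolding pi_Si_poly_eq by (simp add: lessThan_nat_numeral fact_numeral del: add_2_eq_Suc')
  \<comment> \<open>The powers are enclosed with fifteen significant digits, rounded outwards at
    each multiplication so that the numerals stay short.\<close>
  have p2: "986960440052517 / 100000000000000 \<le> pi ^ 2" "pi ^ 2 \<le> 986960440115349 / 100000000000000"
    using mult_mono[of "3.1415926535" pi "3.1415926535" pi] mult_mono[of pi "3.1415926536" pi "3.1415926536"] pi_bounds
    by (simp_all add: power2_eq_square)
  have p4: "974090910228658 / 10000000000000 \<le> pi ^ 4" "pi ^ 4 \<le> 974090910352684 / 10000000000000"
    using interval_mult[OF p2 p2] by (simp_all flip: power_add)
  have p6: "961389193410433 / 1000000000000 \<le> pi ^ 6" "pi ^ 6 \<le> 961389193594046 / 1000000000000"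
    using interval_mult[OF p4 p2] by (simp_all flip: power_add)
  have p8: "948853101390095 / 100000000000 \<le> pi ^ 8" "pi ^ 8 \<le> 948853101631721 / 100000000000"
    using interval_mult[OF p6 p2] by (simp_all flip: power_add)
  have p10: "936480474493163 / 10000000000 \<le> pi ^ 10" "pi ^ 10 \<le> 936480474791258 / 10000000000"
    using interval_mult[OF p8 p2] by (simp_all flip: power_add)
  have p12: "924269181206362 / 1000000000 \<le> pi ^ 12" "pi ^ 12 \<le> 924269181559411 / 1000000000"
    using interval_mult[OF p10 p2] by (simp_all flip: power_add)
  have p14: "912217117810410 / 100000000 \<le> pi ^ 14" "pi ^ 14 \<le> 912217118216930 / 100000000"
    using interval_mult[OF p12 p2] by (simp_all flip: power_add)
  have p16: "900322208017600 / 10000000 \<le> pi ^ 16" "pi ^ 16 \<le> 900322208476137 / 10000000"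
    using interval_mult[OF p14 p2] by (simp_all flip: power_add)
  have p18: "888582402614104 / 1000000 \<le> pi ^ 18" "pi ^ 18 \<le> 888582403123232 / 1000000"
    using interval_mult[OF p16 p2] by (simp_all flip: power_add)
  have p20: "876995679106938 / 100000 \<le> pi ^ 20" "pi ^ 20 \<le> 876995679665260 / 100000"
    using interval_mult[OF p18 p2] by (simp_all flip: power_add)
  have p22: "865560041375539 / 10000 \<le> pi ^ 22" "pi ^ 22 \<le> 865560041981685 / 10000"
    using interval_mult[OF p20 p2] by (simp_all flip: power_add)
  have p24: "854273519327876 / 1000 \<le> pi ^ 24" "pi ^ 24 \<le> 854273519980504 / 1000"
    using interval_mult[OF p22 p2] by (simp_all flip: power_add)

  \<comment> \<open>Each term is enclosed on the scale 10^-11 and given a name, so that the last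
    step is linear in twelve unknowns.\<close>
  define q2 where "q2 = 1 / 2 * pi ^ 2"
  have q2: "493480220026 / 100000000000 \<le> q2" "q2 \<le> 493480220058 / 100000000000"
    using p2 unfolding q2_def by simp_all
  define q4 where "q4 = 7 / 144 * pi ^ 4"
  have q4: "473516414694 / 100000000000 \<le> q4" "q4 \<le> 473516414755 / 100000000000"
    using p4 unfolding q4_def by simp_all
  define q6 where "q6 = 31 / 19200 * pi ^ 6"
  have q6: "155224296852 / 100000000000 \<le> q6" "q6 \<le> 155224296883 / 100000000000"
    using p6 unfolding q6_def by simp_all
  define q8 where "q8 = 127 / 4515840 * pi ^ 8"
  have q8: "26684812543 / 100000000000 \<le> q8" "q8 \<le> 26684812551 / 100000000000"
    using p8 unfolding q8_def by simp_all
  define q10 where "q10 = 73 / 238878720 * pi ^ 10"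
  have q10: "2861831921 / 100000000000 \<le> q10" "q10 \<le> 2861831923 / 100000000000"
    using p10 unfolding q10_def by simp_all
  define q12 where "q12 = 2047 / 899245670400 * pi ^ 12"
  have q12: "210396232 / 100000000000 \<le> q12" "q12 \<le> 210396233 / 100000000000"
    using p12 unfolding q12_def by simp_all
  define q14 where "q14 = 8191 / 663152807116800 * pi ^ 14"
  have q14: "11267343 / 100000000000 \<le> q14" "q14 \<le> 11267344 / 100000000000"
    using p14 unfolding q14_def by simp_all
  define q16 where "q16 = 4681 / 91821157908480000 * pi ^ 16"
  have q16: "458980 / 100000000000 \<le> q16" "q16 \<le> 458981 / 100000000000"
    using p16 unfolding q16_def by simp_all
  define q18 where "q18 = 131071 / 792551263781781504000 * pi ^ 18"
  have q18: "14695 / 100000000000 \<le> q18" "q18 \<le> 14696 / 100000000000"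
    using p18 unfolding q18_def by simp_all
  define q20 where "q20 = 524287 / 1211764261659768520704000 * pi ^ 20"
  have q20: "379 / 100000000000 \<le> q20" "q20 \<le> 380 / 100000000000"
    using p20 unfolding q20_def by simp_all
  define q22 where "q22 = 42799 / 45919487810264912363520000 * pi ^ 22"
  have q22: "8 / 100000000000 \<le> q22" "q22 \<le> 9 / 100000000000"
    using p22 unfolding q22_def by simp_all
  define q24 where "q24 = 8388607 / 4987835991934721800808693760000 * pi ^ 24"
  have q24: "0 / 100000000000 \<le> q24" "q24 \<le> 1 / 100000000000"
    using p24 unfolding q24_def by simp_all

  show ?thesis
    unfolding eq q2_def[symmetric] q4_def[symmetric] q6_def[symmetric] q8_def[symmetric] q10_def[symmetric] q12_def[symmetric] q14_def[symmetric] q16_def[symmetric] q18_def[symmetric] q20_def[symmetric] q22_def[symmetric] q24_def[symmetric] abs_le_iff using q2 q4 q6 q8 q10 q12 q14 q16 q18 q20 q22 q24 by (intro conjI) linarith+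
qed

text \<open>Only \<open>sin s / s\<close> with \<open>s = t + pi / 2\<close> is replaced by its
  polynomial; the part \<open>sin s\<close> is integrated exactly and contributes the summand -1.
  Half of the tolerance covers this replacement, half the enclosure of the polynomial.\<close>

lemma exit_mean_numeric:
  "\<bar>integral {0..pi/2} (\<lambda>t. (1 - 2 * t / (pi/2 + t)) * cos t) - 51165548 / 100000000\<bar> \<le> 2 / 100000000"
proof -
  define f where "f t = (1 - 2 * t / (pi/2 + t)) * cos t" for t :: real
  define g where "g t = pi * sinc_poly (t + pi/2) - cos t" for t
  have g: "(g has_integral (pi * Si_poly (pi/2 + pi/2) - sin (pi/2)) - (pi * Si_poly (0 + pi/2) - sin 0)) {0..pi/2}"
    unfolding g_def
  proof (rule fundamental_theorem_of_calculus)
    fix x :: real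
    have "((\<lambda>t. pi * Si_poly (t + pi/2) - sin t) has_real_derivative pi * sinc_poly (x + pi/2) - cos x) (at x)"
      by (auto intro!: derivative_eq_intros DERIV_Si_poly[THEN DERIV_chain2])
    then show "((\<lambda>t. pi * Si_poly (t + pi/2) - sin t) has_vector_derivative pi * sinc_poly (x + pi/2) - cos x) (at x within {0..pi/2})"
      by (simp add: has_real_derivative_iff_has_vector_derivative has_vector_derivative_at_within)
  qed simp
  have "f integrable_on {0..pi/2}"
    unfolding f_def by (intro integrable_continuous_interval continuous_intros) (auto simp: add_nonneg_eq_0_iff)
  then have f: "(f has_integral integral {0..pi/2} f) {0..pi/2}" by (rule integrable_integral)
  have "norm (integral {0..pi/2} f - ((pi * Si_poly (pi/2 + pi/2) - sin (pi/2)) - (pi * Si_poly (0 + pi/2) - sin 0)))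
      \<le> (4 * (4 ^ 23 / fact 24)) * measure lborel {0..pi/2}"
  proof (rule has_integral_bound_real[OF _ finite.emptyI has_integral_diff[OF f g]])
    fix t assume t: "t \<in> {0..pi/2} - {}"
    define s where "s = t + pi/2"
    have s: "0 < s" "s \<le> pi" "s \<le> 4" using t pi_less_4 by (auto simp: s_def intro: add_nonneg_pos)
    have "cos t = sin s" by (simp add: s_def sin_add)
    moreover have "1 - 2 * t / (pi/2 + t) = pi / s - 1" using s by (simp add: s_def field_simps)
    ultimately have "f t = (pi / s - 1) * sin s" "g t = pi * sinc_poly s - sin s"
      by (simp_all only: f_def g_def s_def[symmetric])
    then have "f t - g t = pi * ((sin s - s * sinc_poly s) / s)"
      using s by (simp add: left_diff_distrib right_diff_distrib diff_divide_distrib)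
    then have "norm (f t - g t) = pi * (\<bar>sin s - s * sinc_poly s\<bar> / s)"
      using s by (simp add: abs_mult)
    \<comment> \<open>\<open>pi < 4\<close> bounds both the factor and \<open>s\<close>, and the
      division by \<open>s\<close> lowers the order of the remainder from 24 to 23.\<close>
    also have "\<dots> \<le> 4 * ((\<bar>s\<bar> ^ 24 / fact 24) / s)"
      using s pi_less_4 by (intro mult_mono divide_right_mono sin_taylor24) auto
    also have "(\<bar>s\<bar> ^ 24 / fact 24) / s = s ^ 23 / fact 24"
      using s by (simp add: power_Suc[of s 23, simplified])
    also have "\<dots> \<le> 4 ^ 23 / fact 24" using s by (intro divide_right_mono power_mono) auto
    finally show "norm (f t - g t) \<le> 4 * (4 ^ 23 / fact 24)" by simp
  qed simp
  also have "\<dots> \<le> (4 * (4 ^ 23 / fact 24)) * 2" using pi_less_4 by (intro mult_left_mono) auto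
  also have "\<dots> \<le> 1 / 100000000" by (simp add: fact_numeral)
  finally have "\<bar>integral {0..pi/2} f - (pi * (Si_poly pi - Si_poly (pi / 2)) - 1)\<bar> \<le> 1 / 100000000"
    by (simp add: algebra_simps)
  then show ?thesis using pi_Si_poly_bounds unfolding f_def abs_le_iff by linarith
qed

section \<open>Cauchy's perimeter formula\<close>

lemma integral_periodic_shift:
  fixes f :: "real \<Rightarrow> real"
  assumes cont: "continuous_on UNIV f" and per: "\<And>x. f (x + p) = f x" and c: "0 \<le> c" "c \<le> p"
  shows "integral {0..p} (\<lambda>x. f (x + c)) = integral {0..p} f"
proof -
  have int: "f integrable_on {a..b}" for a b
    by (intro integrable_continuous_interval continuous_on_subset[OF cont]) auto
  have sh: "integral {a..b} (\<lambda>x. f (x + d)) = integral {a+d..b+d} f" for a b d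
    using integral_shift[of a d b f] continuous_on_subset[OF cont, of "{a+d..b+d}"] by (simp add: comp_def)
  have "integral {0..p} (\<lambda>x. f (x + c)) = integral {c..p+c} f" using sh[of 0 p c] by simp
  also have "\<dots> = integral {c..p} f + integral {p..p+c} f"
    using c int by (intro Henstock_Kurzweil_Integration.integral_combine[symmetric]) auto
  also have "integral {p..p+c} f = integral {0..c} (\<lambda>x. f (x + p))" using sh[of 0 c p] by (simp add: add.commute)
  also have "\<dots> = integral {0..c} f" by (simp add: per)
  also have "integral {c..p} f + integral {0..c} f = integral {0..p} f"
    using c int Henstock_Kurzweil_Integration.integral_combine[of 0 c p f] by (simp add: add.commute)
  finally show ?thesis .
qed

lemma has_integral_abs_cos: "((\<lambda>x. \<bar>cos x\<bar>) has_integral 4) {0..2*pi}"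
proof -
  have 1: "((\<lambda>x. \<bar>cos x\<bar>) has_integral (sin (pi/2) - sin 0)) {0..pi/2}"
  proof (rule has_integral_eq[rotated])
    show "(cos has_integral (sin (pi/2) - sin 0)) {0..pi/2}"
      by (rule fundamental_theorem_of_calculus) (auto intro!: derivative_eq_intros simp flip: has_real_derivative_iff_has_vector_derivative)
  qed (auto simp: cos_ge_zero)
  have 2: "((\<lambda>x. \<bar>cos x\<bar>) has_integral ((- sin (3*pi/2)) - (- sin (pi/2)))) {pi/2..3*pi/2}"
  proof (rule has_integral_eq[rotated])
    show "((\<lambda>x. - cos x) has_integral ((- sin (3*pi/2)) - (- sin (pi/2)))) {pi/2..3*pi/2}"
      by (rule fundamental_theorem_of_calculus) (auto intro!: derivative_eq_intros simp flip: has_real_derivative_iff_has_vector_derivative)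
    fix x assume x: "x \<in> {pi/2..3*pi/2}"
    have "cos (x - pi) \<ge> 0" using x by (intro cos_ge_zero) auto
    then show "- cos x = \<bar>cos x\<bar>" by simp
  qed
  have 3: "((\<lambda>x. \<bar>cos x\<bar>) has_integral (sin (2*pi) - sin (3*pi/2))) {3*pi/2..2*pi}"
  proof (rule has_integral_eq[rotated])
    show "(cos has_integral (sin (2*pi) - sin (3*pi/2))) {3*pi/2..2*pi}"
      by (rule fundamental_theorem_of_calculus) (auto intro!: derivative_eq_intros simp flip: has_real_derivative_iff_has_vector_derivative)
    fix x assume x: "x \<in> {3*pi/2..2*pi}"
    have "cos (2*pi - x) \<ge> 0" using x by (intro cos_ge_zero) auto
    then show "cos x = \<bar>cos x\<bar>" by simp
  qed
  have s: "sin (3*pi/2) = -1" using sin_3over2_pi by simp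
  have "((\<lambda>x. \<bar>cos x\<bar>) has_integral 3) {0..3*pi/2}"
    using has_integral_combine[OF _ _ 1 2] by (simp add: s)
  from has_integral_combine[OF _ _ this 3] show ?thesis by (simp add: s)
qed

section \<open>Directions and support functions\<close>

definition unit_dir :: "real \<Rightarrow> real \<times> real" where "unit_dir t = (cos t, sin t)"

lemma norm_unit_dir[simp]: "norm (unit_dir t) = 1"
  by (simp add: unit_dir_def norm_Pair)

lemma unit_dir_periodic[simp]: "unit_dir (t + 2 * pi) = unit_dir t"
  by (simp add: unit_dir_def)

lemma unit_dir_pi: "unit_dir (t + pi) = - unit_dir t"
  by (simp add: unit_dir_def)

lemma continuous_on_unit_dir[continuous_intros]:
  fixes f :: "real \<Rightarrow> real"
  shows "continuous_on A f \<Longrightarrow> continuous_on A (\<lambda>x. unit_dir (f x))"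
  unfolding unit_dir_def by (auto intro!: continuous_intros)

lemma dist_unit_dir_le: "dist (unit_dir s) (unit_dir t) \<le> \<bar>s - t\<bar>"
proof -
  have "(dist (unit_dir s) (unit_dir t))\<^sup>2 = (cos s - cos t)\<^sup>2 + (sin s - sin t)\<^sup>2"
    by (simp add: unit_dir_def dist_Pair_Pair dist_real_def)
  also have "\<dots> = 2 - 2 * cos (s - t)"
    by (simp add: cos_diff power2_diff sin_squared_eq algebra_simps)
  also have "\<dots> = 4 * (sin ((s - t) / 2))\<^sup>2"
  proof -
    have "cos (s - t) = 1 - 2 * (sin ((s - t) / 2))\<^sup>2"
      by (metis cos_double_sin field_sum_of_halves mult_2)
    then show ?thesis by simp
  qed
  also have "\<dots> \<le> 4 * ((s - t) / 2)\<^sup>2"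
    using abs_sin_x_le_abs_x[of "(s - t) / 2"] unfolding abs_le_square_iff by (rule mult_left_mono) simp
  also have "\<dots> = \<bar>s - t\<bar>\<^sup>2" by (simp add: power2_eq_square)
  finally show ?thesis by (rule power2_le_imp_le) simp
qed

text \<open>This converts the length of a polygon into an integral over directions. Measuring angles
  from the direction of \<open>v\<close> turns the integrand into a multiple of the modulus of the
  cosine.\<close>

lemma integral_abs_inner_unit_dir:
  "integral {0..2*pi} (\<lambda>t. \<bar>v \<bullet> unit_dir t\<bar>) = 4 * norm v"
proof -
  obtain \<phi> where \<phi>: "0 \<le> \<phi>" "\<phi> < 2*pi" "v = norm v *\<^sub>R unit_dir \<phi>"
  proof (cases "v = 0")
    case True
    then show ?thesis using that[of 0] by simp
  next
    case False
    define w where "w = v /\<^sub>R norm v"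
    have "norm w = 1" using False by (simp add: w_def)
    then have "(fst w)\<^sup>2 + (snd w)\<^sup>2 = 1" by (simp add: norm_prod_def)
    then obtain \<phi> where "0 \<le> \<phi>" "\<phi> < 2*pi" "fst w = cos \<phi>" "snd w = sin \<phi>"
      using sincos_total_2pi by blast
    moreover from this have "w = unit_dir \<phi>" by (simp add: unit_dir_def prod_eq_iff)
    then have "norm v *\<^sub>R (v /\<^sub>R norm v) = norm v *\<^sub>R unit_dir \<phi>" by (simp add: w_def)
    then have "v = norm v *\<^sub>R unit_dir \<phi>" using False by simp
    ultimately show ?thesis using that by blast
  qed
  \<comment> \<open>The phase is \<open>2 * pi - \<phi>\<close> and not \<open>- \<phi>\<close>
    because \<open>integral_periodic_shift\<close> takes shifts between 0 and the period.\<close>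
  have "unit_dir \<phi> \<bullet> unit_dir t = cos (t + (2 * pi - \<phi>))" for t
  proof -
    have "cos (t + (2 * pi - \<phi>)) = cos (t - \<phi> + 2 * pi)" by (simp add: algebra_simps)
    then show ?thesis by (simp only: cos_periodic) (simp add: unit_dir_def cos_diff mult.commute)
  qed
  then have "\<bar>v \<bullet> unit_dir t\<bar> = norm v * \<bar>cos (t + (2 * pi - \<phi>))\<bar>" for t
    by (subst \<phi>(3)) (simp add: abs_mult)
  then have "integral {0..2*pi} (\<lambda>t. \<bar>v \<bullet> unit_dir t\<bar>) = norm v * integral {0..2*pi} (\<lambda>t. \<bar>cos (t + (2 * pi - \<phi>))\<bar>)"
    by simp
  also have "integral {0..2*pi} (\<lambda>t. \<bar>cos (t + (2 * pi - \<phi>))\<bar>) = integral {0..2*pi} (\<lambda>t. \<bar>cos t\<bar>)"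
    using \<phi> by (intro integral_periodic_shift continuous_intros) auto
  also have "\<dots> = 4" by (rule integral_unique[OF has_integral_abs_cos])
  finally show ?thesis by simp
qed

lemma riemann_sum_tendsto:
  fixes f :: "real \<Rightarrow> real"
  assumes lip: "\<And>x y. \<bar>f x - f y\<bar> \<le> L * \<bar>x - y\<bar>" and "0 \<le> p"
  shows "(\<lambda>n. p / real n * (\<Sum>i<n. f (p * real i / real n))) \<longlonglongrightarrow> integral {0..p} f"
proof -
  have "0 \<le> L" using lip[of 0 1] abs_ge_zero[of "f 0 - f 1"] by simp
  then have "L-lipschitz_on UNIV f" using lip by (intro lipschitz_onI) (auto simp: dist_real_def)
  then have cont: "continuous_on UNIV f" by (rule lipschitz_on_continuous_on)
  have int: "f integrable_on {a..b}" for a b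
    by (intro integrable_continuous_interval continuous_on_subset[OF cont]) auto
  have piece: "\<bar>integral {a..a+d} f - d * f a\<bar> \<le> L * d * d" if "0 \<le> d" for a d
  proof -
    have "((\<lambda>x. f x - f a) has_integral (integral {a..a+d} f - d * f a)) {a..a+d}"
      using has_integral_diff[OF integrable_integral[OF int] has_integral_const_real[of "f a" a "a+d"]] that by simp
    then have "norm (integral {a..a+d} f - d * f a) \<le> (L * d) * measure lborel {a..a+d}"
    proof (rule has_integral_bound_real[OF _ finite.emptyI, rotated])
      fix x assume x: "x \<in> {a..a+d} - {}"
      have "\<bar>f x - f a\<bar> \<le> L * \<bar>x - a\<bar>" by (rule lip)
      also have "\<dots> \<le> L * d" using x \<open>0 \<le> L\<close> by (intro mult_left_mono) auto
      finally show "norm (f x - f a) \<le> L * d" by simp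
    qed (use \<open>0 \<le> L\<close> that in auto)
    then show ?thesis using that by simp
  qed
  have sum: "\<bar>integral {0..real k * d} f - d * (\<Sum>i<k. f (real i * d))\<bar> \<le> real k * (L * d * d)" if "0 \<le> d" for d k
  proof (induction k)
    case (Suc k)
    have "integral {0..real (Suc k) * d} f = integral {0..real k * d} f + integral {real k * d..real k * d + d} f"
      using that int Henstock_Kurzweil_Integration.integral_combine[of 0 "real k * d" "real k * d + d" f]
      by (simp add: algebra_simps)
    then show ?case using Suc piece[OF that, of "real k * d"] by (simp add: algebra_simps abs_le_iff)
  qed simp
  have bound: "\<bar>integral {0..p} f - p / real n * (\<Sum>i<n. f (p * real i / real n))\<bar> \<le> L * p * p / real n" if "n > 0" for n
    using sum[of "p / real n" n] that \<open>0 \<le> p\<close> by (simp add: mult.commute)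
  have "(\<lambda>n. p / real n * (\<Sum>i<n. f (p * real i / real n)) - integral {0..p} f) \<longlonglongrightarrow> 0"
  proof (rule Lim_null_comparison[OF _ lim_const_over_n])
    show "\<forall>\<^sub>F n in sequentially. norm (p / real n * (\<Sum>i<n. f (p * real i / real n)) - integral {0..p} f) \<le> L * p * p / real n"
      using eventually_gt_at_top[of 0] by eventually_elim (use bound in \<open>simp add: abs_minus_commute\<close>)
  qed
  then show ?thesis by (simp add: LIM_zero_iff)
qed

definition supp :: "(real \<times> real) set \<Rightarrow> real \<Rightarrow> real" where
  "supp A t = Sup ((\<lambda>p. p \<bullet> unit_dir t) ` A)"

lemma supp_upper: "compact A \<Longrightarrow> p \<in> A \<Longrightarrow> p \<bullet> unit_dir t \<le> supp A t"
  unfolding supp_def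
  by (intro cSup_upper bounded_imp_bdd_above compact_imp_bounded compact_continuous_image continuous_intros) auto

lemma supp_attained: "compact A \<Longrightarrow> A \<noteq> {} \<Longrightarrow> \<exists>p\<in>A. p \<bullet> unit_dir t = supp A t"
proof -
  assume A: "compact A" "A \<noteq> {}"
  have c: "compact ((\<lambda>p. p \<bullet> unit_dir t) ` A)"
    by (intro compact_continuous_image continuous_intros A)
  have "Sup ((\<lambda>p. p \<bullet> unit_dir t) ` A) \<in> (\<lambda>p. p \<bullet> unit_dir t) ` A"
    using A c by (intro closed_contains_Sup bounded_imp_bdd_above compact_imp_bounded compact_imp_closed) auto
  then show ?thesis unfolding supp_def by force
qed

lemma supp_le: "compact A \<Longrightarrow> A \<noteq> {} \<Longrightarrow> (\<And>p. p \<in> A \<Longrightarrow> p \<bullet> unit_dir t \<le> c) \<Longrightarrow> supp A t \<le> c"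
  using supp_attained[of A t] by force

lemma supp_periodic[simp]: "supp A (t + 2 * pi) = supp A t"
  by (simp add: supp_def)

lemma supp_convex_hull: "compact A \<Longrightarrow> A \<noteq> {} \<Longrightarrow> supp (convex hull A) t = supp A t"
proof (rule antisym)
  assume A: "compact A" "A \<noteq> {}"
  have "convex hull A \<subseteq> {p. p \<bullet> unit_dir t \<le> supp A t}"
    using supp_upper[OF A(1)] convex_halfspace_le[of "unit_dir t"] by (intro hull_minimal) (auto simp: inner_commute)
  then show "supp (convex hull A) t \<le> supp A t"
    using A by (intro supp_le compact_convex_hull) auto
  show "supp A t \<le> supp (convex hull A) t"
    using A by (intro supp_le supp_upper compact_convex_hull) (auto intro: hull_inc)
qed

lemma supp_lipschitz:
  assumes A: "compact A" "A \<noteq> {}" "A \<subseteq> cball 0 R"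
  shows "\<bar>supp A s - supp A t\<bar> \<le> R * \<bar>s - t\<bar>"
proof -
  have *: "supp A s - supp A t \<le> R * \<bar>s - t\<bar>" for s t
  proof -
    obtain p where p: "p \<in> A" "p \<bullet> unit_dir s = supp A s" using supp_attained[OF A(1,2)] by blast
    have "supp A s - supp A t \<le> p \<bullet> unit_dir s - p \<bullet> unit_dir t"
      using supp_upper[OF A(1) p(1), of t] p by simp
    also have "\<dots> = p \<bullet> (unit_dir s - unit_dir t)" by (simp add: inner_diff_right)
    also have "\<dots> \<le> norm p * norm (unit_dir s - unit_dir t)" by (rule norm_cauchy_schwarz)
    also have "\<dots> \<le> R * \<bar>s - t\<bar>"
    proof (intro mult_mono)
      show "norm p \<le> R" using p A(3) by auto
      then show "0 \<le> R" using norm_ge_zero[of p] by linarith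
    qed (use dist_unit_dir_le[of s t] in \<open>auto simp: dist_norm\<close>)
    finally show ?thesis .
  qed
  show ?thesis using *[of s t] *[of t s] by (auto simp: abs_le_iff abs_minus_commute)
qed

lemma continuous_on_supp:
  assumes "compact A" "A \<noteq> {}" shows "continuous_on S (supp A)"
proof -
  obtain R where R: "A \<subseteq> cball 0 R" using compact_imp_bounded[OF assms(1)]
    by (meson ball_subset_cball bounded_subset_ballD order_trans)
  then have "R \<ge> 0" using assms(2) by (auto intro: order_trans[OF norm_ge_zero])
  then have "R-lipschitz_on S (supp A)"
    using supp_lipschitz[OF assms R] by (intro lipschitz_onI) (auto simp: dist_real_def)
  then show ?thesis by (rule lipschitz_on_continuous_on)
qed

lemma supp_riemann:
  assumes "compact A" "A \<noteq> {}"
  shows "(\<lambda>n. 2 * pi / real n * (\<Sum>i<n. supp A (2 * pi * real i / real n))) \<longlonglongrightarrow> integral {0..2*pi} (supp A)"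
proof -
  obtain R where R: "A \<subseteq> cball 0 R" using compact_imp_bounded[OF assms(1)]
    by (meson ball_subset_cball bounded_subset_ballD order_trans)
  show ?thesis by (rule riemann_sum_tendsto[OF supp_lipschitz[OF assms R]]) simp
qed

text \<open>A maximiser of a nonzero linear functional cannot be interior. The curve traces only the
  frontier, so the maximum is wanted there.\<close>

lemma supp_attained_frontier:
  assumes "compact K" "K \<noteq> {}"
  shows "\<exists>p\<in>frontier K. p \<bullet> unit_dir t = supp K t"
proof -
  obtain p where p: "p \<in> K" "p \<bullet> unit_dir t = supp K t" using supp_attained[OF assms] by blast
  have "p \<notin> interior K"
  proof
    assume "p \<in> interior K"
    then obtain e where e: "e > 0" "cball p e \<subseteq> K" using mem_interior_cball by blast
    have "p + e *\<^sub>R unit_dir t \<in> K" using e by (intro subsetD[OF e(2)]) (auto simp: dist_norm)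
    from supp_upper[OF assms(1) this, of t] have "supp K t + e * (unit_dir t \<bullet> unit_dir t) \<le> supp K t"
      using p by (simp add: inner_add_left)
    then show False using e(1) by (simp add: dot_square_norm)
  qed
  then show ?thesis using p assms by (auto simp: frontier_def compact_imp_closed)
qed

section \<open>Lower bound for the length of a curve along the frontier\<close>

lemma abs_diff_le_sum_steps:
  fixes x :: "nat \<Rightarrow> real"
  assumes "i \<le> j" shows "\<bar>x j - x i\<bar> \<le> (\<Sum>k=i..<j. \<bar>x (Suc k) - x k\<bar>)"
  using assms
proof (induction j rule: dec_induct)
  case (step n)
  have "\<bar>x (Suc n) - x i\<bar> \<le> \<bar>x n - x i\<bar> + \<bar>x (Suc n) - x n\<bar>" by linarith
  then show ?case using step by simp
qed simp

text \<open>A closed sequence has to pass from one value to the other and back, so each oscillation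
  is paid for twice.\<close>

lemma closed_sequence_variation:
  fixes x :: "nat \<Rightarrow> real"
  assumes "x N = x 0" "i \<le> N" "j \<le> N"
  shows "2 * (x i - x j) \<le> (\<Sum>k<N. \<bar>x (Suc k) - x k\<bar>)"
proof -
  have *: "2 * \<bar>x i - x j\<bar> \<le> (\<Sum>k<N. \<bar>x (Suc k) - x k\<bar>)" if "i \<le> j" "j \<le> N" for i j
  proof -
    have split: "(\<Sum>k<N. \<bar>x (Suc k) - x k\<bar>) = (\<Sum>k=0..<i. \<bar>x (Suc k) - x k\<bar>) + (\<Sum>k=i..<j. \<bar>x (Suc k) - x k\<bar>) + (\<Sum>k=j..<N. \<bar>x (Suc k) - x k\<bar>)"
      using that by (simp add: lessThan_atLeast0 sum.atLeastLessThan_concat)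
    have tri: "2 * \<bar>a - c\<bar> \<le> A + B + C" if "\<bar>a - b\<bar> \<le> A" "\<bar>c - a\<bar> \<le> B" "\<bar>b - c\<bar> \<le> C" for a b c A B C :: real
    proof -
      have "\<bar>a - c\<bar> \<le> A + C" "\<bar>a - c\<bar> \<le> B" using that by linarith+
      from add_mono[OF this] show ?thesis by (simp add: algebra_simps)
    qed
    show ?thesis
      unfolding split using abs_diff_le_sum_steps[OF that(2), of x] unfolding assms(1)
      by (rule tri[OF abs_diff_le_sum_steps[OF le0] abs_diff_le_sum_steps[OF that(1)]])
  qed
  show ?thesis
  proof (cases "i \<le> j")
    case True
    from *[OF True assms(3)] show ?thesis by (rule order_trans[rotated]) (intro mult_left_mono abs_ge_self, simp)
  next
    case False
    then have "j \<le> i" by simp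
    from *[OF this assms(2)] show ?thesis unfolding abs_minus_commute[of "x j"] by (rule order_trans[rotated]) (intro mult_left_mono abs_ge_self, simp)
  qed
qed

text \<open>Projected to direction \<open>t\<close>, a fine inscribed polygon varies by at least
  twice the width \<open>supp K t + supp K (t + pi)\<close>, up to the sampling error. Over all
  directions the width integrates to twice the integral of \<open>supp K\<close>, and each edge
  contributes four times its length, so the factors 4 cancel.\<close>

lemma curve_length_ge_integral_supp:
  assumes K: "compact K" "K \<noteq> {}" and g: "path g" "pathfinish g = pathstart g" "path_image g = frontier K"
  shows "ereal (integral {0..2*pi} (supp K)) \<le> curve_length g"
proof (rule ereal_le_epsilon2)
  fix \<epsilon>' :: real assume "0 < \<epsilon>'"
  \<comment> \<open>Chosen so that the loss \<open>8 * pi * \<epsilon>\<close>, divided by 4, is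
    \<open>\<epsilon>'\<close>.\<close>
  define \<epsilon> where "\<epsilon> = \<epsilon>' / (2 * pi)"
  have "0 < \<epsilon>" using \<open>0 < \<epsilon>'\<close> by (simp add: \<epsilon>_def)
  have "uniformly_continuous_on {0..1} g"
    using g(1) by (intro compact_uniformly_continuous) (auto simp: path_def)
  then obtain d where d: "d > 0" "\<And>s t. s \<in> {0..1} \<Longrightarrow> t \<in> {0..1} \<Longrightarrow> dist t s < d \<Longrightarrow> dist (g t) (g s) < \<epsilon>"
    unfolding uniformly_continuous_on_def using \<open>0 < \<epsilon>\<close> by metis
  obtain m :: nat where m: "1 / real (Suc m) < d" using d(1) nat_approx_posE by blast
  define N where "N = Suc m"
  have N: "N > 0" "1 / real N < d" using m by (auto simp: N_def)
  define x where "x k = g (real k / real N)" for k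
  define s where "s = (\<Sum>k<N. dist (x k) (x (Suc k)))"
  have "ereal s \<le> curve_length g"
  proof -
    define ts where "ts = map (\<lambda>k. real k / real N) [0..<Suc N]"
    have "sorted ts" unfolding ts_def sorted_map
      by (rule sorted_wrt_mono_rel[OF _ sorted_wrt_upt]) (auto simp: divide_right_mono)
    moreover have "set ts \<subseteq> {0..1}" using N by (auto simp: ts_def field_simps)
    moreover have "(\<Sum>i<length ts - 1. dist (g (ts ! i)) (g (ts ! Suc i))) = s"
      unfolding s_def x_def ts_def by (intro sum.cong) (auto simp: nth_append simp del: upt_Suc)
    ultimately show ?thesis unfolding curve_length_def
      by (intro SUP_upper2[of ts]) auto
  qed
  have near: "\<exists>k\<le>N. dist p (x k) < \<epsilon>" if p: "p \<in> frontier K" for p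
  proof -
    obtain t where t: "t \<in> {0..1}" "p = g t" using p unfolding g(3)[symmetric] path_image_def by blast
    define k where "k = nat \<lfloor>real N * t\<rfloor>"
    have k: "real k \<le> real N * t" "real N * t < real k + 1"
      using t N by (auto simp: k_def)
    have "real k \<le> real N" using k(1) t mult_left_le[of t "real N"] by auto
    moreover have "dist t (real k / real N) \<le> 1 / real N"
    proof -
      have "real k / real N \<le> t" "t \<le> (real k + 1) / real N"
        using k N by (simp_all add: divide_le_eq le_divide_eq mult.commute)
      then show ?thesis by (simp add: dist_real_def abs_le_iff add_divide_distrib)
    qed
    ultimately show ?thesis
      using N t d(2)[of "real k / real N" t] by (intro exI[of _ k]) (auto simp: x_def)
  qed
  have closed: "x N = x 0" using g(2) N by (simp add: x_def pathfinish_def pathstart_def)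
  have var: "2 * (supp K t + supp K (t + pi)) - 4 * \<epsilon> \<le> (\<Sum>k<N. \<bar>(x (Suc k) - x k) \<bullet> unit_dir t\<bar>)" for t
  proof -
    obtain p where p: "p \<in> frontier K" "p \<bullet> unit_dir t = supp K t" using supp_attained_frontier[OF K] by blast
    obtain q where q: "q \<in> frontier K" "q \<bullet> unit_dir (t + pi) = supp K (t + pi)" using supp_attained_frontier[OF K] by blast
    obtain i where i: "i \<le> N" "dist p (x i) < \<epsilon>" using near[OF p(1)] by blast
    obtain j where j: "j \<le> N" "dist q (x j) < \<epsilon>" using near[OF q(1)] by blast
    have cs: "\<bar>v \<bullet> unit_dir t\<bar> \<le> norm v" for v using Cauchy_Schwarz_ineq2[of v "unit_dir t"] by simp
    have "x i \<bullet> unit_dir t \<ge> supp K t - \<epsilon>"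
      using cs[of "p - x i"] i(2) p(2) by (simp add: dist_norm inner_diff_left abs_le_iff)
    moreover have "x j \<bullet> unit_dir t \<le> - supp K (t + pi) + \<epsilon>"
      using cs[of "q - x j"] j(2) q(2) by (simp add: dist_norm inner_diff_left abs_le_iff unit_dir_pi)
    moreover have "2 * (x i \<bullet> unit_dir t - x j \<bullet> unit_dir t) \<le> (\<Sum>k<N. \<bar>x (Suc k) \<bullet> unit_dir t - x k \<bullet> unit_dir t\<bar>)"
      using closed_sequence_variation[of "\<lambda>k. x k \<bullet> unit_dir t" N i j] closed i(1) j(1) by simp
    ultimately show ?thesis by (simp add: inner_diff_left)
  qed
  have contK: "continuous_on UNIV (supp K)" by (rule continuous_on_supp[OF K])
  have ci: "(\<lambda>t. supp K t) integrable_on {0..2*pi}" "(\<lambda>t. supp K (t + pi)) integrable_on {0..2*pi}"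
    by (intro integrable_continuous_interval continuous_on_compose2[OF contK] continuous_intros; simp)+
  have cd: "(\<lambda>t. \<bar>v \<bullet> unit_dir t\<bar>) integrable_on {0..2*pi}" for v
    by (intro integrable_continuous_interval continuous_intros)
  have "4 * integral {0..2*pi} (supp K) - 8 * pi * \<epsilon> = integral {0..2*pi} (\<lambda>t. 2 * (supp K t + supp K (t + pi)) - 4 * \<epsilon>)"
  proof -
    have "integral {0..2*pi} (\<lambda>t. supp K (t + pi)) = integral {0..2*pi} (supp K)"
      by (rule integral_periodic_shift[OF contK]) auto
    moreover have "((\<lambda>t. 2 * (supp K t + supp K (t + pi)) - 4 * \<epsilon>) has_integral
        (2 * (integral {0..2*pi} (supp K) + integral {0..2*pi} (\<lambda>t. supp K (t + pi))) - (2 * pi - 0) *\<^sub>R (4 * \<epsilon>))) {0..2*pi}"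
      using has_integral_const_real[of "4 * \<epsilon>" 0 "2*pi"]
      by (intro has_integral_diff has_integral_mult_right has_integral_add integrable_integral ci) simp
    ultimately show ?thesis by (simp add: integral_unique)
  qed
  also have "\<dots> \<le> integral {0..2*pi} (\<lambda>t. \<Sum>k<N. \<bar>(x (Suc k) - x k) \<bullet> unit_dir t\<bar>)"
    using var by (intro integral_le integrable_sum cd integrable_continuous_interval continuous_on_compose2[OF contK] continuous_intros) auto
  also have "\<dots> = (\<Sum>k<N. integral {0..2*pi} (\<lambda>t. \<bar>(x (Suc k) - x k) \<bullet> unit_dir t\<bar>))"
    using cd by (intro integral_sum) auto
  also have "\<dots> = 4 * s"
    unfolding integral_abs_inner_unit_dir s_def by (simp add: sum_distrib_left dist_norm norm_minus_commute)
  finally have "integral {0..2*pi} (supp K) \<le> s + \<epsilon>'"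
    by (simp add: \<epsilon>_def)
  then have "ereal (integral {0..2*pi} (supp K)) \<le> ereal s + ereal \<epsilon>'" by simp
  also have "\<dots> \<le> curve_length g + ereal \<epsilon>'" using \<open>ereal s \<le> curve_length g\<close> by (rule add_right_mono)
  finally show "ereal (integral {0..2*pi} (supp K)) \<le> curve_length g + ereal \<epsilon>'" .
qed

section \<open>Upper bound by projected circumscribed polygons\<close>

definition length_majorant :: "(real \<Rightarrow> 'a::metric_space) \<Rightarrow> real \<Rightarrow> (real \<Rightarrow> real) \<Rightarrow> bool" where
  "length_majorant g L F \<longleftrightarrow> F 0 = 0 \<and> F 1 = L \<and> (\<forall>s t. 0 \<le> s \<longrightarrow> s \<le> t \<longrightarrow> t \<le> 1 \<longrightarrow> dist (g s) (g t) \<le> F t - F s)"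

text \<open>A majorant stands in for the arc length function: it adds up under joining and survives
  1-Lipschitz maps, which spares computing the length of the curve. Its increments telescope over
  any partition.\<close>

lemma curve_length_le_majorant:
  assumes "length_majorant g L F"
  shows "curve_length g \<le> ereal L"
  unfolding curve_length_def
proof (rule SUP_least)
  have F: "F 0 = 0" "F 1 = L" "\<And>s t. 0 \<le> s \<Longrightarrow> s \<le> t \<Longrightarrow> t \<le> 1 \<Longrightarrow> dist (g s) (g t) \<le> F t - F s"
    using assms by (auto simp: length_majorant_def)
  have mono: "F s \<le> F t" if "0 \<le> s" "s \<le> t" "t \<le> 1" for s t
    using F(3)[OF that] zero_le_dist[of "g s" "g t"] by linarith
  fix ts :: "real list" assume "ts \<in> {ts. sorted ts \<and> set ts \<subseteq> {0..1}}"
  then have ts: "sorted ts" "set ts \<subseteq> {0..1}" by auto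
  have "(\<Sum>i<length ts - 1. dist (g (ts ! i)) (g (ts ! Suc i))) \<le> L"
  proof (cases "ts = []")
    case True then show ?thesis using mono[of 0 1] F by simp
  next
    case False
    have in01: "0 \<le> ts ! i" "ts ! i \<le> 1" if "i < length ts" for i
      using nth_mem[OF that] ts(2) by auto
    have "(\<Sum>i<length ts - 1. dist (g (ts ! i)) (g (ts ! Suc i))) \<le> (\<Sum>i<length ts - 1. F (ts ! Suc i) - F (ts ! i))"
      using sorted_nth_mono[OF ts(1)] in01 by (intro sum_mono F(3)) auto
    also have "\<dots> = F (ts ! (length ts - 1)) - F (ts ! 0)" by (rule sum_lessThan_telescope)
    also have "\<dots> \<le> F 1 - F 0"
      using False in01[of "length ts - 1"] in01[of 0] by (intro diff_mono mono) auto
    finally show ?thesis using F by simp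
  qed
  then show "ereal (\<Sum>i<length ts - 1. dist (g (ts ! i)) (g (ts ! Suc i))) \<le> ereal L" by simp
qed

lemma length_majorant_lipschitz_comp:
  assumes "length_majorant g L F" "\<And>x y. dist (f x) (f y) \<le> dist x y"
  shows "length_majorant (f \<circ> g) L F"
  using assms unfolding length_majorant_def comp_def by (meson order_trans)

lemma length_majorant_linepath: "length_majorant (linepath a b) (dist a b) (\<lambda>t. t * dist a b)"
  unfolding length_majorant_def
proof (intro conjI allI impI)
  fix s t :: real assume "s \<le> t"
  have "linepath a b s - linepath a b t = (t - s) *\<^sub>R (a - b)"
    by (simp add: linepath_def algebra_simps)
  then have "dist (linepath a b s) (linepath a b t) = (t - s) * dist a b"
    using \<open>s \<le> t\<close> by (simp add: dist_norm)
  then show "dist (linepath a b s) (linepath a b t) \<le> t * dist a b - s * dist a b"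
    by (simp add: algebra_simps)
qed auto

lemma length_majorant_join:
  assumes g: "length_majorant g L F" and h: "length_majorant h L' G" and fin: "pathfinish g = pathstart h"
  shows "\<exists>H. length_majorant (g +++ h) (L + L') H"
proof -
  define H where "H t = (if t \<le> 1/2 then F (2 * t) else L + G (2 * t - 1))" for t
  have F: "F 0 = 0" "F 1 = L" "\<And>s t. 0 \<le> s \<Longrightarrow> s \<le> t \<Longrightarrow> t \<le> 1 \<Longrightarrow> dist (g s) (g t) \<le> F t - F s"
    using g by (auto simp: length_majorant_def)
  have G: "G 0 = 0" "G 1 = L'" "\<And>s t. 0 \<le> s \<Longrightarrow> s \<le> t \<Longrightarrow> t \<le> 1 \<Longrightarrow> dist (h s) (h t) \<le> G t - G s"
    using h by (auto simp: length_majorant_def)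
  have "dist ((g +++ h) s) ((g +++ h) t) \<le> H t - H s" if st: "0 \<le> s" "s \<le> t" "t \<le> 1" for s t
  proof -
    consider "t \<le> 1/2" | "s > 1/2" | "s \<le> 1/2" "t > 1/2" by linarith
    then show ?thesis
    proof cases
      case 1 then show ?thesis using st F(3)[of "2 * s" "2 * t"] by (simp add: joinpaths_def H_def)
    next
      case 2 then show ?thesis using st G(3)[of "2 * s - 1" "2 * t - 1"] by (simp add: joinpaths_def H_def)
    next
      case 3
      have "dist (g (2 * s)) (h (2 * t - 1)) \<le> dist (g (2 * s)) (g 1) + dist (h 0) (h (2 * t - 1))"
        using fin dist_triangle[of "g (2 * s)" "h (2 * t - 1)" "g 1"] by (simp add: pathfinish_def pathstart_def)
      also have "\<dots> \<le> (F 1 - F (2 * s)) + (G (2 * t - 1) - G 0)"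
        using 3 st by (intro add_mono F(3) G(3)) auto
      finally show ?thesis using 3 F G by (simp add: joinpaths_def H_def)
    qed
  qed
  then have "length_majorant (g +++ h) (L + L') H"
    using F G by (simp add: length_majorant_def H_def)
  then show ?thesis by blast
qed

text \<open>The starting point is inserted for the sake of \<open>k = 0\<close>, where there is no
  segment.\<close>

lemma polygonal_path_exists:
  fixes V :: "nat \<Rightarrow> 'a::euclidean_space"
  shows "\<exists>p F. path p \<and> pathstart p = V 0 \<and> pathfinish p = V k \<and>
     path_image p = insert (V 0) (\<Union>i<k. closed_segment (V i) (V (Suc i))) \<and>
     length_majorant p (\<Sum>i<k. dist (V i) (V (Suc i))) F"
proof (induction k)
  case 0
  then show ?case
    by (intro exI[of _ "\<lambda>_. V 0"] exI[of _ "\<lambda>_. 0"])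
       (auto simp: path_def pathstart_def pathfinish_def path_image_def length_majorant_def)
next
  case (Suc k)
  then obtain p F where p: "path p" "pathstart p = V 0" "pathfinish p = V k"
     "path_image p = insert (V 0) (\<Union>i<k. closed_segment (V i) (V (Suc i)))"
     "length_majorant p (\<Sum>i<k. dist (V i) (V (Suc i))) F" by blast
  obtain H where H: "length_majorant (p +++ linepath (V k) (V (Suc k))) ((\<Sum>i<k. dist (V i) (V (Suc i))) + dist (V k) (V (Suc k))) H"
    using length_majorant_join[OF p(5) length_majorant_linepath[of "V k" "V (Suc k)"]] p(3) by auto
  have "path_image (p +++ linepath (V k) (V (Suc k))) = insert (V 0) (\<Union>i<Suc k. closed_segment (V i) (V (Suc i)))"
    using p by (subst path_image_join) (auto simp: lessThan_Suc)
  then show ?case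
    using p H by (intro exI[of _ "p +++ linepath (V k) (V (Suc k))"] exI[of _ H]) auto
qed

text \<open>Convex sets without interior lie in a hyperplane whose normal serves; otherwise a
  frontier point is outside the relative interior and has a supporting hyperplane. In the plane the
  flat case covers segments and points.\<close>

lemma supporting_normal:
  fixes K :: "'a::euclidean_space set"
  assumes "convex K" "y \<in> frontier K"
  shows "\<exists>u. u \<noteq> 0 \<and> (\<forall>z\<in>K. z \<bullet> u \<le> y \<bullet> u)"
proof (cases "interior K = {}")
  case True
  then obtain a b where ab: "a \<noteq> 0" "K \<subseteq> {x. a \<bullet> x = b}"
    using empty_interior_subset_hyperplane[OF assms(1)] by blast
  have "closure K \<subseteq> {x. a \<bullet> x = b}" by (rule closure_minimal[OF ab(2) closed_hyperplane])
  then have "a \<bullet> y = b" using assms(2) by (auto simp: frontier_def)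
  then show ?thesis using ab by (intro exI[of _ a]) (auto simp: inner_commute)
next
  case False
  have "y \<in> closure K" "y \<notin> rel_interior K" using assms(2) False rel_interior_nonempty_interior[of K]
    by (auto simp: frontier_def)
  then obtain a where a: "a \<noteq> 0" "\<And>z. z \<in> closure K \<Longrightarrow> a \<bullet> y \<le> a \<bullet> z"
    using supporting_hyperplane_relative_frontier[OF assms(1)] by metis
  then show ?thesis using subsetD[OF closure_subset[of K]] by (intro exI[of _ "- a"]) (simp add: inner_commute[of _ a])
qed

text \<open>Makes the projection of a surrounding polygon reach every frontier point: it is enough
  to follow a normal ray from \<open>y\<close> to the polygon. The inequality
  \<open>z \<bullet> u \<le> y \<bullet> u\<close> renders the mixed term of the squared distance
  nonnegative.\<close>

lemma closest_point_normal:
  fixes K :: "'a::euclidean_space set"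
  assumes "convex K" "closed K" "y \<in> K" "\<And>z. z \<in> K \<Longrightarrow> z \<bullet> u \<le> y \<bullet> u" "0 \<le> s"
  shows "closest_point K (y + s *\<^sub>R u) = y"
proof (rule closest_point_unique[OF assms(1-3), symmetric], intro ballI)
  fix z assume "z \<in> K"
  have "0 \<le> 2 * s * (u \<bullet> (y - z)) + (y - z) \<bullet> (y - z)"
  proof (intro add_nonneg_nonneg mult_nonneg_nonneg inner_ge_zero)
    show "0 \<le> u \<bullet> (y - z)" using assms(4)[OF \<open>z \<in> K\<close>] by (simp add: inner_diff_right inner_commute)
  qed (use assms(5) in auto)
  then have "(s *\<^sub>R u) \<bullet> (s *\<^sub>R u) \<le> (s *\<^sub>R u + (y - z)) \<bullet> (s *\<^sub>R u + (y - z))"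
    unfolding inner_add_left inner_add_right by (simp add: inner_commute)
  then have "norm (s *\<^sub>R u) \<le> norm (s *\<^sub>R u + (y - z))" by (simp only: norm_le)
  then show "dist (y + s *\<^sub>R u) y \<le> dist (y + s *\<^sub>R u) z" by (simp add: dist_norm algebra_simps)
qed

lemma closest_point_frontier:
  fixes K :: "'a::euclidean_space set"
  assumes "closed K" "K \<noteq> {}" "x \<notin> interior K"
  shows "closest_point K x \<in> frontier K"
proof -
  have "closest_point K x \<notin> interior K"
  proof
    assume c: "closest_point K x \<in> interior K"
    then have "interior K \<noteq> {}" by blast
    then have "rel_interior K = interior K" "affine hull K = UNIV"
      by (auto simp: rel_interior_nonempty_interior affine_hull_nonempty_interior)
    then show False using closest_point_in_rel_interior[of K x] assms c by simp
  qed
  then show ?thesis using assms closest_point_in_set[of K x] by (auto simp: frontier_def)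
qed

definition unit_normal :: "real \<Rightarrow> real \<times> real" where "unit_normal t = (- sin t, cos t)"

lemma unit_dir_add: "unit_dir (t + d) = cos d *\<^sub>R unit_dir t + sin d *\<^sub>R unit_normal t"
  by (simp add: unit_dir_def unit_normal_def cos_add sin_add)

lemma unit_dir_diff: "unit_dir (t - d) = cos d *\<^sub>R unit_dir t - sin d *\<^sub>R unit_normal t"
  by (simp add: unit_dir_def unit_normal_def cos_diff sin_diff)

lemma unit_frame:
  "unit_dir t \<bullet> unit_dir t = 1" "unit_normal t \<bullet> unit_dir t = 0" "unit_dir t \<bullet> unit_normal t = 0" "norm (unit_normal t) = 1"
  by (simp_all add: unit_dir_def unit_normal_def norm_Pair power2_eq_square[symmetric])

lemma unit_frame_expand: "x = (x \<bullet> unit_dir t) *\<^sub>R unit_dir t + (x \<bullet> unit_normal t) *\<^sub>R unit_normal t"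
proof -
  have *: "a = (a * cos t + b * sin t) * cos t - (b * cos t - a * sin t) * sin t"
    "b = (a * cos t + b * sin t) * sin t + (b * cos t - a * sin t) * cos t" for a b :: real
  proof -
    have "(a * cos t + b * sin t) * cos t - (b * cos t - a * sin t) * sin t = a * ((sin t)\<^sup>2 + (cos t)\<^sup>2)"
      by algebra
    then show "a = (a * cos t + b * sin t) * cos t - (b * cos t - a * sin t) * sin t"
      by (simp only: sin_cos_squared_add mult_1_right)
    have "(a * cos t + b * sin t) * sin t + (b * cos t - a * sin t) * cos t = b * ((sin t)\<^sup>2 + (cos t)\<^sup>2)"
      by algebra
    then show "b = (a * cos t + b * sin t) * sin t + (b * cos t - a * sin t) * cos t"
      by (simp only: sin_cos_squared_add mult_1_right)
  qed
  show ?thesis using *(1)[where a="fst x" and b="snd x"] *(2)[where a="fst x" and b="snd x"] by (simp add: prod_eq_iff unit_dir_def unit_normal_def inner_prod_def)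
qed

lemma sum_shift_periodic:
  fixes f :: "nat \<Rightarrow> real"
  assumes "f n = f 0"
  shows "(\<Sum>i<n. f (Suc i)) = (\<Sum>i<n. f i)"
  using sum.lessThan_Suc_shift[of f n] sum.lessThan_Suc[of f n] assms by simp

lemma frontier_curve_exists:
  fixes K :: "(real \<times> real) set"
  assumes K: "compact K" "convex K" "K \<noteq> {}" and m: "m > 0"
  defines "d \<equiv> pi / (2 * real m)"
  shows "\<exists>g. path g \<and> pathfinish g = pathstart g \<and> path_image g = frontier K \<and>
     curve_length g \<le> ereal (2 * (1 - cos d) / sin d * (\<Sum>i<4 * m. supp K (real i * d)))"
proof -
  have Kcl: "closed K" using K(1) by (rule compact_imp_closed)
  have d: "0 < d" "d \<le> pi / 2" using m by (auto simp: d_def field_simps)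
  have sd: "sin d > 0" using d by (intro sin_gt_zero) auto
  define n where "n = 4 * m"
  have nd: "real n * d = 2 * pi" using m by (simp add: n_def d_def)
  define \<theta> where "\<theta> i = real i * d" for i :: nat
  have \<theta>S: "\<theta> (Suc i) = \<theta> i + d" for i by (simp add: \<theta>_def algebra_simps)
  have \<theta>n: "\<theta> (i + n) = \<theta> i + 2 * pi" for i using nd by (simp add: \<theta>_def algebra_simps)
  define h where "h i = supp K (\<theta> i)" for i
  have hn: "h (i + n) = h i" for i by (simp add: h_def \<theta>n)
  \<comment> \<open>\<open>V i\<close> is the intersection of the supporting lines with outer normals at angles \<open>\<theta> i\<close> and \<open>\<theta> (i + 1)\<close>,
    so the \<open>V i\<close> are the vertices of a polygon circumscribed about \<open>K\<close>. Its boundary, of length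
    \<open>2 (1 - cos d) / sin d\<close> times the sum of the \<open>h i\<close>, is projected onto \<open>K\<close> by the 1-Lipschitz map
    \<open>closest_point K\<close>. As \<open>4 m\<close> directions are used, every vector has positive inner product with one of them.\<close>
  define V where "V i = h i *\<^sub>R unit_dir (\<theta> i) + ((h (Suc i) - h i * cos d) / sin d) *\<^sub>R unit_normal (\<theta> i)" for i
  \<comment> \<open>The same vertex in the frame of the next supporting line: with both forms the
    two ends of an edge are available in a common frame.\<close>
  have V': "V i = h (Suc i) *\<^sub>R unit_dir (\<theta> (Suc i)) - ((h i - h (Suc i) * cos d) / sin d) *\<^sub>R unit_normal (\<theta> (Suc i))" for i
  proof -
    have dir: "unit_dir (\<theta> i) = cos d *\<^sub>R unit_dir (\<theta> (Suc i)) - sin d *\<^sub>R unit_normal (\<theta> (Suc i))"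
      using unit_dir_diff[of "\<theta> (Suc i)" d] by (simp add: \<theta>S)
    have nor: "unit_normal (\<theta> i) = sin d *\<^sub>R unit_dir (\<theta> (Suc i)) + cos d *\<^sub>R unit_normal (\<theta> (Suc i))"
      using cos_diff[of "\<theta> (Suc i)" d] sin_diff[of "\<theta> (Suc i)" d] by (simp add: unit_dir_def unit_normal_def \<theta>S)
    have "h i * cos d + (h (Suc i) - h i * cos d) / sin d * sin d = h (Suc i)" using sd by simp
    moreover have "(h (Suc i) - h i * cos d) / sin d * cos d - h i * sin d = - ((h i - h (Suc i) * cos d) / sin d)"
    proof -
      have "(h (Suc i) - h i * cos d) / sin d * cos d - h i * sin d = ((h (Suc i) - h i * cos d) * cos d - h i * (sin d)\<^sup>2) / sin d"
      proof -
        have "A / s * c - b * s = (A * c - b * s\<^sup>2) / s" if "s \<noteq> 0" for A b c s :: real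
          using that by (simp add: field_simps power2_eq_square)
        then show ?thesis using sd by simp
      qed
      also have "(h (Suc i) - h i * cos d) * cos d - h i * (sin d)\<^sup>2 = - (h i - h (Suc i) * cos d)"
        by (simp only: sin_squared_eq) (simp add: power2_eq_square algebra_simps)
      finally show ?thesis by (simp only: minus_divide_left)
    qed
    moreover have "V i = (h i * cos d + (h (Suc i) - h i * cos d) / sin d * sin d) *\<^sub>R unit_dir (\<theta> (Suc i)) +
        ((h (Suc i) - h i * cos d) / sin d * cos d - h i * sin d) *\<^sub>R unit_normal (\<theta> (Suc i))"
      unfolding V_def dir nor by (simp add: scaleR_add_right scaleR_diff_right scaleR_left_distrib scaleR_left_diff_distrib)
    ultimately show ?thesis by (simp only: scaleR_minus_left) simp
  qed
  have Vn: "V n = V 0"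
    using hn[of 0] hn[of 1] \<theta>n[of 0] by (simp add: V_def unit_dir_def unit_normal_def)
  define l where "l i = (h (Suc (Suc i)) + h i - 2 * cos d * h (Suc i)) / sin d" for i
  \<comment> \<open>A maximiser for the middle direction, tested in the two neighbouring directions,
    gives \<open>h (Suc (Suc i)) + h i \<ge> 2 * cos d * h (Suc i)\<close>, so no edge has negative
    length.\<close>
  have l_nonneg: "l i \<ge> 0" for i
  proof -
    obtain p where p: "p \<in> K" "p \<bullet> unit_dir (\<theta> (Suc i)) = h (Suc i)"
      using supp_attained[OF K(1,3)] unfolding h_def by blast
    have "unit_dir (\<theta> (Suc i) + d) + unit_dir (\<theta> (Suc i) - d) = (2 * cos d) *\<^sub>R unit_dir (\<theta> (Suc i))"
      unfolding unit_dir_add unit_dir_diff by (simp flip: scaleR_add_left)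
    then have "p \<bullet> unit_dir (\<theta> (Suc (Suc i))) + p \<bullet> unit_dir (\<theta> i) = 2 * cos d * h (Suc i)"
      using p(2) by (simp add: \<theta>S flip: inner_add_right)
    moreover have "p \<bullet> unit_dir (\<theta> (Suc (Suc i))) \<le> h (Suc (Suc i))" "p \<bullet> unit_dir (\<theta> i) \<le> h i"
      unfolding h_def by (intro supp_upper K p)+
    ultimately show ?thesis using sd by (simp add: l_def)
  qed
  have VV: "V (Suc i) - V i = l i *\<^sub>R unit_normal (\<theta> (Suc i))" for i
  proof -
    have "V (Suc i) - V i = ((h (Suc (Suc i)) - h (Suc i) * cos d) / sin d) *\<^sub>R unit_normal (\<theta> (Suc i)) + ((h i - h (Suc i) * cos d) / sin d) *\<^sub>R unit_normal (\<theta> (Suc i))"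
      unfolding V'[of i] V_def[of "Suc i"] by simp
    also have "\<dots> = l i *\<^sub>R unit_normal (\<theta> (Suc i))"
      unfolding scaleR_add_left[symmetric] by (simp add: l_def add_divide_distrib diff_divide_distrib)
    finally show ?thesis .
  qed
  have dV: "dist (V i) (V (Suc i)) = l i" for i
  proof -
    have "dist (V i) (V (Suc i)) = norm (V (Suc i) - V i)" by (simp add: dist_norm norm_minus_commute)
    also have "\<dots> = l i" unfolding VV using l_nonneg[of i] by (simp add: unit_frame)
    finally show ?thesis .
  qed
  have "(\<Sum>i<n. dist (V i) (V (Suc i))) = (\<Sum>i<n. l i)" by (simp add: dV)
  also have "\<dots> = ((\<Sum>i<n. h (Suc (Suc i))) + (\<Sum>i<n. h i) - 2 * cos d * (\<Sum>i<n. h (Suc i))) / sin d"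
    by (simp add: l_def sum.distrib sum_subtractf sum_distrib_left flip: sum_divide_distrib)
  also have "(\<Sum>i<n. h (Suc (Suc i))) = (\<Sum>i<n. h (Suc i))"
    using hn[of 1] by (intro sum_shift_periodic) simp
  also have "(\<Sum>i<n. h (Suc i)) = (\<Sum>i<n. h i)"
    using hn[of 0] by (intro sum_shift_periodic) simp
  also have "((\<Sum>i<n. h i) + (\<Sum>i<n. h i) - 2 * cos d * (\<Sum>i<n. h i)) / sin d = 2 * (1 - cos d) / sin d * (\<Sum>i<n. h i)"
    by (simp add: algebra_simps)
  finally have len: "(\<Sum>i<n. dist (V i) (V (Suc i))) = 2 * (1 - cos d) / sin d * (\<Sum>i<n. h i)" .
  obtain p F where p: "path p" "pathstart p = V 0" "pathfinish p = V n"
     "path_image p = insert (V 0) (\<Union>i<n. closed_segment (V i) (V (Suc i)))"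
     "length_majorant p (\<Sum>i<n. dist (V i) (V (Suc i))) F"
    using polygonal_path_exists[of V n] by (elim exE conjE) (rule that)
  have "n > 0" using m by (simp add: n_def)
  then have img: "path_image p = (\<Union>i<n. closed_segment (V i) (V (Suc i)))"
    unfolding p(4) by (intro insert_absorb UN_I[of 0]) auto
  define g where "g = closest_point K \<circ> p"
  have "path g" unfolding g_def
    by (intro path_continuous_image p continuous_on_closest_point K Kcl)
  moreover have "pathfinish g = pathstart g"
    using p(2,3) Vn by (simp add: g_def pathfinish_def pathstart_def)
  moreover have "path_image g = frontier K"
  proof (intro equalityI subsetI)
    fix x assume "x \<in> path_image g"
    then obtain y i where y: "i < n" "y \<in> closed_segment (V i) (V (Suc i))" "x = closest_point K y"
      unfolding g_def path_image_compose img by auto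
    have V1: "V i \<bullet> unit_dir (\<theta> (Suc i)) = h (Suc i)" unfolding V' by (simp add: inner_diff_left unit_frame)
    have V2: "V (Suc i) \<bullet> unit_dir (\<theta> (Suc i)) = h (Suc i)" unfolding V_def by (simp add: inner_add_left unit_frame)
    obtain u where y_eq: "y = (1 - u) *\<^sub>R V i + u *\<^sub>R V (Suc i)" using y(2) by (auto simp: in_segment)
    have "y \<bullet> unit_dir (\<theta> (Suc i)) = (1 - u) * h (Suc i) + u * h (Suc i)"
      unfolding y_eq by (simp only: inner_add_left inner_scaleR_left V1 V2)
    then have yh: "y \<bullet> unit_dir (\<theta> (Suc i)) = h (Suc i)" by (simp add: algebra_simps)
    \<comment> \<open>An edge lies on a supporting line, so it misses the interior and is projected
      into the frontier.\<close>
    have "y \<notin> interior K"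
    proof
      assume "y \<in> interior K"
      then obtain e where e: "e > 0" "cball y e \<subseteq> K" using mem_interior_cball by blast
      have "y + e *\<^sub>R unit_dir (\<theta> (Suc i)) \<in> K" using e by (intro subsetD[OF e(2)]) (auto simp: dist_norm)
      from supp_upper[OF K(1) this, of "\<theta> (Suc i)"] show False
        using yh e(1) by (simp add: inner_add_left unit_frame h_def)
    qed
    then show "x \<in> frontier K" unfolding y(3) by (intro closest_point_frontier Kcl K)
  next
    fix y assume y: "y \<in> frontier K"
    then have yK: "y \<in> K" using Kcl by (auto simp: frontier_def)
    obtain u where u: "u \<noteq> 0" "\<And>z. z \<in> K \<Longrightarrow> z \<bullet> u \<le> y \<bullet> u" using supporting_normal[OF K(2) y] by blast
    define J where "J = {i \<in> {1..n}. u \<bullet> unit_dir (\<theta> i) > 0}"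
    \<comment> \<open>For \<open>j\<close> in \<open>J\<close>, \<open>q j\<close> is the parameter
      at which the ray from \<open>y\<close> along \<open>u\<close> meets the \<open>j\<close>-th
      supporting line; the smallest one gives the point where the ray leaves the polygon.\<close>
    define q where "q i = (h i - y \<bullet> unit_dir (\<theta> i)) / (u \<bullet> unit_dir (\<theta> i))" for i
    have "J \<noteq> {}"
    proof -
      have dirs: "unit_dir (\<theta> m) = (0, 1)" "unit_dir (\<theta> (2 * m)) = (-1, 0)" "unit_dir (\<theta> (3 * m)) = (0, -1)" "unit_dir (\<theta> (4 * m)) = (1, 0)"
      proof -
        have "\<theta> m = pi / 2" "\<theta> (2 * m) = pi" "\<theta> (3 * m) = 3 / 2 * pi" "\<theta> (4 * m) = 2 * pi"
          using m by (simp_all add: \<theta>_def d_def)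
        note th = this
        show "unit_dir (\<theta> m) = (0, 1)" "unit_dir (\<theta> (2 * m)) = (-1, 0)" "unit_dir (\<theta> (3 * m)) = (0, -1)" "unit_dir (\<theta> (4 * m)) = (1, 0)"
          unfolding unit_dir_def th
          by (simp_all only: cos_3over2_pi sin_3over2_pi cos_pi_half sin_pi_half cos_pi sin_pi cos_two_pi sin_two_pi)
      qed
      have "fst u \<noteq> 0 \<or> snd u \<noteq> 0" using u(1) by (auto simp: prod_eq_iff)
      then consider "fst u > 0" | "fst u < 0" | "snd u > 0" | "snd u < 0" by linarith
      then show ?thesis
      proof cases
        case 1 then have "4 * m \<in> J" using dirs m by (auto simp: J_def n_def inner_prod_def)
        then show ?thesis by blast
      next
        case 2 then have "2 * m \<in> J" using dirs m by (auto simp: J_def n_def inner_prod_def)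
        then show ?thesis by blast
      next
        case 3 then have "m \<in> J" using dirs m by (auto simp: J_def n_def inner_prod_def)
        then show ?thesis by blast
      next
        case 4 then have "3 * m \<in> J" using dirs m by (auto simp: J_def n_def inner_prod_def)
        then show ?thesis by blast
      qed
    qed
    moreover have "finite J" by (simp add: J_def)
    ultimately obtain i where i: "i \<in> J" "\<And>j. j \<in> J \<Longrightarrow> q i \<le> q j"
      by (metis arg_min_if_finite(1) arg_min_least)
    define x where "x = y + q i *\<^sub>R u"
    have yh: "y \<bullet> unit_dir (\<theta> j) \<le> h j" for j unfolding h_def by (rule supp_upper[OF K(1) yK])
    have q0: "q i \<ge> 0" using yh[of i] i(1) by (simp add: q_def J_def)
    have xi: "x \<bullet> unit_dir (\<theta> i) = h i" using i(1) by (simp add: x_def inner_add_left q_def J_def)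
    have xj: "x \<bullet> unit_dir (\<theta> j) \<le> h j" if "j \<in> {1..n}" for j
    proof (cases "j \<in> J")
      case True
      then have "q i * (u \<bullet> unit_dir (\<theta> j)) \<le> q j * (u \<bullet> unit_dir (\<theta> j))"
        using i(2)[OF True] by (intro mult_right_mono) (auto simp: J_def)
      also have "\<dots> = h j - y \<bullet> unit_dir (\<theta> j)" using True by (simp add: q_def J_def)
      finally show ?thesis by (simp add: x_def inner_add_left)
    next
      case False
      then have "q i * (u \<bullet> unit_dir (\<theta> j)) \<le> 0" using that q0 by (intro mult_nonneg_nonpos) (auto simp: J_def)
      then show ?thesis using yh[of j] by (simp add: x_def inner_add_left)
    qed
    \<comment> \<open>The neighbours of index \<open>i\<close> may be 0 and \<open>Suc n\<close>,
      outside the range of \<open>J\<close>; periodicity takes care of these.\<close>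
    have xj': "x \<bullet> unit_dir (\<theta> j) \<le> h j" if "j \<le> Suc n" for j
    proof -
      consider "j = 0" | "j = Suc n" | "j \<in> {1..n}" using \<open>j \<le> Suc n\<close> by force
      then show ?thesis
      proof cases
        case 1 then show ?thesis using xj[of n] \<open>n > 0\<close> hn[of 0] \<theta>n[of 0] by simp
      next
        case 2 then show ?thesis using xj[of 1] \<open>n > 0\<close> hn[of 1] \<theta>n[of 1] by simp
      qed (rule xj)
    qed
    obtain k where k: "i = Suc k" "k < n" using i(1) by (cases i) (auto simp: J_def)
    define c where "c = x \<bullet> unit_normal (\<theta> (Suc k))"
    have x_eq: "x = h (Suc k) *\<^sub>R unit_dir (\<theta> (Suc k)) + c *\<^sub>R unit_normal (\<theta> (Suc k))"
      using unit_frame_expand[of x "\<theta> (Suc k)"] xi k by (simp add: c_def)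
    \<comment> \<open>The two neighbouring supporting lines bound the position of \<open>x\<close>
      along its own line, and these bounds are the two vertices.\<close>
    have "x \<bullet> unit_dir (\<theta> (Suc k) + d) \<le> h (Suc (Suc k))" using xj'[of "Suc (Suc k)"] k by (simp add: \<theta>S)
    then have "h (Suc k) * cos d + c * sin d \<le> h (Suc (Suc k))"
      using xi k by (simp add: unit_dir_add inner_add_right c_def mult.commute)
    then have c1: "c \<le> (h (Suc (Suc k)) - h (Suc k) * cos d) / sin d" using sd by (simp add: le_divide_eq)
    have "x \<bullet> unit_dir (\<theta> (Suc k) - d) \<le> h k" using xj'[of k] k by (simp add: \<theta>S)
    then have "h (Suc k) * cos d - c * sin d \<le> h k"
      using xi k by (simp add: unit_dir_diff inner_diff_right c_def mult.commute)
    then have c2: "- ((h k - h (Suc k) * cos d) / sin d) \<le> c" using sd by (simp add: minus_divide_left divide_le_eq)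
    have "x \<in> closed_segment (V k) (V (Suc k))"
    proof -
      define c' where "c' = c + (h k - h (Suc k) * cos d) / sin d"
      have "l k = (h (Suc (Suc k)) - h (Suc k) * cos d) / sin d + (h k - h (Suc k) * cos d) / sin d"
        unfolding l_def add_divide_distrib[symmetric] by (simp add: algebra_simps)
      then have c': "0 \<le> c'" "c' \<le> l k"
        using c1 c2 unfolding c'_def by linarith+
      have xV: "x = V k + c' *\<^sub>R unit_normal (\<theta> (Suc k))"
        unfolding x_eq V'[of k] c'_def by (simp add: scaleR_add_left)
      show ?thesis
      proof (cases "l k = 0")
        case True
        then show ?thesis using c' xV by simp
      next
        case False
        then have "l k > 0" using l_nonneg[of k] by simp
        have "x = V k + (c' / l k) *\<^sub>R (V (Suc k) - V k)" unfolding xV VV using False by simp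
        also have "\<dots> = (1 - c' / l k) *\<^sub>R V k + (c' / l k) *\<^sub>R V (Suc k)" by (simp add: algebra_simps)
        finally show ?thesis using c' \<open>l k > 0\<close> by (auto simp: in_segment intro!: exI[of _ "c' / l k"])
      qed
    qed
    then have "x \<in> path_image p" using k unfolding img by blast
    moreover have "closest_point K x = y"
      unfolding x_def by (rule closest_point_normal[OF K(2) Kcl yK u(2) q0])
    ultimately show "y \<in> path_image g" unfolding g_def path_image_compose by blast
  qed
  moreover have "curve_length g \<le> ereal (2 * (1 - cos d) / sin d * (\<Sum>i<4 * m. supp K (real i * d)))"
  proof -
    have "length_majorant g (\<Sum>i<n. dist (V i) (V (Suc i))) F"
      unfolding g_def by (rule length_majorant_lipschitz_comp[OF p(5)]) (rule closest_point_lipschitz[OF K(2) Kcl K(3)])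
    from curve_length_le_majorant[OF this] show ?thesis unfolding len by (simp add: n_def h_def \<theta>_def)
  qed
  ultimately show ?thesis by blast
qed

theorem perimeter_eq_integral_supp:
  fixes K :: "(real \<times> real) set"
  assumes K: "compact K" "convex K" "K \<noteq> {}"
  shows "perimeter K = integral {0..2*pi} (supp K)"
proof -
  let ?I = "integral {0..2*pi} (supp K)"
  let ?G = "{g. path g \<and> pathfinish g = pathstart g \<and> path_image g = frontier K}"
  define R where "R n = 2 * pi / real n * (\<Sum>i<n. supp K (2 * pi * real i / real n))" for n
  have R: "R \<longlonglongrightarrow> ?I" unfolding R_def by (rule supp_riemann[OF K(1,3)])
  \<comment> \<open>The polygon has length \<open>c m\<close> times the Riemann sum over
    \<open>4 * m\<close> directions, and \<open>2 * (1 - cos d) / (d * sin d)\<close> tends to 1 as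
    \<open>d\<close> tends to 0.\<close>
  define c where "c m = 2 * (1 - cos (pi / (2 * real m))) / sin (pi / (2 * real m)) / (pi / (2 * real m))" for m :: nat
  have c: "c \<longlonglongrightarrow> 1" unfolding c_def by real_asymp
  have sub: "filterlim (\<lambda>m::nat. 4 * m) sequentially sequentially"
    by (rule filterlim_subseq) (simp add: strict_mono_def)
  have lim: "(\<lambda>m. c m * R (4 * m)) \<longlonglongrightarrow> 1 * ?I"
    by (intro tendsto_mult c filterlim_compose[OF R sub])
  have le: "(INF g\<in>?G. curve_length g) \<le> ereal (c m * R (4 * m))" if mpos: "m > 0" for m
  proof -
    obtain g where g: "g \<in> ?G" "curve_length g \<le> ereal (2 * (1 - cos (pi / (2 * real m))) / sin (pi / (2 * real m)) *
        (\<Sum>i<4 * m. supp K (real i * (pi / (2 * real m)))))"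
      using frontier_curve_exists[OF K mpos] by blast
    define \<delta> where "\<delta> = pi / (2 * real m)"
    have "\<delta> \<noteq> 0" using mpos by (simp add: \<delta>_def)
    have "2 * pi / real (4 * m) = \<delta>" "2 * pi * real i / real (4 * m) = real i * \<delta>" for i
      by (simp_all add: \<delta>_def field_simps)
    then have "c m * R (4 * m) = 2 * (1 - cos \<delta>) / sin \<delta> / \<delta> * (\<delta> * (\<Sum>i<4 * m. supp K (real i * \<delta>)))"
      unfolding R_def c_def \<delta>_def[symmetric] by (simp only:)
    also have "\<dots> = 2 * (1 - cos \<delta>) / sin \<delta> * (\<Sum>i<4 * m. supp K (real i * \<delta>))"
      using \<open>\<delta> \<noteq> 0\<close> by simp
    finally have "c m * R (4 * m) = 2 * (1 - cos (pi / (2 * real m))) / sin (pi / (2 * real m)) *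
        (\<Sum>i<4 * m. supp K (real i * (pi / (2 * real m))))"
      unfolding \<delta>_def .
    then show ?thesis using g by (intro INF_lower2[OF g(1)]) simp
  qed
  have "(INF g\<in>?G. curve_length g) \<le> ereal ?I"
  proof (rule tendsto_lowerbound)
    show "(\<lambda>m. ereal (c m * R (4 * m))) \<longlonglongrightarrow> ereal ?I" using lim by simp
    show "\<forall>\<^sub>F m in sequentially. (INF g\<in>?G. curve_length g) \<le> ereal (c m * R (4 * m))"
      using eventually_gt_at_top[of 0] by eventually_elim (rule le)
  qed simp
  moreover have "ereal ?I \<le> (INF g\<in>?G. curve_length g)"
    using curve_length_ge_integral_supp[OF K(1,3)] by (intro INF_greatest) auto
  ultimately have "(INF g\<in>?G. curve_length g) = ereal ?I" by (rule antisym)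
  then show ?thesis unfolding perimeter_def by simp
qed

section \<open>The expected perimeter\<close>

definition exit_mean :: real where
  "exit_mean = integral {0..pi/2} (\<lambda>t. (1 - 2 * t / (pi/2 + t)) * cos t)"

context planar_BM
begin

lemma dir_sup_eq_supp: "dir_sup (cis (- t)) s \<omega> = supp ((\<lambda>s. (X s \<omega>, Y s \<omega>)) ` {0..s}) t"
proof -
  have "Re (cis (- t) * Z s \<omega>) = (X s \<omega>, Y s \<omega>) \<bullet> unit_dir t" for s
    by (simp add: Z_def unit_dir_def mult.commute)
  then show ?thesis unfolding dir_sup_def supp_def image_image by simp
qed

lemma max_horiz_eq: "max_horiz X Y \<omega> = dir_sup 1 (exit_from (ball 0 1) \<omega>) \<omega>"
  unfolding max_horiz_def dir_sup_def exit_time_eq by (simp add: Z_def)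

lemma AE_dir_sup_bounds:
  assumes "norm u = 1"
  shows "AE \<omega> in M. 0 \<le> dir_sup u (exit_from (ball 0 1) \<omega>) \<omega> \<and> dir_sup u (exit_from (ball 0 1) \<omega>) \<omega> \<le> 1"
proof -
  have "AE \<omega> in M. \<omega> \<in> space M \<and> leaves (ball 0 1) \<omega>" using AE_leaves[of "ball 0 1"] by auto
  then show ?thesis
  proof eventually_elim
    case (elim \<omega>)
    then have \<omega>: "\<omega> \<in> space M" "leaves (ball 0 1) \<omega>" by auto
    have e0: "0 \<le> exit_from (ball 0 1) \<omega>" using exit_from_props(1)[OF _ \<omega>] by simp
    obtain s where s: "s \<in> {0..exit_from (ball 0 1) \<omega>}" "dir_sup u (exit_from (ball 0 1) \<omega>) \<omega> = Re (u * Z s \<omega>)"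
      using dir_sup_attained(1)[OF \<omega>(1) e0] by blast
    have "Z s \<omega> \<in> closure (ball 0 1)" using s(1) by (intro before_exit_in_closure \<omega>) auto
    then have "norm (Z s \<omega>) \<le> 1" by simp
    then have "Re (u * Z s \<omega>) \<le> 1" using complex_Re_le_cmod[of "u * Z s \<omega>"] assms by (simp add: norm_mult)
    moreover have "0 \<le> dir_sup u (exit_from (ball 0 1) \<omega>) \<omega>"
      using dir_sup_attained(2)[OF \<omega>(1) e0, of 0 u] e0 by (simp add: Z_0[OF \<omega>(1)])
    ultimately show ?case using s(2) by simp
  qed
qed

lemma expectation_dir_sup:
  assumes "norm u = 1"
  shows "expectation (\<lambda>\<omega>. dir_sup u (exit_from (ball 0 1) \<omega>) \<omega>) = exit_mean"
  unfolding exit_mean_def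
  by (intro expectation_of_exit_cdf dir_sup_exit_measurable AE_dir_sup_bounds[OF assms] prob_dir_sup[OF assms])

text \<open>Sums over finitely many directions replace the integral over directions, so each
  direction can be treated by itself and no joint measurability in direction and outcome comes
  in.\<close>

definition dir_riemann :: "nat \<Rightarrow> 'a \<Rightarrow> real" where
  "dir_riemann n \<omega> = 2 * pi / real n * (\<Sum>i<n. dir_sup (cis (- (2 * pi * real i / real n))) (exit_from (ball 0 1) \<omega>) \<omega>)"

lemma dir_riemann_measurable[measurable]: "dir_riemann n \<in> borel_measurable M"
  unfolding dir_riemann_def using dir_sup_exit_measurable by measurable

lemma dir_riemann_tendsto:
  assumes \<omega>: "\<omega> \<in> space M" and e0: "0 \<le> exit_from (ball 0 1) \<omega>"
  shows "(\<lambda>n. dir_riemann n \<omega>) \<longlonglongrightarrow> hull_perimeter X Y \<omega>"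
proof -
  let ?A = "(\<lambda>s. (X s \<omega>, Y s \<omega>)) ` {0..exit_from (ball 0 1) \<omega>}"
  have "continuous_on {0..} (\<lambda>t. X t \<omega>)" "continuous_on {0..} (\<lambda>t. Y t \<omega>)"
    using BM \<omega> by (auto simp: std_planar_BM_def)
  then have cont: "continuous_on {0..exit_from (ball 0 1) \<omega>} (\<lambda>s. (X s \<omega>, Y s \<omega>))"
    by (intro continuous_on_Pair) (auto elim: continuous_on_subset)
  have A: "compact ?A" "?A \<noteq> {}"
    using e0 by (auto intro!: compact_continuous_image[OF cont])
  have "hull_perimeter X Y \<omega> = perimeter (convex hull ?A)"
    by (simp add: hull_perimeter_def exit_time_eq)
  also have "\<dots> = integral {0..2*pi} (supp (convex hull ?A))"
    using A by (intro perimeter_eq_integral_supp compact_convex_hull convex_convex_hull) auto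
  also have "supp (convex hull ?A) = supp ?A" by (intro ext supp_convex_hull A)
  finally show ?thesis
    using supp_riemann[OF A] by (simp add: dir_riemann_def[abs_def] dir_sup_eq_supp)
qed

lemma hull_perimeter_measurable: "hull_perimeter X Y \<in> borel_measurable M"
proof -
  \<comment> \<open>A negative exit time, possible only through \<open>Inf {}\<close>, leaves an
    empty path; hence the separate constant.\<close>
  have "hull_perimeter X Y \<omega> = (if exit_from (ball 0 1) \<omega> < 0 then perimeter {} else lim (\<lambda>n. dir_riemann n \<omega>))"
    if "\<omega> \<in> space M" for \<omega>
    using limI[OF dir_riemann_tendsto[OF that]] by (auto simp: hull_perimeter_def exit_time_eq)
  moreover have "(\<lambda>\<omega>. if exit_from (ball 0 1) \<omega> < 0 then perimeter {} else lim (\<lambda>n. dir_riemann n \<omega>)) \<in> borel_measurable M"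
    by measurable
  ultimately show ?thesis by (subst measurable_cong) auto
qed

text \<open>All directions have the same mean, so every Riemann sum has mean exactly
  \<open>2 * pi * exit_mean\<close>. Displacements in the unit interval give the dominating constant
  \<open>2 * pi\<close>.\<close>

lemma expectation_hull_perimeter: "expectation (hull_perimeter X Y) = 2 * pi * exit_mean"
proof -
  have AE_all: "AE \<omega> in M. \<forall>n i. 0 \<le> dir_sup (cis (- (2 * pi * real i / real (Suc n)))) (exit_from (ball 0 1) \<omega>) \<omega> \<and>
      dir_sup (cis (- (2 * pi * real i / real (Suc n)))) (exit_from (ball 0 1) \<omega>) \<omega> \<le> 1"
    unfolding AE_all_countable by (intro allI AE_dir_sup_bounds) simp
  have "(\<lambda>n. expectation (dir_riemann (Suc n))) \<longlonglongrightarrow> expectation (hull_perimeter X Y)"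
  proof (rule integral_dominated_convergence[where w="\<lambda>_. 2 * pi"])
    have "AE \<omega> in M. \<omega> \<in> space M \<and> leaves (ball 0 1) \<omega>" using AE_leaves[of "ball 0 1"] by auto
    then show "AE \<omega> in M. (\<lambda>n. dir_riemann (Suc n) \<omega>) \<longlonglongrightarrow> hull_perimeter X Y \<omega>"
      by eventually_elim (use exit_from_props(1)[of "ball 0 1"] in \<open>auto intro!: LIMSEQ_Suc dir_riemann_tendsto\<close>)
    show "AE \<omega> in M. norm (dir_riemann (Suc n) \<omega>) \<le> 2 * pi" for n
      using AE_all
    proof eventually_elim
      case (elim \<omega>)
      define S where "S = (\<Sum>i<Suc n. dir_sup (cis (- (2 * pi * real i / real (Suc n)))) (exit_from (ball 0 1) \<omega>) \<omega>)"
      have "S \<le> (\<Sum>i<Suc n. 1)" unfolding S_def using elim by (intro sum_mono) blast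
      then have S1: "S \<le> real (Suc n)" by simp
      have S0: "0 \<le> S" unfolding S_def using elim by (intro sum_nonneg) blast
      have "dir_riemann (Suc n) \<omega> = 2 * pi * (S / real (Suc n))" by (simp add: dir_riemann_def S_def)
      moreover have "0 \<le> S / real (Suc n)" "S / real (Suc n) \<le> 1" using S0 S1 by (auto simp: divide_le_eq)
      ultimately show ?case
        using mult_left_mono[of "S / real (Suc n)" 1 "2 * pi"] S0 by (simp add: abs_mult)
    qed
  qed (auto intro: hull_perimeter_measurable)
  moreover have "expectation (dir_riemann (Suc n)) = 2 * pi * exit_mean" for n
  proof -
    have int: "integrable M (\<lambda>\<omega>. dir_sup (cis t) (exit_from (ball 0 1) \<omega>) \<omega>)" for t
    proof (rule integrable_const_bound[where B=1])
      have "norm (cis t) = 1" by simp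
      from AE_dir_sup_bounds[OF this]
      show "AE \<omega> in M. norm (dir_sup (cis t) (exit_from (ball 0 1) \<omega>) \<omega>) \<le> 1"
        by eventually_elim simp
    qed (rule dir_sup_exit_measurable)
    have "expectation (dir_riemann (Suc n)) = 2 * pi / real (Suc n) * (\<Sum>i<Suc n. exit_mean)"
      unfolding dir_riemann_def using int
      by (simp only: integral_mult_right_zero Bochner_Integration.integral_sum expectation_dir_sup norm_cis)
    then show ?thesis by (simp del: of_nat_Suc)
  qed
  ultimately show ?thesis by (simp add: LIMSEQ_const_iff)
qed

end

theorem theorem1p1:
  fixes M :: "'a measure" and X Y :: "real \<Rightarrow> 'a \<Rightarrow> real"
  assumes "std_planar_BM M X Y"
  shows "(\<forall>a. 0 < a \<and> a < 1 \<longrightarrow>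
            measure M {\<omega> \<in> space M. max_horiz X Y \<omega> < a} = 2 * arcsin a / (pi - arccos a))
      \<and> (\<integral>\<omega>. max_horiz X Y \<omega> \<partial>M) = integral {0..pi/2} (\<lambda>t. (1 - 2 * t / (pi/2 + t)) * cos t)
      \<and> \<bar>(\<integral>\<omega>. max_horiz X Y \<omega> \<partial>M) - 0.511655\<bar> < 0.000001
      \<and> (\<integral>\<omega>. hull_perimeter X Y \<omega> \<partial>M) = 2 * pi * (\<integral>\<omega>. max_horiz X Y \<omega> \<partial>M)
      \<and> \<bar>(\<integral>\<omega>. hull_perimeter X Y \<omega> \<partial>M) - 3.214826\<bar> < 0.000001"
proof -
  interpret planar_BM M X Y by standard (rule assms)
  have mean: "(\<integral>\<omega>. max_horiz X Y \<omega> \<partial>M) = exit_mean"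
    unfolding max_horiz_eq by (rule expectation_dir_sup) simp
  have per: "(\<integral>\<omega>. hull_perimeter X Y \<omega> \<partial>M) = 2 * pi * exit_mean"
    by (rule expectation_hull_perimeter)
  have b: "51165546 / 100000000 \<le> exit_mean" "exit_mean \<le> 51165550 / 100000000"
    using exit_mean_numeric unfolding exit_mean_def[symmetric] abs_le_iff by linarith+
  \<comment> \<open>Naming the product keeps the final comparison linear.\<close>
  define x where "x = pi * exit_mean"
  have "3.1415926535 * (51165546 / 100000000) \<le> x" "x \<le> 3.1415926536 * (51165550 / 100000000)"
    unfolding x_def using b pi_bounds by (intro mult_mono; simp)+
  then have "\<bar>2 * x - 3.214826\<bar> < 0.000001"
    unfolding abs_less_iff by simp
  then have "\<bar>2 * pi * exit_mean - 3.214826\<bar> < 0.000001"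
    unfolding x_def mult.assoc .
  moreover have "\<bar>exit_mean - 0.511655\<bar> < 0.000001"
    using b unfolding abs_less_iff by simp
  moreover have "measure M {\<omega> \<in> space M. max_horiz X Y \<omega> < a} = 2 * arcsin a / (pi - arccos a)" if "0 < a" "a < 1" for a
    unfolding max_horiz_eq using that by (intro prob_dir_sup) simp
  ultimately show ?thesis
    unfolding mean per by (auto simp: exit_mean_def)
qed

end
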